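(* Let $(\mathfrak A,\theta)$ be a unital $\mathbb Z_2$-graded $C^*$-algebra, let $(\mathfrak A,\{\iota_j:j\in\mathbb N\},\mathcal H,\xi)$ be a $\mathbb Z_2$-graded process with corresponding state $\omega$ on $\hat\otimes_{\max}^{\mathbb N}\mathfrak A$, and let $E_\omega:\pi_\omega(\hat\otimes_{\max}^{\mathbb N}\mathfrak A)''\to\mathfrak Z^\perp_\omega$ be the normal conditional expectation onto the tail algebra preserving the vector state $\langle\cdot\,\xi_\omega,\xi_\omega\rangle$. The process is exchangeable if and only if: (i) it is conditionally independent with respect to $E_\omega$, namely $E_\omega[XY]=E_\omega[X]E_\omega[Y]$ for every $X\in\big(\bigvee_{i\in I}\iota_i(\mathfrak A)\big)\vee\mathfrak Z^\perp_\omega$ and $Y\in\big(\bigvee_{j\in J}\iota_j(\mathfrak A)\big)\vee\mathfrak Z^\perp_\omega$, and all finite disjoint subsets $I,J\subset\mathbb N$; and (ii) it is identically distributed with respect to $E_\omega$, namely $E_\omega[\iota_j(a)]=E_\omega[\iota_k(a)]$ for every $j,k\in\mathbb N$ and $a\in\mathfrak A$.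
   Context: A $\mathbb Z_2$-graded $C^*$-algebra is a pair $(\mathfrak A,\theta)$ with $\theta$ a $*$-automorphism, $\theta^2=\mathrm{id}$; $a$ is even if $\theta(a)=a$, odd if $\theta(a)=-a$, homogeneous if even or odd. A quantum stochastic process is a quadruple $(\mathfrak A,\{\iota_j:j\in\mathbb N\},\mathcal H,\xi)$ where $\mathfrak A$ is a unital $C^*$-algebra, $\mathcal H$ a Hilbert space, each $\iota_j:\mathfrak A\to\mathcal B(\mathcal H)$ a (unital) $*$-representation, and $\xi\in\mathcal H$ a unit vector cyclic for the von Neumann algebra $\bigvee_{j\in\mathbb N}\iota_j(\mathfrak A)$ ($\bigvee$ denotes the generated von Neumann algebra). It is a $\mathbb Z_2$-graded process if $\mathfrak A$ is $\mathbb Z_2$-graded and, for homogeneous $a,b\in\mathfrak A$ and $j\ne k$, $\iota_j(a)$ and $\iota_k(b)$ commute if at least one of $a,b$ is even and anticommute if both are odd. It is exchangeable if for every $n\in\mathbb N$, $j_1\neq j_2\neq\cdots\neq j_n$ in $\mathbb N$, $a_1,\dots,a_n\in\mathfrak A$ and every permutation $\sigma$ of $\mathbb N$ moving finitely many points, $\langle\iota_{j_1}(a_1)\cdots\iota_{j_n}(a_n)\xi,\xi\rangle=\langle\iota_{\sigma(j_1)}(a_1)\cdots\iota_{\sigma(j_n)}(a_n)\xi,\xi\rangle$. $\hat\otimes_{\max}^{\mathbb N}\mathfrak A$ is (isomorphic to) the quotient of the infinite unital free product $*^{\mathbb N}\mathfrak A$, with embeddings $i_j:\mathfrak A\to *^{\mathbb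 N}\mathfrak A$, by the closed two-sided ideal generated by the graded commutators of $i_j(a)$ and $i_k(b)$, $j\ne k$, $a,b\in\mathfrak A$ homogeneous (commutator if at least one of $a,b$ is even, anticommutator if both are odd); the induced maps $\mathfrak A\to\hat\otimes_{\max}^{\mathbb N}\mathfrak A$ are still denoted $i_j$. States $\omega$ of $\hat\otimes_{\max}^{\mathbb N}\mathfrak A$ correspond one-to-one to $\mathbb Z_2$-graded processes (up to unitary equivalence) via the GNS triple: $\mathcal H=\mathcal H_\omega$, $\xi=\xi_\omega$, $\iota_j=\pi_\omega\circ i_j$. The tail algebra is $\mathfrak Z^\perp_\omega=\bigcap_{n\ge1}\bigvee_{I}\pi_\omega(\mathfrak A(I))''$, with $I$ ranging over the finite subsets of $\{n,n+1,\dots\}$ and $\mathfrak A(I)$ the $C^*$-algebra generated by $i_j(\mathfrak A)$, $j\in I$; equivalently $\mathfrak Z^\perp_\omega=\bigcap_{n\ge1}\bigvee_{j\ge n}\iota_j(\mathfrak A)$. *)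

theory Defs
  imports "HOL-Analysis.Analysis"
begin

section \<open>Complex Hilbert spaces and unital C*-algebras\<close>

class complex_vector = real_vector +
  fixes scaleC :: "complex \<Rightarrow> 'a \<Rightarrow> 'a"  (infixr \<open>*\<^sub>C\<close> 75)
  assumes scaleC_add_right: "c *\<^sub>C (x + y) = c *\<^sub>C x + c *\<^sub>C y"
    and scaleC_add_left: "(c + d) *\<^sub>C x = c *\<^sub>C x + d *\<^sub>C x"
    and scaleC_scaleC: "c *\<^sub>C d *\<^sub>C x = (c * d) *\<^sub>C x"
    and scaleC_one: "1 *\<^sub>C x = x"
    and scaleR_scaleC: "r *\<^sub>R x = complex_of_real r *\<^sub>C x"

class complex_normed_vector = complex_vector + real_normed_vector +
  assumes norm_scaleC: "norm (c *\<^sub>C x) = cmod c * norm x"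

text \<open>The inner product is linear in its first argument.\<close>

class complex_inner = complex_normed_vector +
  fixes cinner :: "'a \<Rightarrow> 'a \<Rightarrow> complex"
  assumes cinner_commute: "cinner x y = cnj (cinner y x)"
    and cinner_add_left: "cinner (x + y) z = cinner x z + cinner y z"
    and cinner_scaleC_left: "cinner (c *\<^sub>C x) y = c * cinner x y"
    and cinner_same: "cinner x x = complex_of_real ((norm x)\<^sup>2)"

class chilbert_space = complex_inner + complete_space

class unital_cstar_algebra = complex_normed_vector + real_normed_algebra_1 + complete_space +
  fixes star :: "'a \<Rightarrow> 'a"
  assumes mult_scaleC_left: "(c *\<^sub>C x) * y = c *\<^sub>C (x * y)"
    and mult_scaleC_right: "x * (c *\<^sub>C y) = c *\<^sub>C (x * y)"
    and star_star: "star (star x) = x"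
    and star_add: "star (x + y) = star x + star y"
    and star_scaleC: "star (c *\<^sub>C x) = cnj c *\<^sub>C star x"
    and star_mult: "star (x * y) = star y * star x"
    and cstar_identity: "norm (star x * x) = (norm x)\<^sup>2"


section \<open>The Hilbert space of square-summable families\<close>

typedef 'i ell2 = "{f :: 'i \<Rightarrow> complex. (\<lambda>i. (cmod (f i))\<^sup>2) summable_on UNIV}"
  morphisms coord Abs_ell2
  by (rule exI[of _ "\<lambda>_. 0"]) simp

setup_lifting type_definition_ell2

lemma square_summable_iff:
  fixes f :: "'i \<Rightarrow> complex"
  shows "(\<lambda>i. (cmod (f i))\<^sup>2) summable_on UNIV \<longleftrightarrow>
    (\<exists>B. \<forall>F. finite F \<longrightarrow> L2_set (\<lambda>i. cmod (f i)) F \<le> B)"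
proof
  assume s: "(\<lambda>i. (cmod (f i))\<^sup>2) summable_on UNIV"
  have "L2_set (\<lambda>i. cmod (f i)) F \<le> sqrt (\<Sum>\<^sub>\<infinity>i. (cmod (f i))\<^sup>2)" if "finite F" for F
    unfolding L2_set_def using finite_sum_le_infsum[OF s that] by simp
  thus "\<exists>B. \<forall>F. finite F \<longrightarrow> L2_set (\<lambda>i. cmod (f i)) F \<le> B" by blast
next
  assume "\<exists>B. \<forall>F. finite F \<longrightarrow> L2_set (\<lambda>i. cmod (f i)) F \<le> B"
  then obtain B where B: "\<And>F. finite F \<Longrightarrow> L2_set (\<lambda>i. cmod (f i)) F \<le> B" by blast
  have "sum (\<lambda>i. (cmod (f i))\<^sup>2) F \<le> B\<^sup>2" if "finite F" for F
    using sqrt_le_D[OF B[OF that, unfolded L2_set_def]] .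
  thus "(\<lambda>i. (cmod (f i))\<^sup>2) summable_on UNIV"
    by (intro nonneg_bdd_above_summable_on bdd_aboveI2[of _ _ "B\<^sup>2"]) auto
qed

lemma coord_summable: "(\<lambda>i. (cmod (coord x i))\<^sup>2) summable_on UNIV"
  using coord[of x] by simp

lemma square_summable_add:
  fixes f g :: "'i \<Rightarrow> complex"
  assumes "(\<lambda>i. (cmod (f i))\<^sup>2) summable_on UNIV" "(\<lambda>i. (cmod (g i))\<^sup>2) summable_on UNIV"
  shows "(\<lambda>i. (cmod (f i + g i))\<^sup>2) summable_on UNIV"
proof -
  obtain B where B: "\<And>F. finite F \<Longrightarrow> L2_set (\<lambda>i. cmod (f i)) F \<le> B"
    using assms(1) square_summable_iff[of f] by blast
  obtain C where C: "\<And>F. finite F \<Longrightarrow> L2_set (\<lambda>i. cmod (g i)) F \<le> C"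
    using assms(2) square_summable_iff[of g] by blast
  have "L2_set (\<lambda>i. cmod (f i + g i)) F \<le> B + C" if "finite F" for F
  proof -
    have "L2_set (\<lambda>i. cmod (f i + g i)) F \<le> L2_set (\<lambda>i. cmod (f i) + cmod (g i)) F"
      by (intro L2_set_mono) (auto intro: norm_triangle_ineq)
    also have "\<dots> \<le> L2_set (\<lambda>i. cmod (f i)) F + L2_set (\<lambda>i. cmod (g i)) F"
      by (rule L2_set_triangle_ineq)
    finally show ?thesis using B[OF that] C[OF that] by linarith
  qed
  thus ?thesis using square_summable_iff[of "\<lambda>i. f i + g i"] by blast
qed

lemma square_summable_scale:
  fixes f :: "'i \<Rightarrow> complex"
  assumes "(\<lambda>i. (cmod (f i))\<^sup>2) summable_on UNIV"
  shows "(\<lambda>i. (cmod (c * f i))\<^sup>2) summable_on UNIV"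
  using summable_on_cmult_right[OF assms, of "(cmod c)\<^sup>2"]
  by (simp add: norm_mult power_mult_distrib)

instantiation ell2 :: (type) complex_vector
begin

lift_definition zero_ell2 :: "'a ell2" is "\<lambda>_. 0" by simp
lift_definition plus_ell2 :: "'a ell2 \<Rightarrow> 'a ell2 \<Rightarrow> 'a ell2" is "\<lambda>f g i. f i + g i"
  by (rule square_summable_add)
lift_definition uminus_ell2 :: "'a ell2 \<Rightarrow> 'a ell2" is "\<lambda>f i. - f i" by simp
lift_definition minus_ell2 :: "'a ell2 \<Rightarrow> 'a ell2 \<Rightarrow> 'a ell2" is "\<lambda>f g i. f i - g i"
  using square_summable_add[of _ "\<lambda>i. - _ i"] by force
lift_definition scaleC_ell2 :: "complex \<Rightarrow> 'a ell2 \<Rightarrow> 'a ell2" is "\<lambda>c f i. c * f i"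
  by (rule square_summable_scale)
lift_definition scaleR_ell2 :: "real \<Rightarrow> 'a ell2 \<Rightarrow> 'a ell2" is "\<lambda>r f i. complex_of_real r * f i"
  by (rule square_summable_scale)

instance
  by standard (transfer; auto simp: fun_eq_iff algebra_simps)+

end

lemmas coord_simps = zero_ell2.rep_eq plus_ell2.rep_eq uminus_ell2.rep_eq minus_ell2.rep_eq
  scaleC_ell2.rep_eq scaleR_ell2.rep_eq

instantiation ell2 :: (type) complex_inner
begin

definition cinner_ell2 :: "'a ell2 \<Rightarrow> 'a ell2 \<Rightarrow> complex"
  where "cinner_ell2 x y = (\<Sum>\<^sub>\<infinity>i. coord x i * cnj (coord y i))"
definition norm_ell2 :: "'a ell2 \<Rightarrow> real"
  where "norm_ell2 x = sqrt (\<Sum>\<^sub>\<infinity>i. (cmod (coord x i))\<^sup>2)"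
definition dist_ell2 :: "'a ell2 \<Rightarrow> 'a ell2 \<Rightarrow> real"
  where "dist_ell2 x y = norm (x - y)"
definition sgn_ell2 :: "'a ell2 \<Rightarrow> 'a ell2"
  where "sgn_ell2 x = x /\<^sub>R norm x"
definition uniformity_ell2 :: "('a ell2 \<times> 'a ell2) filter"
  where "uniformity_ell2 = (INF e\<in>{0<..}. principal {(x :: 'a ell2, y). dist x y < e})"
definition open_ell2 :: "'a ell2 set \<Rightarrow> bool"
  where "open_ell2 U \<longleftrightarrow> (\<forall>x\<in>U. \<forall>\<^sub>F (x', y) in uniformity. x' = x \<longrightarrow> y \<in> U)"

lemma L2_set_le_norm_ell2: "finite F \<Longrightarrow> L2_set (\<lambda>i. cmod (coord x i)) F \<le> norm x"
  unfolding L2_set_def norm_ell2_def using finite_sum_le_infsum[OF coord_summable[of x], of F] by simp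

lemma norm_ell2_le:
  assumes "\<And>F. finite F \<Longrightarrow> L2_set (\<lambda>i. cmod (coord x i)) F \<le> B"
  shows "norm x \<le> B"
proof -
  have "0 \<le> B" using assms[of "{}"] by simp
  have "sum (\<lambda>i. (cmod (coord x i))\<^sup>2) F \<le> B\<^sup>2" if "finite F" for F
    using sqrt_le_D[OF assms[OF that, unfolded L2_set_def]] .
  hence "(\<Sum>\<^sub>\<infinity>i. (cmod (coord x i))\<^sup>2) \<le> B\<^sup>2"
    by (intro infsum_le_finite_sums[OF coord_summable])
  thus ?thesis unfolding norm_ell2_def using \<open>0 \<le> B\<close> by (simp add: real_le_lsqrt)
qed

lemma coord_le_norm_ell2: "cmod (coord x i) \<le> norm x"
  using L2_set_le_norm_ell2[of "{i}" x] by simp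

lemma coord_mult_summable: "(\<lambda>i. coord x i * cnj (coord y i)) summable_on UNIV"
proof (rule abs_summable_summable, rule summable_on_comparison_test)
  show "(\<lambda>i. (cmod (coord x i))\<^sup>2 + (cmod (coord y i))\<^sup>2) summable_on UNIV"
    by (intro summable_on_add coord_summable)
  show "norm (coord x i * cnj (coord y i)) \<le> (cmod (coord x i))\<^sup>2 + (cmod (coord y i))\<^sup>2" for i
  proof -
    have "0 \<le> (cmod (coord x i) - cmod (coord y i))\<^sup>2" "0 \<le> cmod (coord x i) * cmod (coord y i)"
      by simp_all
    thus ?thesis unfolding norm_mult complex_mod_cnj power2_diff by linarith
  qed
qed simp

instance
proof
  fix x y z :: "'a ell2" and c :: complex and r :: real
  show "dist x y = norm (x - y)" by (rule dist_ell2_def)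
  show "sgn x = x /\<^sub>R norm x" by (rule sgn_ell2_def)
  show "uniformity = (INF e\<in>{0<..}. principal {(x :: 'a ell2, y). dist x y < e})"
    by (rule uniformity_ell2_def)
  show "open U \<longleftrightarrow> (\<forall>x\<in>U. \<forall>\<^sub>F (x', y) in uniformity. x' = x \<longrightarrow> y \<in> U)" for U :: "'a ell2 set"
    by (rule open_ell2_def)
  show "norm x = 0 \<longleftrightarrow> x = 0"
  proof
    assume "norm x = 0"
    hence "coord x i = 0" for i using coord_le_norm_ell2[of x i] by simp
    thus "x = 0" by (metis coord_inject ext zero_ell2.rep_eq)
  qed (simp add: norm_ell2_def coord_simps)
  show "norm (x + y) \<le> norm x + norm y"
  proof (rule norm_ell2_le)
    fix F :: "'a set" assume F: "finite F"
    have "L2_set (\<lambda>i. cmod (coord (x + y) i)) F \<le> L2_set (\<lambda>i. cmod (coord x i) + cmod (coord y i)) F"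
      by (intro L2_set_mono) (auto simp: coord_simps intro: norm_triangle_ineq)
    also have "\<dots> \<le> L2_set (\<lambda>i. cmod (coord x i)) F + L2_set (\<lambda>i. cmod (coord y i)) F"
      by (rule L2_set_triangle_ineq)
    finally show "L2_set (\<lambda>i. cmod (coord (x + y) i)) F \<le> norm x + norm y"
      using L2_set_le_norm_ell2[OF F, of x] L2_set_le_norm_ell2[OF F, of y] by linarith
  qed
  show nC: "norm (c *\<^sub>C x) = cmod c * norm x" for c
    by (simp add: norm_ell2_def coord_simps norm_mult power_mult_distrib infsum_cmult_right'
        real_sqrt_mult)
  show "norm (r *\<^sub>R x) = \<bar>r\<bar> * norm x" by (simp add: scaleR_scaleC nC)
  show "cinner x y = cnj (cinner y x)"
    unfolding cinner_ell2_def infsum_cnj[symmetric] by (simp add: mult.commute)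
  show "cinner (x + y) z = cinner x z + cinner y z"
    unfolding cinner_ell2_def
    by (simp add: coord_simps distrib_right infsum_add coord_mult_summable)
  show "cinner (c *\<^sub>C x) y = c * cinner x y"
    unfolding cinner_ell2_def by (simp add: coord_simps mult.assoc infsum_cmult_right')
  have "cinner x x = (\<Sum>\<^sub>\<infinity>i. complex_of_real ((cmod (coord x i))\<^sup>2))"
    unfolding cinner_ell2_def by (simp only: complex_norm_square)
  also have "\<dots> = complex_of_real (\<Sum>\<^sub>\<infinity>i. (cmod (coord x i))\<^sup>2)"
    by (intro infsumI has_sum_of_real has_sum_infsum coord_summable)
  finally show "cinner x x = complex_of_real ((norm x)\<^sup>2)"
    unfolding norm_ell2_def by (simp add: infsum_nonneg)
qed

end

instance ell2 :: (type) chilbert_space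
proof
  fix X :: "nat \<Rightarrow> 'a ell2" assume "Cauchy X"
  hence C: "\<exists>N. \<forall>m\<ge>N. \<forall>n\<ge>N. norm (X m - X n) \<le> e" if "e > 0" for e
    using that unfolding Cauchy_def dist_norm by (meson less_imp_le)
  have "Cauchy (\<lambda>n. coord (X n) i)" for i
    unfolding Cauchy_def dist_norm
  proof (intro allI impI)
    fix e :: real assume "0 < e"
    then obtain N where N: "\<forall>m\<ge>N. \<forall>n\<ge>N. norm (X m - X n) \<le> e/2" using C[of "e/2"] by auto
    have "cmod (coord (X m) i - coord (X n) i) < e" if "m \<ge> N" "n \<ge> N" for m n
    proof -
      have "norm (X m - X n) \<le> e/2" using N that by blast
      thus ?thesis
        using coord_le_norm_ell2[of "X m - X n" i] \<open>0 < e\<close> unfolding minus_ell2.rep_eq by linarith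
    qed
    thus "\<exists>N. \<forall>m\<ge>N. \<forall>n\<ge>N. cmod (coord (X m) i - coord (X n) i) < e" by blast
  qed
  hence "\<exists>l. (\<lambda>n. coord (X n) i) \<longlonglongrightarrow> l" for i
    using Cauchy_convergent_iff convergent_def by blast
  then obtain f where f: "\<And>i. (\<lambda>n. coord (X n) i) \<longlonglongrightarrow> f i" by metis
  have lim: "L2_set (\<lambda>i. cmod (coord (X n) i - f i)) F \<le> e"
    if "finite F" and N: "\<forall>m\<ge>N. norm (X n - X m) \<le> e" for n N e F
  proof (rule tendsto_upperbound)
    show "(\<lambda>m. L2_set (\<lambda>i. cmod (coord (X n) i - coord (X m) i)) F)
        \<longlonglongrightarrow> L2_set (\<lambda>i. cmod (coord (X n) i - f i)) F"
      unfolding L2_set_def by (intro tendsto_intros f)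
    show "\<forall>\<^sub>F m in sequentially. L2_set (\<lambda>i. cmod (coord (X n) i - coord (X m) i)) F \<le> e"
      unfolding eventually_sequentially
    proof (intro exI[of _ N] allI impI)
      fix m assume "N \<le> m"
      thus "L2_set (\<lambda>i. cmod (coord (X n) i - coord (X m) i)) F \<le> e"
        using L2_set_le_norm_ell2[OF that(1), of "X n - X m"] N by (fastforce simp: coord_simps)
    qed
  qed simp
  have "(\<lambda>i. (cmod (f i))\<^sup>2) summable_on UNIV"
  proof -
    obtain N where N: "\<forall>m\<ge>N. \<forall>n\<ge>N. norm (X m - X n) \<le> 1" using C[of 1] by auto
    hence "\<forall>F. finite F \<longrightarrow> L2_set (\<lambda>i. cmod (coord (X N) i - f i)) F \<le> 1"
      using lim[of _ N N 1] by auto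
    hence "(\<lambda>i. (cmod (coord (X N) i - f i))\<^sup>2) summable_on UNIV"
      using square_summable_iff[of "\<lambda>i. coord (X N) i - f i"] by blast
    from square_summable_add[OF square_summable_scale[OF this, of "-1"] coord_summable[of "X N"]]
    show ?thesis by simp
  qed
  then obtain x where x: "coord x = f" using Abs_ell2_inverse by blast
  have "X \<longlonglongrightarrow> x"
    unfolding LIMSEQ_def dist_norm
  proof (intro allI impI)
    fix e :: real assume "0 < e"
    then obtain N where N: "\<forall>m\<ge>N. \<forall>n\<ge>N. norm (X m - X n) \<le> e/2" using C[of "e/2"] by auto
    have "norm (X n - x) \<le> e/2" if "n \<ge> N" for n
      by (rule norm_ell2_le) (use lim[of _ N n "e/2"] N that in \<open>auto simp: coord_simps x\<close>)
    thus "\<exists>N. \<forall>n\<ge>N. norm (X n - x) < e" using \<open>0 < e\<close> by (intro exI[of _ N]) force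
  qed
  thus "convergent X" unfolding convergent_def by blast
qed


section \<open>Bounded operators, von Neumann algebras, representations\<close>

definition bounded_clinear :: "('h::chilbert_space \<Rightarrow> 'h) \<Rightarrow> bool" where
  "bounded_clinear T \<longleftrightarrow> bounded_linear T \<and> (\<forall>c x. T (c *\<^sub>C x) = c *\<^sub>C T x)"

definition adj :: "('h::chilbert_space \<Rightarrow> 'h) \<Rightarrow> 'h \<Rightarrow> 'h" where
  "adj T = (THE S. \<forall>x y. cinner (T x) y = cinner x (S y))"

definition commutant :: "('h::chilbert_space \<Rightarrow> 'h) set \<Rightarrow> ('h \<Rightarrow> 'h) set" where
  "commutant S = {T. bounded_clinear T \<and> (\<forall>s\<in>S. T \<circ> s = s \<circ> T)}"

definition von_neumann_algebra :: "('h::chilbert_space \<Rightarrow> 'h) set \<Rightarrow> bool" where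
  "von_neumann_algebra N \<longleftrightarrow> (\<forall>T\<in>N. adj T \<in> N) \<and> commutant (commutant N) = N"

definition vN_gen :: "('h::chilbert_space \<Rightarrow> 'h) set \<Rightarrow> ('h \<Rightarrow> 'h) set" where
  "vN_gen S = von_neumann_algebra hull S"

definition unital_star_rep :: "('a::unital_cstar_algebra \<Rightarrow> 'h::chilbert_space \<Rightarrow> 'h) \<Rightarrow> bool" where
  "unital_star_rep \<rho> \<longleftrightarrow>
    (\<forall>a. bounded_clinear (\<rho> a)) \<and>
    (\<forall>a b. \<rho> (a + b) = (\<lambda>v. \<rho> a v + \<rho> b v)) \<and>
    (\<forall>c a. \<rho> (c *\<^sub>C a) = (\<lambda>v. c *\<^sub>C \<rho> a v)) \<and>
    (\<forall>a b. \<rho> (a * b) = \<rho> a \<circ> \<rho> b) \<and>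
    (\<forall>a. \<rho> (star a) = adj (\<rho> a)) \<and>
    \<rho> 1 = id"


section \<open>Graded processes\<close>

definition grading :: "('a::unital_cstar_algebra \<Rightarrow> 'a) \<Rightarrow> bool" where
  "grading \<theta> \<longleftrightarrow>
    (\<forall>a b. \<theta> (a + b) = \<theta> a + \<theta> b) \<and> (\<forall>c a. \<theta> (c *\<^sub>C a) = c *\<^sub>C \<theta> a) \<and>
    (\<forall>a b. \<theta> (a * b) = \<theta> a * \<theta> b) \<and> (\<forall>a. \<theta> (star a) = star (\<theta> a)) \<and>
    bij \<theta> \<and> \<theta> \<circ> \<theta> = id"

definition even_elt :: "('a::unital_cstar_algebra \<Rightarrow> 'a) \<Rightarrow> 'a \<Rightarrow> bool" where
  "even_elt \<theta> a \<longleftrightarrow> \<theta> a = a"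

definition odd_elt :: "('a::unital_cstar_algebra \<Rightarrow> 'a) \<Rightarrow> 'a \<Rightarrow> bool" where
  "odd_elt \<theta> a \<longleftrightarrow> \<theta> a = - a"

definition homogeneous :: "('a::unital_cstar_algebra \<Rightarrow> 'a) \<Rightarrow> 'a \<Rightarrow> bool" where
  "homogeneous \<theta> a \<longleftrightarrow> even_elt \<theta> a \<or> odd_elt \<theta> a"

definition quantum_stochastic_process ::
    "(nat \<Rightarrow> 'a::unital_cstar_algebra \<Rightarrow> 'h::chilbert_space \<Rightarrow> 'h) \<Rightarrow> 'h \<Rightarrow> bool" where
  "quantum_stochastic_process \<iota> \<xi> \<longleftrightarrow>
    (\<forall>j. unital_star_rep (\<iota> j)) \<and> norm \<xi> = 1 \<and>
    closure {T \<xi> | T. T \<in> vN_gen (\<Union>j. range (\<iota> j))} = UNIV"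

definition graded_process ::
    "('a::unital_cstar_algebra \<Rightarrow> 'a) \<Rightarrow> (nat \<Rightarrow> 'a \<Rightarrow> 'h::chilbert_space \<Rightarrow> 'h) \<Rightarrow> 'h \<Rightarrow> bool" where
  "graded_process \<theta> \<iota> \<xi> \<longleftrightarrow>
    grading \<theta> \<and> quantum_stochastic_process \<iota> \<xi> \<and>
    (\<forall>j k a b. j \<noteq> k \<longrightarrow> homogeneous \<theta> a \<longrightarrow> homogeneous \<theta> b \<longrightarrow>
      (even_elt \<theta> a \<or> even_elt \<theta> b \<longrightarrow> (\<forall>v. \<iota> j a (\<iota> k b v) = \<iota> k b (\<iota> j a v))) \<and>
      (odd_elt \<theta> a \<and> odd_elt \<theta> b \<longrightarrow> (\<forall>v. \<iota> j a (\<iota> k b v) = - \<iota> k b (\<iota> j a v))))"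

fun word_op :: "(nat \<Rightarrow> 'a \<Rightarrow> 'h \<Rightarrow> 'h) \<Rightarrow> (nat \<times> 'a) list \<Rightarrow> 'h \<Rightarrow> 'h" where
  "word_op \<iota> [] = id"
| "word_op \<iota> ((j, a) # w) = \<iota> j a \<circ> word_op \<iota> w"

text \<open>As usual for words in a free product, \<open>j\<^sub>1 \<noteq> j\<^sub>2 \<noteq> \<dots> \<noteq> j\<^sub>n\<close> means that neighbouring indices
  are distinct.\<close>

definition exchangeable ::
    "(nat \<Rightarrow> 'a::unital_cstar_algebra \<Rightarrow> 'h::chilbert_space \<Rightarrow> 'h) \<Rightarrow> 'h \<Rightarrow> bool" where
  "exchangeable \<iota> \<xi> \<longleftrightarrow>
    (\<forall>w \<sigma>. successively (\<lambda>p q. fst p \<noteq> fst q) w \<longrightarrow> bij \<sigma> \<longrightarrow> finite {j. \<sigma> j \<noteq> j} \<longrightarrow>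
      cinner (word_op \<iota> w \<xi>) \<xi> = cinner (word_op \<iota> (map (\<lambda>(j, a). (\<sigma> j, a)) w) \<xi>) \<xi>)"


section \<open>The infinite unital free product\<close>

text \<open>
  The universal norm of the free product is the supremum over all families \<open>\<kappa>\<close> of unital
  representations \<open>\<kappa> j\<close> of the algebra on a common Hilbert space. It suffices to consider cyclic
  families, for which the space has a dense subset of cardinality at most that of the infinite set
  of words over \<open>nat \<times> 'a\<close>; replacing such a family by a multiple of itself, one may take the space
  to be the square-summable families indexed by words. Hence the free product is realised as the
  C*-algebra, in the bounded operator-valued functions on the set of families on this one space,
  that is generated by the functions \<open>\<kappa> \<mapsto> \<kappa> j a\<close>. Elements vanish outside the set of families, so
  that the unit is \<open>fp_emb j 1\<close>, for any \<open>j\<close>.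
\<close>

type_synonym 'a word_space = "(nat \<times> 'a) list ell2"
type_synonym 'a family = "nat \<Rightarrow> 'a \<Rightarrow> 'a word_space \<Rightarrow> 'a word_space"
type_synonym 'a fp = "'a family \<Rightarrow> 'a word_space \<Rightarrow> 'a word_space"

definition families :: "'a::unital_cstar_algebra family set" where
  "families = {\<kappa>. \<forall>j. unital_star_rep (\<kappa> j)}"

definition fp_emb :: "nat \<Rightarrow> 'a::unital_cstar_algebra \<Rightarrow> 'a fp" where
  "fp_emb j a = (\<lambda>\<kappa> v. if \<kappa> \<in> families then \<kappa> j a v else 0)"

definition fp_add :: "'a fp \<Rightarrow> 'a fp \<Rightarrow> 'a fp" where
  "fp_add x y = (\<lambda>\<kappa> v. x \<kappa> v + y \<kappa> v)"

definition fp_diff :: "'a fp \<Rightarrow> 'a fp \<Rightarrow> 'a fp" where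
  "fp_diff x y = (\<lambda>\<kappa> v. x \<kappa> v - y \<kappa> v)"

definition fp_scale :: "complex \<Rightarrow> 'a fp \<Rightarrow> 'a fp" where
  "fp_scale c x = (\<lambda>\<kappa> v. c *\<^sub>C x \<kappa> v)"

definition fp_mult :: "'a fp \<Rightarrow> 'a fp \<Rightarrow> 'a fp" where
  "fp_mult x y = (\<lambda>\<kappa>. x \<kappa> \<circ> y \<kappa>)"

definition fp_star :: "'a fp \<Rightarrow> 'a fp" where
  "fp_star x = (\<lambda>\<kappa>. adj (x \<kappa>))"

definition fp_closed :: "'a fp set \<Rightarrow> bool" where
  "fp_closed S \<longleftrightarrow>
    (\<forall>x. (\<forall>e>0. \<exists>y\<in>S. \<forall>\<kappa> v. norm (x \<kappa> v - y \<kappa> v) \<le> e * norm v) \<longrightarrow> x \<in> S)"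

definition fp_cstar_subalgebra :: "'a fp set \<Rightarrow> bool" where
  "fp_cstar_subalgebra S \<longleftrightarrow>
    S \<noteq> {} \<and> (\<forall>x\<in>S. \<forall>y\<in>S. fp_add x y \<in> S \<and> fp_mult x y \<in> S) \<and>
    (\<forall>c. \<forall>x\<in>S. fp_scale c x \<in> S) \<and> (\<forall>x\<in>S. fp_star x \<in> S) \<and> fp_closed S"

definition fp_local :: "nat set \<Rightarrow> 'a::unital_cstar_algebra fp set" where
  "fp_local I = fp_cstar_subalgebra hull (\<Union>j\<in>I. range (fp_emb j))"

definition free_product :: "'a::unital_cstar_algebra fp set" where
  "free_product = fp_local UNIV"


section \<open>The infinite maximal graded tensor product\<close>

definition fp_closed_ideal :: "'a::unital_cstar_algebra fp set \<Rightarrow> bool" where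
  "fp_closed_ideal J \<longleftrightarrow>
    J \<noteq> {} \<and> J \<subseteq> free_product \<and> (\<forall>x\<in>J. \<forall>y\<in>J. fp_add x y \<in> J) \<and> (\<forall>c. \<forall>x\<in>J. fp_scale c x \<in> J) \<and>
    (\<forall>x\<in>free_product. \<forall>y\<in>J. fp_mult x y \<in> J \<and> fp_mult y x \<in> J) \<and> fp_closed J"

definition graded_commutators :: "('a::unital_cstar_algebra \<Rightarrow> 'a) \<Rightarrow> 'a fp set" where
  "graded_commutators \<theta> =
    {fp_diff (fp_mult (fp_emb j a) (fp_emb k b)) (fp_mult (fp_emb k b) (fp_emb j a)) | j k a b.
      j \<noteq> k \<and> homogeneous \<theta> a \<and> homogeneous \<theta> b \<and> (even_elt \<theta> a \<or> even_elt \<theta> b)} \<union>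
    {fp_add (fp_mult (fp_emb j a) (fp_emb k b)) (fp_mult (fp_emb k b) (fp_emb j a)) | j k a b.
      j \<noteq> k \<and> odd_elt \<theta> a \<and> odd_elt \<theta> b}"

definition graded_ideal :: "('a::unital_cstar_algebra \<Rightarrow> 'a) \<Rightarrow> 'a fp set" where
  "graded_ideal \<theta> = fp_closed_ideal hull graded_commutators \<theta>"

text \<open>Elements of the quotient are cosets, with the algebraic operations of representatives.\<close>

type_synonym 'a gt = "'a fp set"

definition gt_coset :: "('a::unital_cstar_algebra \<Rightarrow> 'a) \<Rightarrow> 'a fp \<Rightarrow> 'a gt" where
  "gt_coset \<theta> x = {y \<in> free_product. fp_diff y x \<in> graded_ideal \<theta>}"

definition graded_tensor :: "('a::unital_cstar_algebra \<Rightarrow> 'a) \<Rightarrow> 'a gt set" where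
  "graded_tensor \<theta> = gt_coset \<theta> ` free_product"

definition gt_emb :: "('a::unital_cstar_algebra \<Rightarrow> 'a) \<Rightarrow> nat \<Rightarrow> 'a \<Rightarrow> 'a gt" where
  "gt_emb \<theta> j a = gt_coset \<theta> (fp_emb j a)"

text \<open>Images of C*-algebras under *-homomorphisms are closed, so this is the C*-subalgebra of the
  quotient generated by the embedded copies of the algebra with index in \<open>I\<close>.\<close>

definition gt_local :: "('a::unital_cstar_algebra \<Rightarrow> 'a) \<Rightarrow> nat set \<Rightarrow> 'a gt set" where
  "gt_local \<theta> I = gt_coset \<theta> ` fp_local I"

definition gt_state :: "('a::unital_cstar_algebra \<Rightarrow> 'a) \<Rightarrow> ('a gt \<Rightarrow> complex) \<Rightarrow> bool" where
  "gt_state \<theta> \<omega> \<longleftrightarrow>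
    (\<forall>x\<in>free_product. \<forall>y\<in>free_product.
      \<omega> (gt_coset \<theta> (fp_add x y)) = \<omega> (gt_coset \<theta> x) + \<omega> (gt_coset \<theta> y)) \<and>
    (\<forall>c. \<forall>x\<in>free_product. \<omega> (gt_coset \<theta> (fp_scale c x)) = c * \<omega> (gt_coset \<theta> x)) \<and>
    (\<forall>x\<in>free_product. \<exists>r\<ge>0. \<omega> (gt_coset \<theta> (fp_mult (fp_star x) x)) = complex_of_real r) \<and>
    \<omega> (gt_emb \<theta> 0 1) = 1"

definition gt_rep ::
    "('a::unital_cstar_algebra \<Rightarrow> 'a) \<Rightarrow> ('a gt \<Rightarrow> 'h::chilbert_space \<Rightarrow> 'h) \<Rightarrow> bool" where
  "gt_rep \<theta> \<pi> \<longleftrightarrow>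
    (\<forall>x\<in>free_product. bounded_clinear (\<pi> (gt_coset \<theta> x))) \<and>
    (\<forall>x\<in>free_product. \<forall>y\<in>free_product.
      \<pi> (gt_coset \<theta> (fp_add x y)) = (\<lambda>v. \<pi> (gt_coset \<theta> x) v + \<pi> (gt_coset \<theta> y) v)) \<and>
    (\<forall>c. \<forall>x\<in>free_product. \<pi> (gt_coset \<theta> (fp_scale c x)) = (\<lambda>v. c *\<^sub>C \<pi> (gt_coset \<theta> x) v)) \<and>
    (\<forall>x\<in>free_product. \<forall>y\<in>free_product.
      \<pi> (gt_coset \<theta> (fp_mult x y)) = \<pi> (gt_coset \<theta> x) \<circ> \<pi> (gt_coset \<theta> y)) \<and>
    (\<forall>x\<in>free_product. \<pi> (gt_coset \<theta> (fp_star x)) = adj (\<pi> (gt_coset \<theta> x))) \<and>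
    \<pi> (gt_emb \<theta> 0 1) = id"

definition gns_triple ::
    "('a::unital_cstar_algebra \<Rightarrow> 'a) \<Rightarrow> ('a gt \<Rightarrow> complex) \<Rightarrow>
     ('a gt \<Rightarrow> 'h::chilbert_space \<Rightarrow> 'h) \<Rightarrow> 'h \<Rightarrow> bool" where
  "gns_triple \<theta> \<omega> \<pi> \<xi> \<longleftrightarrow>
    gt_rep \<theta> \<pi> \<and> closure ((\<lambda>x. \<pi> x \<xi>) ` graded_tensor \<theta>) = UNIV \<and>
    (\<forall>x\<in>graded_tensor \<theta>. \<omega> x = cinner (\<pi> x \<xi>) \<xi>)"

definition tail_algebra ::
    "('a::unital_cstar_algebra \<Rightarrow> 'a) \<Rightarrow> ('a gt \<Rightarrow> 'h::chilbert_space \<Rightarrow> 'h) \<Rightarrow> ('h \<Rightarrow> 'h) set" where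
  "tail_algebra \<theta> \<pi> =
    (\<Inter>n\<in>{1..}. vN_gen (\<Union>I\<in>{I. finite I \<and> I \<subseteq> {n..}}. commutant (commutant (\<pi> ` gt_local \<theta> I))))"


section \<open>Normal conditional expectations\<close>

definition positive_op :: "('h::chilbert_space \<Rightarrow> 'h) \<Rightarrow> bool" where
  "positive_op T \<longleftrightarrow> bounded_clinear T \<and> (\<forall>v. \<exists>r\<ge>0. cinner (T v) v = complex_of_real r)"

definition op_le :: "('h::chilbert_space \<Rightarrow> 'h) \<Rightarrow> ('h \<Rightarrow> 'h) \<Rightarrow> bool" where
  "op_le S T \<longleftrightarrow> positive_op (\<lambda>v. T v - S v)"

definition op_is_sup :: "('h::chilbert_space \<Rightarrow> 'h) set \<Rightarrow> ('h \<Rightarrow> 'h) \<Rightarrow> bool" where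
  "op_is_sup D S \<longleftrightarrow> bounded_clinear S \<and> (\<forall>T\<in>D. op_le T S) \<and>
    (\<forall>R. bounded_clinear R \<and> (\<forall>T\<in>D. op_le T R) \<longrightarrow> op_le S R)"

definition conditional_expectation ::
    "('h::chilbert_space \<Rightarrow> 'h) set \<Rightarrow> ('h \<Rightarrow> 'h) set \<Rightarrow> (('h \<Rightarrow> 'h) \<Rightarrow> 'h \<Rightarrow> 'h) \<Rightarrow> bool" where
  "conditional_expectation M N E \<longleftrightarrow>
    (\<forall>X\<in>M. E X \<in> N) \<and> (\<forall>Z\<in>N. E Z = Z) \<and>
    (\<forall>X\<in>M. \<forall>Y\<in>M. E (\<lambda>v. X v + Y v) = (\<lambda>v. E X v + E Y v)) \<and>
    (\<forall>c. \<forall>X\<in>M. E (\<lambda>v. c *\<^sub>C X v) = (\<lambda>v. c *\<^sub>C E X v)) \<and>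
    (\<forall>X\<in>M. positive_op X \<longrightarrow> positive_op (E X)) \<and>
    (\<forall>X\<in>M. \<forall>Z\<in>N. \<forall>Z'\<in>N. E (Z \<circ> X \<circ> Z') = Z \<circ> E X \<circ> Z')"

definition normal_on :: "('h::chilbert_space \<Rightarrow> 'h) set \<Rightarrow> (('h \<Rightarrow> 'h) \<Rightarrow> 'h \<Rightarrow> 'h) \<Rightarrow> bool" where
  "normal_on M E \<longleftrightarrow>
    (\<forall>D S. D \<noteq> {} \<longrightarrow> D \<subseteq> M \<longrightarrow> (\<forall>T\<in>D. positive_op T) \<longrightarrow>
      (\<forall>T\<in>D. \<forall>T'\<in>D. \<exists>R\<in>D. op_le T R \<and> op_le T' R) \<longrightarrow>
      S \<in> M \<longrightarrow> op_is_sup D S \<longrightarrow> op_is_sup (E ` D) (E S))"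


section \<open>Conditional independence and identical distribution\<close>

definition conditionally_independent ::
    "(nat \<Rightarrow> 'a \<Rightarrow> 'h::chilbert_space \<Rightarrow> 'h) \<Rightarrow> ('h \<Rightarrow> 'h) set \<Rightarrow> (('h \<Rightarrow> 'h) \<Rightarrow> 'h \<Rightarrow> 'h) \<Rightarrow> bool" where
  "conditionally_independent \<iota> Z E \<longleftrightarrow>
    (\<forall>I J. finite I \<longrightarrow> finite J \<longrightarrow> I \<inter> J = {} \<longrightarrow>
      (\<forall>X \<in> vN_gen (vN_gen (\<Union>i\<in>I. range (\<iota> i)) \<union> Z).
       \<forall>Y \<in> vN_gen (vN_gen (\<Union>j\<in>J. range (\<iota> j)) \<union> Z).
         E (X \<circ> Y) = E X \<circ> E Y))"

definition identically_distributed ::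
    "(nat \<Rightarrow> 'a \<Rightarrow> 'h::chilbert_space \<Rightarrow> 'h) \<Rightarrow> (('h \<Rightarrow> 'h) \<Rightarrow> 'h \<Rightarrow> 'h) \<Rightarrow> bool" where
  "identically_distributed \<iota> E \<longleftrightarrow> (\<forall>j k a. E (\<iota> j a) = E (\<iota> k a))"

end

theory Submission
  imports Defs
begin

text \<open>
  If independence and identical distribution hold, graded commutation sorts a word by first
  occurrence of its indices, with a sign that an injective relabelling does not change, and \<open>E\<close> of
  the sorted word is a product of one-letter expectations that do not depend on the indices.

  Conversely, let the process be exchangeable. Averages of \<open>N\<close> disjoint copies of a word, applied to
  \<open>\<xi>\<close>, converge because the Gram matrix of the copies is constant off the diagonal; for odd words
  the limit is \<open>0\<close> because the copies anticommute. So the state is even, the parity is implemented by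
  a unitary, and this makes the tail algebra commute with everything; hence \<open>\<xi>\<close> separates it and
  \<open>E X\<close> is determined by the functional \<open>S \<mapsto> \<langle>X \<xi>, S \<xi>\<rangle>\<close> on the tail algebra. For an even word
  the averages converge strongly to a tail element \<open>T\<close>. Replacing a word \<open>Y\<close> by copies with indices
  disjoint from those of \<open>X\<close> does not change \<open>\<langle>X Y \<xi>, S \<xi>\<rangle>\<close> for \<open>S\<close> in the tail algebra; averaging
  turns \<open>Y\<close> into the central element \<open>T = E Y\<close>. The general case follows from the density of words, which is
  needed at the single vector \<open>\<xi>\<close> only.
\<close>

section \<open>Hilbert spaces and bicommutants\<close>

text \<open>Representations are given by algebraic identities only, while the tail algebra is built
  from norm-closed local algebras. Passing from these to the letters \<open>\<iota> j a\<close>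
  therefore needs automatic contractivity, which is obtained from Neumann series instead of spectral
  theory. Strong approximation of operators is avoided: every identity to be extended by density is
  written as orthogonality of \<open>X \<xi>\<close> to a fixed vector, and for this a projection in
  the commutant suffices. Such an identity sees one factor at a time, which is why the factorisation
  of expectations is restated twice, as a condition on \<open>Y \<xi>\<close> and as a condition on
  \<open>adj X \<xi>\<close>. The grading obstructs centrality of the tail: an odd letter only
  anticommutes with distant odd letters, so it does not lie in the commutant of the distant algebra
  until the parity unitary corrects the sign. That unitary exists because odd moments vanish, which
  is a consequence of exchangeability.\<close>

lemma cinner_Cauchy_Schwarz: "cmod (cinner x y) \<le> norm x * norm y"
  for x y :: "'a::complex_inner"
proof -
  have re: "Re (cinner x y) \<le> norm x * norm y" for x y :: 'a
  proof -
    have "cinner (x + y) (x + y) = cinner x x + cinner y y + (cinner x y + cnj (cinner x y))"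
      by (metis (no_types, lifting) cinner_add_left cinner_commute complex_cnj_add add.assoc add.commute)
    hence "(norm (x + y))\<^sup>2 = (norm x)\<^sup>2 + (norm y)\<^sup>2 + 2 * Re (cinner x y)"
      unfolding cinner_same complex_add_cnj by (metis of_real_add of_real_eq_iff)
    moreover have "(norm (x + y))\<^sup>2 \<le> (norm x + norm y)\<^sup>2"
      by (intro power_mono norm_triangle_ineq) simp
    ultimately show ?thesis by (simp add: power2_sum)
  qed
  show ?thesis
  proof (cases "cinner x y = 0")
    case False
    \<comment> \<open>This unit phase rotates \<open>x\<close> so that the inner product becomes its
      own modulus; the bound on real parts then applies.\<close>
    let ?c = "cnj (cinner x y) / cmod (cinner x y)"
    have "cmod ?c = 1" using False by (simp add: norm_divide)
    moreover have "cinner (?c *\<^sub>C x) y = cmod (cinner x y)"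
      using False by (simp add: cinner_scaleC_left complex_norm_square[symmetric] mult.commute power2_eq_square
        del: of_real_mult) (simp add: complex_norm_square[symmetric] power2_eq_square)
    ultimately show ?thesis using re[of "?c *\<^sub>C x" y] by (simp add: norm_scaleC)
  qed simp
qed

lemma bounded_bilinear_cinner: "bounded_bilinear (cinner :: 'a::complex_inner \<Rightarrow> 'a \<Rightarrow> complex)"
proof
  fix x y z :: 'a and r :: real
  show add_l: "cinner (x + y) z = cinner x z + cinner y z" for x y z :: 'a
    by (rule cinner_add_left)
  show "cinner x (y + z) = cinner x y + cinner x z"
    by (metis cinner_add_left cinner_commute complex_cnj_add)
  show sc_l: "cinner (r *\<^sub>R x) y = r *\<^sub>R cinner x y" for r and x y :: 'a
    by (simp add: scaleR_scaleC cinner_scaleC_left scaleR_conv_of_real)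
  show "cinner x (r *\<^sub>R y) = r *\<^sub>R cinner x y"
    by (metis sc_l cinner_commute complex_cnj_scaleR)
  show "\<exists>K. \<forall>x y :: 'a. cmod (cinner x y) \<le> norm x * norm y * K"
    by (intro exI[of _ 1] allI) (simp add: cinner_Cauchy_Schwarz)
qed

interpretation cinner: bounded_bilinear cinner
  by (rule bounded_bilinear_cinner)

lemma cinner_scaleC_right: "cinner x (c *\<^sub>C y) = cnj c * cinner x y"
  by (metis cinner_commute cinner_scaleC_left complex_cnj_mult)

lemma norm_sq_cinner: "(norm x)\<^sup>2 = Re (cinner x x)"
  by (simp add: cinner_same)

lemma cinner_eq_zero: "cinner x x = 0 \<longleftrightarrow> x = 0"
  by (simp add: cinner_same)

lemma cinner_swap_zero: "cinner x y = 0 \<longleftrightarrow> cinner y x = 0"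
  by (metis cinner_commute complex_cnj_zero)

lemma cinner_eqI: "(\<And>u. cinner u x = cinner u y) \<Longrightarrow> x = y"
  by (metis cinner.diff_right cinner_eq_zero eq_iff_diff_eq_0)

lemma norm_add_sq: "(norm (x + y))\<^sup>2 = (norm x)\<^sup>2 + (norm y)\<^sup>2 + 2 * Re (cinner x y)"
  unfolding norm_sq_cinner using cinner_commute[of y x]
  by (simp add: cinner.add_left cinner.add_right)

lemma norm_diff_sq: "(norm (x - y))\<^sup>2 = (norm x)\<^sup>2 + (norm y)\<^sup>2 - 2 * Re (cinner x y)"
  using norm_add_sq[of x "- y"] by (simp add: cinner.minus_right)

lemma scaleC_zero_left: "0 *\<^sub>C x = 0"
  by (metis of_real_0 scaleR_scaleC scaleR_zero_left)

lemma scaleC_minus_one: "(-1) *\<^sub>C x = - x"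
  by (metis of_real_1 of_real_minus scaleR_minus1_left scaleR_scaleC)

section \<open>Orthogonal projections onto closed subspaces\<close>

definition closed_csubspace :: "'h::complex_inner set \<Rightarrow> bool" where
  "closed_csubspace K \<longleftrightarrow> closed K \<and> 0 \<in> K \<and> (\<forall>x\<in>K. \<forall>y\<in>K. x + y \<in> K) \<and> (\<forall>c. \<forall>x\<in>K. c *\<^sub>C x \<in> K)"

lemma
  assumes "closed_csubspace K"
  shows csubspace_add: "x \<in> K \<Longrightarrow> y \<in> K \<Longrightarrow> x + y \<in> K"
    and csubspace_scaleC: "x \<in> K \<Longrightarrow> c *\<^sub>C x \<in> K"
    and csubspace_zero: "0 \<in> K"
    and csubspace_scaleR: "x \<in> K \<Longrightarrow> r *\<^sub>R x \<in> K"
    and csubspace_diff: "x \<in> K \<Longrightarrow> y \<in> K \<Longrightarrow> x - y \<in> K"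
    and csubspace_closed: "closed K"
proof -
  show add: "x + y \<in> K" if "x \<in> K" "y \<in> K" for x y
    using assms that unfolding closed_csubspace_def by blast
  show sc: "c *\<^sub>C x \<in> K" if "x \<in> K" for c x
    using assms that unfolding closed_csubspace_def by blast
  show "0 \<in> K" "closed K" using assms unfolding closed_csubspace_def by blast+
  show "r *\<^sub>R x \<in> K" if "x \<in> K" using sc[OF that] by (simp add: scaleR_scaleC)
  show "x - y \<in> K" if "x \<in> K" "y \<in> K"
    using add[OF that(1) sc[OF that(2), of "-1"]] by (simp add: scaleC_minus_one)
qed

text \<open>The sum is expressed through the midpoint, because the midpoint of two elements of a
  subspace stays in it and the infimum in \<open>projection_exists\<close> bounds that term from
  below.\<close>

lemma parallelogram: "(norm (x - y))\<^sup>2 = 2 * (norm x)\<^sup>2 + 2 * (norm y)\<^sup>2 - 4 * (norm ((1/2) *\<^sub>R (x + y)))\<^sup>2"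
  for x y :: "'a::complex_inner"
proof -
  have "4 * (norm ((1/2) *\<^sub>R (x + y)))\<^sup>2 = (norm (x + y))\<^sup>2"
    unfolding norm_scaleR power_mult_distrib by (simp add: power2_eq_square)
  thus ?thesis using norm_add_sq[of x y] norm_diff_sq[of x y] by linarith
qed

lemma orth_of_minimal:
  fixes y h :: "'a::complex_inner"
  assumes min: "\<And>c. (norm y)\<^sup>2 \<le> (norm (y - c *\<^sub>C h))\<^sup>2"
  shows "cinner y h = 0"
proof (rule ccontr)
  define z where "z = cinner y h"
  define t where "t = (norm h)\<^sup>2"
  \<comment> \<open>The coefficient of the orthogonal projection of \<open>y\<close> onto
    \<open>h\<close>: subtracting \<open>c *\<^sub>C h\<close> lowers the squared norm by
    \<open>(cmod z)\<^sup>2 / t\<close>.\<close>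
  define c where "c = z / complex_of_real t"
  assume "cinner y h \<noteq> 0"
  hence z: "(cmod z)\<^sup>2 > 0" by (simp add: z_def)
  have "h \<noteq> 0" using \<open>cinner y h \<noteq> 0\<close> cinner.zero_right by blast
  hence t: "t > 0" by (simp add: t_def)
  have "cmod c = cmod z / t" using t by (simp add: c_def norm_divide)
  hence 1: "(norm (c *\<^sub>C h))\<^sup>2 = (cmod z / t)\<^sup>2 * t" by (simp only: norm_scaleC power_mult_distrib t_def)
  have "(cmod z / t)\<^sup>2 * t = (cmod z)\<^sup>2 / t" using t by (simp add: power2_eq_square)
  have "cinner y (c *\<^sub>C h) = (z * cnj z) / complex_of_real t"
    by (simp add: cinner_scaleC_right c_def z_def)
  also have "\<dots> = complex_of_real ((cmod z)\<^sup>2 / t)"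
    by (simp only: complex_norm_square[symmetric] of_real_divide of_real_power)
  finally have 2: "Re (cinner y (c *\<^sub>C h)) = (cmod z)\<^sup>2 / t" by simp
  have "(cmod z)\<^sup>2 / t \<le> 0"
    using min[of c] norm_diff_sq[of y "c *\<^sub>C h"] 1 2 \<open>(cmod z / t)\<^sup>2 * t = (cmod z)\<^sup>2 / t\<close> by linarith
  thus False using z t by (simp add: divide_le_0_iff)
qed

text \<open>A minimising sequence for the distance is Cauchy by the parallelogram law, and
  \<open>orth_of_minimal\<close> gives orthogonality at its limit.\<close>

lemma projection_exists:
  fixes K :: "'h::chilbert_space set"
  assumes K: "closed_csubspace K"
  shows "\<exists>p\<in>K. \<forall>k\<in>K. cinner (x - p) k = 0"
proof -
  define d where "d = (INF k\<in>K. (norm (x - k))\<^sup>2)"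
  have ne: "K \<noteq> {}" using csubspace_zero[OF K] by blast
  have bdd: "bdd_below ((\<lambda>k. (norm (x - k))\<^sup>2) ` K)" by (rule bdd_belowI[of _ 0]) auto
  have d_le: "d \<le> (norm (x - k))\<^sup>2" if "k \<in> K" for k
    unfolding d_def by (rule cINF_lower[OF bdd that])
  have "\<exists>k\<in>K. (norm (x - k))\<^sup>2 < d + 1 / real (Suc n)" for n
    using cINF_less_iff[OF ne bdd, of "d + 1 / real (Suc n)"] unfolding d_def by auto
  then obtain k where kK: "\<And>n. k n \<in> K" and kd: "\<And>n. (norm (x - k n))\<^sup>2 < d + 1 / real (Suc n)"
    by metis
  have diff: "(norm (k m - k n))\<^sup>2 \<le> 2 / real (Suc m) + 2 / real (Suc n)" for m n
  proof -
    have "(1/2) *\<^sub>R (k m + k n) \<in> K" by (intro csubspace_scaleR[OF K] csubspace_add[OF K] kK)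
    from d_le[OF this] have "d \<le> (norm ((1/2) *\<^sub>R ((x - k m) + (x - k n))))\<^sup>2"
      by (smt (verit) add_diff_add scaleR_half_double scaleR_right_diff_distrib)
    hence "(norm ((x - k n) - (x - k m)))\<^sup>2 \<le> 2 * (norm (x - k n))\<^sup>2 + 2 * (norm (x - k m))\<^sup>2 - 4 * d"
      using parallelogram[of "x - k n" "x - k m"] by (simp add: add.commute)
    moreover have "(x - k n) - (x - k m) = k m - k n" by simp
    ultimately show ?thesis using kd[of m] kd[of n] by simp
  qed
  have "Cauchy k"
  proof (rule CauchyI)
    fix e :: real assume e: "0 < e"
    then obtain N where N: "4 / e\<^sup>2 < real (Suc N)"
      by (meson reals_Archimedean2 less_trans lessI of_nat_less_iff)
    have "norm (k m - k n) < e" if "m \<ge> N" "n \<ge> N" for m n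
    proof -
      have "2 / real (Suc m) \<le> 2 / real (Suc N)" "2 / real (Suc n) \<le> 2 / real (Suc N)"
        using that by (auto intro!: divide_left_mono)
      hence "(norm (k m - k n))\<^sup>2 \<le> 4 / real (Suc N)" using diff[of m n] by linarith
      also have "\<dots> < e\<^sup>2" using N e by (simp add: field_simps)
      finally show ?thesis using e by (simp add: power2_less_imp_less)
    qed
    thus "\<exists>M. \<forall>m\<ge>M. \<forall>n\<ge>M. norm (k m - k n) < e" by blast
  qed
  then obtain p where p: "k \<longlonglongrightarrow> p" using Cauchy_convergent convergent_def by blast
  have pK: "p \<in> K" using closed_sequentially[OF csubspace_closed[OF K]] kK p by blast
  have "(\<lambda>n. (norm (x - k n))\<^sup>2) \<longlonglongrightarrow> (norm (x - p))\<^sup>2" by (intro tendsto_intros p)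
  moreover have "(\<lambda>n. d + 1 / real (Suc n)) \<longlonglongrightarrow> d + 0"
    by (intro tendsto_intros LIMSEQ_inverse_real_of_nat[unfolded inverse_eq_divide])
  ultimately have pd: "(norm (x - p))\<^sup>2 \<le> d + 0"
    by (rule LIMSEQ_le) (use kd less_imp_le in blast)
  have "cinner (x - p) h = 0" if h: "h \<in> K" for h
  proof (rule orth_of_minimal)
    fix c
    have "p + c *\<^sub>C h \<in> K" by (intro csubspace_add[OF K] csubspace_scaleC[OF K] pK h)
    from d_le[OF this] show "(norm (x - p))\<^sup>2 \<le> (norm (x - p - c *\<^sub>C h))\<^sup>2"
      using pd unfolding diff_diff_eq by linarith
  qed
  thus ?thesis using pK by blast
qed

lemma bounded_clinearI:
  assumes "\<And>x y. T (x + y) = T x + T y" "\<And>c x. T (c *\<^sub>C x) = c *\<^sub>C T x"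
    "\<And>x. norm (T x) \<le> B * norm x"
  shows "bounded_clinear T"
proof -
  have "bounded_linear T"
  proof (rule bounded_linear_intro)
    show "T (r *\<^sub>R x) = r *\<^sub>R T x" for r x by (simp only: scaleR_scaleC assms(2))
    show "norm (T x) \<le> norm x * B" for x using assms(3)[of x] by (simp only: mult.commute)
  qed (rule assms(1))
  thus ?thesis unfolding bounded_clinear_def using assms(2) by blast
qed

lemma
  assumes "bounded_clinear T"
  shows clinear_add: "T (x + y) = T x + T y"
    and clinear_diff: "T (x - y) = T x - T y"
    and clinear_minus: "T (- x) = - T x"
    and clinear_zero: "T 0 = 0"
    and clinear_scaleC: "T (c *\<^sub>C x) = c *\<^sub>C T x"
    and clinear_scaleR: "T (r *\<^sub>R x) = r *\<^sub>R T x"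
    and clinear_sum: "T (\<Sum>i\<in>F. f i) = (\<Sum>i\<in>F. T (f i))"
    and clinear_bounded_linear: "bounded_linear T"
proof -
  interpret T: bounded_linear T using assms unfolding bounded_clinear_def by blast
  show "T (x + y) = T x + T y" "T (x - y) = T x - T y" "T (- x) = - T x" "T 0 = 0"
    "T (r *\<^sub>R x) = r *\<^sub>R T x" "T (\<Sum>i\<in>F. f i) = (\<Sum>i\<in>F. T (f i))" "bounded_linear T"
    by (rule T.add T.diff T.neg T.zero T.scaleR T.sum T.bounded_linear_axioms)+
  show "T (c *\<^sub>C x) = c *\<^sub>C T x" using assms unfolding bounded_clinear_def by blast
qed

lemma clinear_bound:
  assumes "bounded_clinear T"
  obtains B where "B > 0" "\<And>v. norm (T v) \<le> B * norm v"
  using bounded_linear.pos_bounded[OF clinear_bounded_linear[OF assms]] by (auto simp: mult.commute)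

lemma clinear_tendsto: "bounded_clinear T \<Longrightarrow> (f \<longlongrightarrow> l) F \<Longrightarrow> ((\<lambda>i. T (f i)) \<longlongrightarrow> T l) F"
  by (rule bounded_linear.tendsto[OF clinear_bounded_linear])

lemma bounded_clinear_id: "bounded_clinear id" "bounded_clinear (\<lambda>v. v)"
  unfolding bounded_clinear_def id_def by (auto intro: bounded_linear_ident)

lemma bounded_clinear_comp: "bounded_clinear S \<Longrightarrow> bounded_clinear T \<Longrightarrow> bounded_clinear (S \<circ> T)"
  unfolding bounded_clinear_def o_def by (auto intro: bounded_linear_compose)

lemma scaleC_commute: "c *\<^sub>C d *\<^sub>C x = d *\<^sub>C c *\<^sub>C x"
  by (simp add: scaleC_scaleC mult.commute)

lemma scaleC_diff_right: "c *\<^sub>C (x - y) = c *\<^sub>C x - c *\<^sub>C y"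
  using scaleC_add_right[of c "x - y" y] by simp

lemma scaleR_scaleC_commute: "c *\<^sub>C r *\<^sub>R x = r *\<^sub>R c *\<^sub>C x"
  by (simp add: scaleR_scaleC scaleC_commute)

lemma bounded_linear_scaleC: "bounded_linear (\<lambda>v::'a::complex_normed_vector. c *\<^sub>C v)"
  by (rule bounded_linear_intro[where K="cmod c"])
    (simp_all only: scaleC_add_right scaleR_scaleC_commute norm_scaleC mult.commute order_refl)

lemma bounded_clinear_scaleC: "bounded_clinear T \<Longrightarrow> bounded_clinear (\<lambda>v. c *\<^sub>C T v)"
  unfolding bounded_clinear_def
  by (auto intro: bounded_linear_compose[OF bounded_linear_scaleC]) (metis scaleC_commute)

lemma bounded_clinear_add: "bounded_clinear S \<Longrightarrow> bounded_clinear T \<Longrightarrow> bounded_clinear (\<lambda>v. S v + T v)"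
  unfolding bounded_clinear_def by (auto intro: bounded_linear_add simp: scaleC_add_right)

lemma bounded_clinear_diff: "bounded_clinear S \<Longrightarrow> bounded_clinear T \<Longrightarrow> bounded_clinear (\<lambda>v. S v - T v)"
  unfolding bounded_clinear_def by (auto intro: bounded_linear_sub simp: scaleC_diff_right)

definition proj :: "'h::chilbert_space set \<Rightarrow> 'h \<Rightarrow> 'h" where
  "proj K x = (SOME p. p \<in> K \<and> (\<forall>k\<in>K. cinner (x - p) k = 0))"

lemma
  assumes K: "closed_csubspace K"
  shows proj_in: "proj K x \<in> K"
    and proj_orth: "k \<in> K \<Longrightarrow> cinner (x - proj K x) k = 0"
    and proj_eqI: "p \<in> K \<Longrightarrow> (\<And>k. k \<in> K \<Longrightarrow> cinner (x - p) k = 0) \<Longrightarrow> proj K x = p"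
proof -
  have "proj K x \<in> K \<and> (\<forall>k\<in>K. cinner (x - proj K x) k = 0)" for x
    unfolding proj_def by (rule someI_ex) (use projection_exists[OF K, of x] in blast)
  thus in_K: "proj K x \<in> K" and orth: "k \<in> K \<Longrightarrow> cinner (x - proj K x) k = 0" for x k by auto
  assume p: "p \<in> K" "\<And>k. k \<in> K \<Longrightarrow> cinner (x - p) k = 0"
  let ?e = "proj K x - p"
  have "?e \<in> K" using csubspace_diff[OF K in_K p(1)] .
  hence "cinner ((x - p) - (x - proj K x)) ?e = 0"
    unfolding cinner.diff_left[of "x - p"] using p(2) orth by simp
  thus "proj K x = p" by (simp add: cinner_eq_zero)
qed

lemma bounded_clinear_proj:
  assumes K: "closed_csubspace K"
  shows "bounded_clinear (proj K)"
proof (rule bounded_clinearI[where B=1])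
  fix x y c
  note o = proj_orth[OF K]
  show "proj K (x + y) = proj K x + proj K y"
  proof (rule proj_eqI[OF K])
    fix k assume "k \<in> K"
    with o[of k x] o[of k y] show "cinner (x + y - (proj K x + proj K y)) k = 0"
      by (simp add: add_diff_add cinner.add_left)
  qed (intro csubspace_add[OF K] proj_in[OF K])
  show "proj K (c *\<^sub>C x) = c *\<^sub>C proj K x"
  proof (rule proj_eqI[OF K])
    fix k assume "k \<in> K"
    with o[of k x] show "cinner (c *\<^sub>C x - c *\<^sub>C proj K x) k = 0"
      by (simp add: scaleC_diff_right[symmetric] cinner_scaleC_left)
  qed (intro csubspace_scaleC[OF K] proj_in[OF K])
  have "(norm x)\<^sup>2 = (norm (x - proj K x))\<^sup>2 + (norm (proj K x))\<^sup>2"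
    using norm_add_sq[of "x - proj K x" "proj K x"] o[OF proj_in[OF K], of x x] by simp
  hence "(norm (proj K x))\<^sup>2 \<le> (norm x)\<^sup>2" by simp
  thus "norm (proj K x) \<le> 1 * norm x" by (auto intro: power2_le_imp_le)
qed

text \<open>The residue \<open>e\<close> of a point outside the kernel is orthogonal to the kernel,
  and every \<open>y\<close> differs from a multiple of \<open>e\<close> by an element of the
  kernel.\<close>

lemma riesz:
  fixes f :: "'h::chilbert_space \<Rightarrow> complex"
  assumes bl: "bounded_linear f" and sc: "\<And>c x. f (c *\<^sub>C x) = c * f x"
  obtains u where "\<And>x. f x = cinner x u"
proof (cases "\<forall>x. f x = 0")
  case True
  thus ?thesis using that[of 0] by (simp add: cinner.zero_right)
next
  case False
  then obtain x where x: "f x \<noteq> 0" by blast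
  interpret f: bounded_linear f by (rule bl)
  let ?K = "{v. f v = 0}"
  have K: "closed_csubspace ?K"
  proof -
    have "closed ?K"
      by (intro closed_Collect_eq continuous_on_const f.continuous_on continuous_on_id)
    thus ?thesis unfolding closed_csubspace_def by (simp add: f.zero f.add sc)
  qed
  define e where "e = x - proj ?K x"
  have fe: "f e \<noteq> 0" using x proj_in[OF K, of x] by (simp add: e_def f.diff)
  hence ne: "norm e \<noteq> 0" using f.zero by auto
  show ?thesis
  proof (rule that)
    fix y
    have "y - (f y / f e) *\<^sub>C e \<in> ?K" using fe by (simp add: f.diff sc)
    hence "cinner e (y - (f y / f e) *\<^sub>C e) = 0" unfolding e_def by (rule proj_orth[OF K])
    hence "cinner (y - (f y / f e) *\<^sub>C e) e = 0" using cinner_swap_zero by blast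
    hence "cinner y e = (f y / f e) * (norm e)\<^sup>2"
      by (simp add: cinner.diff_left cinner_scaleC_left cinner_same)
    thus "f y = cinner y ((cnj (f e) / (norm e)\<^sup>2) *\<^sub>C e)"
      using fe ne by (simp add: cinner_scaleC_right)
  qed
qed

text \<open>\<open>adj\<close> is a definite description, so one map with the defining identity
  determines it; adjoints of concrete operators are computed below in this way.\<close>

lemma adj_unique:
  assumes "\<And>x y. cinner (T x) y = cinner x (S y)"
  shows "adj T = S"
  unfolding adj_def
proof (rule the_equality)
  show "\<forall>x y. cinner (T x) y = cinner x (S y)" using assms by blast
  fix R assume R: "\<forall>x y. cinner (T x) y = cinner x (R y)"
  show "R = S"
  proof
    fix y show "R y = S y" by (rule cinner_eqI) (metis R assms)
  qed
qed

text \<open>The adjoint comes from the Riesz representation of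
  \<open>\<lambda>x. cinner (T x) y\<close>. The third claim keeps the constant \<open>B\<close>
  unchanged, as the norm estimates by resolvents require.\<close>

lemma
  assumes T: "bounded_clinear T"
  shows cinner_adj: "cinner (T x) y = cinner x (adj T y)"
    and bounded_clinear_adj: "bounded_clinear (adj T)"
    and adj_bound: "(\<And>v. norm (T v) \<le> B * norm v) \<Longrightarrow> norm (adj T v) \<le> B * norm v"
proof -
  have "\<exists>u. \<forall>x. cinner (T x) y = cinner x u" for y
  proof -
    have "bounded_linear (\<lambda>x. cinner (T x) y)"
      by (rule bounded_linear_compose[OF cinner.bounded_linear_left clinear_bounded_linear[OF T]])
    thus ?thesis
      by (rule riesz[where f="\<lambda>x. cinner (T x) y"]) (auto simp: clinear_scaleC[OF T] cinner_scaleC_left)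
  qed
  then obtain S where "\<And>x y. cinner (T x) y = cinner x (S y)" by metis
  with adj_unique[of T S] show adj: "cinner (T x) y = cinner x (adj T y)" for x y by simp
  show bound: "norm (adj T v) \<le> B * norm v" if B: "\<And>v. norm (T v) \<le> B * norm v" for B v
  proof (cases "adj T v = 0")
    case True
    have "0 \<le> B * norm v" by (rule order_trans[OF norm_ge_zero B])
    thus ?thesis using True by simp
  next
    case False
    have "(norm (adj T v))\<^sup>2 = Re (cinner (T (adj T v)) v)" by (simp add: adj norm_sq_cinner)
    also have "\<dots> \<le> norm (T (adj T v)) * norm v"
      using complex_Re_le_cmod cinner_Cauchy_Schwarz order_trans by blast
    also have "\<dots> \<le> B * norm (adj T v) * norm v" by (intro mult_right_mono B) simp
    finally show ?thesis using False by (simp add: power2_eq_square mult.commute mult.left_commute)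
  qed
  obtain B where B: "\<And>v. norm (T v) \<le> B * norm v" using clinear_bound[OF T] by blast
  show "bounded_clinear (adj T)"
  proof (rule bounded_clinearI)
    show "adj T (x + y) = adj T x + adj T y" for x y
      by (rule cinner_eqI) (simp add: adj[symmetric] cinner.add_right)
    show "adj T (c *\<^sub>C x) = c *\<^sub>C adj T x" for c x
      by (rule cinner_eqI) (simp add: adj[symmetric] cinner_scaleC_right)
  qed (rule bound[OF B])
qed

lemma cinner_adj': "bounded_clinear T \<Longrightarrow> cinner (adj T x) y = cinner x (T y)"
  by (metis cinner_adj cinner_commute)

lemma adj_adj: "bounded_clinear T \<Longrightarrow> adj (adj T) = T"
  by (rule adj_unique) (rule cinner_adj')

lemma adj_comp: "bounded_clinear S \<Longrightarrow> bounded_clinear T \<Longrightarrow> adj (S \<circ> T) = adj T \<circ> adj S"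
  by (rule adj_unique) (simp add: cinner_adj)

lemma adj_id: "adj id = id"
  by (rule adj_unique) simp

section \<open>Commutants, bicommutants and generated von Neumann algebras\<close>

lemma commutant_iff: "T \<in> commutant S \<longleftrightarrow> bounded_clinear T \<and> (\<forall>s\<in>S. \<forall>v. T (s v) = s (T v))"
  unfolding commutant_def by (auto simp: fun_eq_iff)

lemma commutant_antimono: "A \<subseteq> B \<Longrightarrow> commutant B \<subseteq> commutant A"
  unfolding commutant_iff subset_iff by blast

lemma bicommutant_mono: "A \<subseteq> B \<Longrightarrow> commutant (commutant A) \<subseteq> commutant (commutant B)"
  by (intro commutant_antimono)

lemma commutant_commutant_superset: "(\<And>s. s \<in> S \<Longrightarrow> bounded_clinear s) \<Longrightarrow> S \<subseteq> commutant (commutant S)"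
  by (auto simp: commutant_iff)

lemma commutant_bounded: "T \<in> commutant S \<Longrightarrow> bounded_clinear T"
  by (simp add: commutant_iff)

lemma commutant_triple:
  assumes "\<And>s. s \<in> S \<Longrightarrow> bounded_clinear s"
  shows "commutant (commutant (commutant S)) = commutant S"
proof
  show "commutant (commutant (commutant S)) \<subseteq> commutant S"
    by (rule commutant_antimono[OF commutant_commutant_superset[OF assms]])
  show "commutant S \<subseteq> commutant (commutant (commutant S))"
    by (rule commutant_commutant_superset) (rule commutant_bounded)
qed

lemma bicommutant_least:
  assumes "A \<subseteq> commutant (commutant B)"
  shows "commutant (commutant A) \<subseteq> commutant (commutant B)"
proof -
  have "commutant (commutant (commutant (commutant B))) = commutant (commutant B)"
    by (rule commutant_triple) (rule commutant_bounded)
  thus ?thesis using bicommutant_mono[OF assms(1)] by simp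
qed

lemma commutant_id: "id \<in> commutant S"
  by (simp add: commutant_iff bounded_clinear_id)

lemma commutant_comp: "S \<in> commutant A \<Longrightarrow> T \<in> commutant A \<Longrightarrow> S \<circ> T \<in> commutant A"
  by (auto simp: commutant_iff bounded_clinear_comp)

lemma commutant_diff:
  assumes "\<And>s. s \<in> A \<Longrightarrow> bounded_clinear s" "S \<in> commutant A" "T \<in> commutant A"
  shows "(\<lambda>v. S v - T v) \<in> commutant A"
  using assms by (auto simp: commutant_iff bounded_clinear_diff clinear_diff)

definition adj_closed :: "('h::chilbert_space \<Rightarrow> 'h) set \<Rightarrow> bool" where
  "adj_closed S \<longleftrightarrow> (\<forall>s\<in>S. bounded_clinear s \<and> adj s \<in> S)"

lemma adj_closed_commutant:
  assumes "adj_closed S" shows "adj_closed (commutant S)"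
  unfolding adj_closed_def
proof (intro ballI conjI)
  fix T assume T: "T \<in> commutant S"
  thus bT: "bounded_clinear T" by (rule commutant_bounded)
  have "adj T (s v) = s (adj T v)" if s: "s \<in> S" for s v
  proof (rule cinner_eqI)
    fix u
    have bs: "bounded_clinear s" "adj s \<in> S" using assms s unfolding adj_closed_def by auto
    have "cinner u (adj T (s v)) = cinner (adj s (T u)) v"
      by (simp add: cinner_adj[OF bT, symmetric] cinner_adj'[OF bs(1)])
    also have "\<dots> = cinner (T (adj s u)) v" using T bs(2) by (simp add: commutant_iff)
    also have "\<dots> = cinner u (s (adj T v))" by (simp add: cinner_adj[OF bT] cinner_adj'[OF bs(1)])
    finally show "cinner u (adj T (s v)) = cinner u (s (adj T v))" .
  qed
  thus "adj T \<in> commutant S" by (simp add: commutant_iff bounded_clinear_adj[OF bT])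
qed

text \<open>The bicommutant is itself a von Neumann algebra, because \<open>S\<close> is
  self-adjoint and triple commutants collapse; by monotonicity it lies in every other one above
  \<open>S\<close>, hence equals the hull.\<close>

lemma vN_gen_eq:
  assumes "adj_closed S"
  shows "vN_gen S = commutant (commutant S)"
proof -
  have b: "\<And>s. s \<in> S \<Longrightarrow> bounded_clinear s"
    using assms by (simp add: adj_closed_def)
  have 1: "S \<subseteq> commutant (commutant S)" by (rule commutant_commutant_superset) (rule b)
  have tr: "commutant (commutant (commutant S)) = commutant S" by (rule commutant_triple) (rule b)
  have ac: "adj_closed (commutant (commutant S))"
    by (intro adj_closed_commutant assms)
  have 2: "von_neumann_algebra (commutant (commutant S))"
    unfolding von_neumann_algebra_def tr using ac unfolding adj_closed_def by simp
  have 3: "commutant (commutant S) \<subseteq> t" if "S \<subseteq> t" "von_neumann_algebra t" for t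
  proof -
    have "commutant (commutant t) = t" using that(2) unfolding von_neumann_algebra_def by (rule conjunct2)
    thus ?thesis using bicommutant_mono[OF that(1)] by simp
  qed
  show ?thesis unfolding vN_gen_def by (rule hull_unique[of S _ von_neumann_algebra, OF 1 2 3])
qed

definition orth :: "'h::chilbert_space set \<Rightarrow> 'h set" where
  "orth V = {u. \<forall>v\<in>V. cinner v u = 0}"

lemma closed_csubspace_orth: "closed_csubspace (orth V)"
proof -
  have "orth V = (\<Inter>v\<in>V. {u. cinner v u = 0})" by (auto simp: orth_def)
  also have "closed \<dots>"
    by (intro closed_INT ballI closed_Collect_eq cinner.continuous_on continuous_on_const continuous_on_id)
  finally have "closed (orth V)" .
  thus ?thesis
    unfolding closed_csubspace_def
    by (auto simp: orth_def cinner.zero_right cinner.add_right cinner_scaleC_right)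
qed

text \<open>Invariance under both \<open>s\<close> and \<open>adj s\<close> makes \<open>K\<close>
  reducing, so \<open>s\<close> respects the orthogonal decomposition.\<close>

lemma proj_commute:
  assumes K: "closed_csubspace K" and s: "bounded_clinear s"
    and "\<And>k. k \<in> K \<Longrightarrow> s k \<in> K" "\<And>k. k \<in> K \<Longrightarrow> adj s k \<in> K"
  shows "proj K (s v) = s (proj K v)"
proof (rule proj_eqI[OF K])
  show "s (proj K v) \<in> K" by (intro assms proj_in[OF K])
  fix k assume "k \<in> K"
  hence "cinner (v - proj K v) (adj s k) = 0" by (intro proj_orth[OF K] assms)
  thus "cinner (s v - s (proj K v)) k = 0"
    by (simp add: clinear_diff[OF s, symmetric] cinner_adj[OF s])
qed

text \<open>The projection onto the closed span of \<open>V\<close> commutes with \<open>S\<close>, hence with \<open>T\<close>.\<close>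

lemma bicommutant_density:
  assumes S: "adj_closed S" and V: "\<And>s v. s \<in> S \<Longrightarrow> v \<in> V \<Longrightarrow> s v \<in> V"
    and T: "T \<in> commutant (commutant S)" and v: "v \<in> V" and u: "\<And>w. w \<in> V \<Longrightarrow> cinner w u = 0"
  shows "cinner (T v) u = 0"
proof -
  let ?K = "orth V"
  have K: "closed_csubspace ?K" by (rule closed_csubspace_orth)
  have b: "bounded_clinear s" "adj s \<in> S" if "s \<in> S" for s using S that unfolding adj_closed_def by auto
  have adj_K: "adj s k \<in> ?K" if "s \<in> S" "k \<in> ?K" for s k
    using that V b(1)[OF that(1)] by (auto simp: orth_def cinner_adj[symmetric])
  have s_K: "s k \<in> ?K" if "s \<in> S" "k \<in> ?K" for s k
    using adj_K[OF b(2)[OF that(1)] that(2)] by (simp add: adj_adj[OF b(1)[OF that(1)]])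
  have "proj ?K (s w) = s (proj ?K w)" if "s \<in> S" for s w
    by (rule proj_commute[OF K b(1)[OF that]]) (use that s_K adj_K in blast)+
  hence "proj ?K \<in> commutant S" by (simp add: commutant_iff bounded_clinear_proj[OF K])
  hence comm: "T (proj ?K v) = proj ?K (T v)" using T by (simp add: commutant_iff)
  have "proj ?K v = 0"
  proof (rule proj_eqI[OF K csubspace_zero[OF K]])
    show "cinner (v - 0) k = 0" if "k \<in> ?K" for k using v that by (simp add: orth_def)
  qed
  hence "proj ?K (T v) = 0" using comm clinear_zero[OF commutant_bounded[OF T]] by simp
  moreover have "u \<in> ?K" using u by (simp add: orth_def)
  ultimately show ?thesis using proj_orth[OF K, of u "T v"] by simp
qed

section \<open>Automatic continuity and the tail algebra\<close>

instance chilbert_space \<subseteq> banach ..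
instance unital_cstar_algebra \<subseteq> banach ..

text \<open>If \<open>m = \<parallel>T\<parallel>\<close> exceeded \<open>B\<close>, then \<open>m\<^sup>2 - T\<^sup>*T\<close> would be bounded below, although it is small on
  vectors at which \<open>T\<close> nearly attains its norm.\<close>

lemma contraction_of_resolvents:
  fixes T :: "'h::chilbert_space \<Rightarrow> 'h"
  assumes T: "bounded_clinear T" and "0 \<le> B"
    and res: "\<And>m. m > B \<Longrightarrow> \<exists>R. bounded_clinear R \<and> (\<forall>v. R (v - (1 / m\<^sup>2) *\<^sub>R adj T (T v)) = v)"
  shows "norm (T v) \<le> B * norm v"
proof -
  have bl: "bounded_linear T" by (rule clinear_bounded_linear[OF T])
  define m where "m = onorm T"
  have m: "norm (T v) \<le> m * norm v" for v unfolding m_def by (rule onorm[OF bl])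
  have "m \<le> B"
  proof (rule ccontr)
    assume "\<not> m \<le> B"
    hence mB: "m > B" and m0: "m > 0" using \<open>0 \<le> B\<close> by auto
    obtain R where R: "bounded_clinear R" "\<And>v. R (v - (1 / m\<^sup>2) *\<^sub>R adj T (T v)) = v"
      using res[OF mB] by blast
    obtain C0 where C0: "C0 > 0" "\<And>v. norm (R v) \<le> C0 * norm v" using clinear_bound[OF R(1)] by blast
    \<comment> \<open>Enlarging the bound to at least 1 keeps \<open>1 - 1 / C\<^sup>2\<close>
      nonnegative and below 1, so that its square root is a genuine improvement factor.\<close>
    define C where "C = max 1 C0"
    have C1: "C \<ge> 1" by (simp add: C_def)
    have C: "norm (R v) \<le> C * norm v" for v
      using C0(2)[of v] mult_right_mono[of C0 C "norm v"] by (simp add: C_def)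
    have "norm (T v) \<le> m * sqrt (1 - 1 / C\<^sup>2) * norm v" for v
    proof -
      let ?w = "adj T (T v)"
      have w: "norm ?w \<le> m * norm (T v)" by (rule adj_bound[OF T m])
      have re: "Re (cinner v ?w) = (norm (T v))\<^sup>2"
        by (simp only: cinner_adj[OF T, symmetric] norm_sq_cinner)
      have "(norm (v - (1 / m\<^sup>2) *\<^sub>R ?w))\<^sup>2
          = (norm v)\<^sup>2 + (1 / m\<^sup>2)\<^sup>2 * (norm ?w)\<^sup>2 - 2 * ((1 / m\<^sup>2) * (norm (T v))\<^sup>2)"
        unfolding norm_diff_sq cinner.scaleR_right norm_scaleR power_mult_distrib by (simp add: re)
      also have "\<dots> \<le> (norm v)\<^sup>2 + (1 / m\<^sup>2)\<^sup>2 * (m * norm (T v))\<^sup>2 - 2 * ((1 / m\<^sup>2) * (norm (T v))\<^sup>2)"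
        using power_mono[OF w, of 2] by (intro diff_right_mono add_left_mono mult_left_mono) auto
      also have "(1 / m\<^sup>2)\<^sup>2 * (m * norm (T v))\<^sup>2 = (1 / m\<^sup>2) * (norm (T v))\<^sup>2"
        using m0 by (simp add: power2_eq_square)
      finally have d: "(norm (v - (1 / m\<^sup>2) *\<^sub>R ?w))\<^sup>2 \<le> (norm v)\<^sup>2 - (1 / m\<^sup>2) * (norm (T v))\<^sup>2"
        by linarith
      have "(norm v)\<^sup>2 \<le> (C * norm (v - (1 / m\<^sup>2) *\<^sub>R ?w))\<^sup>2"
        using C[of "v - (1 / m\<^sup>2) *\<^sub>R ?w"] by (intro power_mono) (simp_all add: R(2))
      also have "\<dots> \<le> C\<^sup>2 * ((norm v)\<^sup>2 - (1 / m\<^sup>2) * (norm (T v))\<^sup>2)"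
        unfolding power_mult_distrib by (intro mult_left_mono d) simp
      finally have "(1 / C\<^sup>2) * (norm v)\<^sup>2 \<le> (norm v)\<^sup>2 - (1 / m\<^sup>2) * (norm (T v))\<^sup>2"
        using C1 by (simp add: field_simps)
      hence "(1 / m\<^sup>2) * (norm (T v))\<^sup>2 \<le> (1 - 1 / C\<^sup>2) * (norm v)\<^sup>2" by (simp add: left_diff_distrib)
      hence "(norm (T v))\<^sup>2 \<le> m\<^sup>2 * ((1 - 1 / C\<^sup>2) * (norm v)\<^sup>2)" using m0 by (simp add: field_simps)
      also have "\<dots> = (m * sqrt (1 - 1 / C\<^sup>2) * norm v)\<^sup>2"
        using C1 by (simp add: power_mult_distrib)
      finally show ?thesis
        by (rule power2_le_imp_le) (use C1 m0 in simp)
    qed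
    \<comment> \<open>Minimality of the operator norm \<open>m\<close> meets a bound with a strictly
      smaller constant.\<close>
    hence "m \<le> m * sqrt (1 - 1 / C\<^sup>2)" unfolding m_def[symmetric]
      using onorm_bound[of "m * sqrt (1 - 1 / C\<^sup>2)" T] C1 m0 by (simp add: m_def)
    hence "1 \<le> sqrt (1 - 1 / C\<^sup>2)" using m0 by simp
    thus False using C1 by simp
  qed
  thus ?thesis using m[of v] mult_right_mono[of m B "norm v"] by simp
qed

lemma geometric_inverse:
  fixes h :: "'a::{real_normed_algebra_1,banach}"
  assumes "norm h < 1"
  shows "(\<Sum>k. h ^ k) * (1 - h) = 1"
proof -
  have s: "summable (\<lambda>k. h ^ k)"
    by (rule summable_comparison_test'[OF summable_geometric[of "norm h"], of 0])
      (use assms in \<open>auto intro: norm_power_ineq\<close>)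
  have "(\<Sum>k. h ^ k) * h = (\<Sum>k. h ^ k * h)" by (rule suminf_mult2[OF s])
  also have "\<dots> = (\<Sum>k. h ^ Suc k)" by (simp only: power_Suc2)
  also have "\<dots> = (\<Sum>k. h ^ k) - 1" using suminf_split_head[OF s] by simp
  finally show ?thesis by (simp add: right_diff_distrib)
qed

text \<open>For \<open>m > norm a\<close> the C*-identity puts the norm of \<open>h\<close> below 1,
  so \<open>1 - h\<close> has a Neumann inverse in the algebra; its image under
  \<open>\<rho>\<close> is the inverse required by \<open>contraction_of_resolvents\<close>.\<close>

lemma unital_star_rep_contraction:
  fixes \<rho> :: "'a::unital_cstar_algebra \<Rightarrow> 'h::chilbert_space \<Rightarrow> 'h"
  assumes \<rho>: "unital_star_rep \<rho>"
  shows "norm (\<rho> a v) \<le> norm a * norm v"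
proof (rule contraction_of_resolvents)
  show "bounded_clinear (\<rho> a)" using \<rho> unfolding unital_star_rep_def by blast
  fix m assume m: "norm a < m"
  define h where "h = complex_of_real (1 / m\<^sup>2) *\<^sub>C (star a * a)"
  have "norm h = (norm a)\<^sup>2 / m\<^sup>2" by (simp add: h_def norm_scaleC cstar_identity norm_divide norm_power)
  also have "\<dots> < 1" using power_strict_mono[OF m, of 2] order_le_less_trans[OF norm_ge_zero m] by simp
  finally have y: "(\<Sum>k. h ^ k) * (1 - h) = 1" by (rule geometric_inverse)
  let ?y = "\<Sum>k. h ^ k"
  have rep: "bounded_clinear (\<rho> x)" "\<rho> (x + y) = (\<lambda>v. \<rho> x v + \<rho> y v)" "\<rho> (c *\<^sub>C x) = (\<lambda>v. c *\<^sub>C \<rho> x v)"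
    "\<rho> (x * y) = \<rho> x \<circ> \<rho> y" "\<rho> (star x) = adj (\<rho> x)" "\<rho> 1 = id" for x y c
    using \<rho> unfolding unital_star_rep_def by blast+
  have "\<rho> ?y (v - (1 / m\<^sup>2) *\<^sub>R adj (\<rho> a) (\<rho> a v)) = v" for v
  proof -
    have "\<rho> (1 + (-1) *\<^sub>C h) v = v + (-1) *\<^sub>C complex_of_real (1 / m\<^sup>2) *\<^sub>C adj (\<rho> a) (\<rho> a v)"
      unfolding h_def rep by simp
    also have "\<dots> = v - (1 / m\<^sup>2) *\<^sub>R adj (\<rho> a) (\<rho> a v)"
      by (simp only: scaleC_minus_one scaleR_scaleC diff_conv_add_uminus)
    finally have "\<rho> ?y (v - (1 / m\<^sup>2) *\<^sub>R adj (\<rho> a) (\<rho> a v)) = \<rho> (?y * (1 + (-1) *\<^sub>C h)) v"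
      by (simp add: rep)
    also have "1 + (-1) *\<^sub>C h = 1 - h" by (simp add: scaleC_minus_one)
    finally show ?thesis by (simp add: y rep)
  qed
  thus "\<exists>R. bounded_clinear R \<and> (\<forall>v. R (v - (1 / m\<^sup>2) *\<^sub>R adj (\<rho> a) (\<rho> a v)) = v)"
    using rep(1) by blast
qed simp

section \<open>Elements of the concrete free product\<close>

lemma scaleC_zero_right: "c *\<^sub>C (0::'a::complex_vector) = 0"
  by (metis add_cancel_right_right scaleC_add_right)

lemma fp_emb_bounded: "bounded_clinear (fp_emb j a \<kappa>)"
proof (cases "\<kappa> \<in> families")
  case True
  hence "bounded_clinear (\<kappa> j a)" by (simp add: families_def unital_star_rep_def)
  thus ?thesis using True by (simp add: fp_emb_def)
next
  case False
  thus ?thesis by (intro bounded_clinearI[where B=0]) (simp_all add: fp_emb_def scaleC_zero_right)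
qed

text \<open>Every clause passes directly to intersections except nonemptiness, for which
  \<open>fp_emb j 1\<close> with \<open>j\<close> in \<open>I\<close> is the witness.\<close>

lemma fp_cstar_subalgebra_local:
  assumes "I \<noteq> {}" shows "fp_cstar_subalgebra (fp_local I :: 'a::unital_cstar_algebra fp set)"
proof -
  let ?S = "{t :: 'a fp set. fp_cstar_subalgebra t \<and> (\<Union>j\<in>I. range (fp_emb j)) \<subseteq> t}"
  have eq: "fp_local I = \<Inter>?S" by (simp add: fp_local_def hull_def)
  obtain j where "j \<in> I" using assms by blast
  hence "fp_emb j 1 \<in> \<Inter>?S" by auto
  hence ne: "fp_local I \<noteq> ({} :: 'a fp set)" unfolding eq by blast
  have cl: "fp_closed (fp_local I :: 'a fp set)"
    unfolding fp_closed_def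
  proof (intro allI impI)
    fix x :: "'a fp"
    assume x: "\<forall>e>0. \<exists>y\<in>fp_local I. \<forall>\<kappa> v. norm (x \<kappa> v - y \<kappa> v) \<le> e * norm v"
    have "x \<in> t" if t: "t \<in> ?S" for t
    proof -
      have "\<forall>e>0. \<exists>y\<in>t. \<forall>\<kappa> v. norm (x \<kappa> v - y \<kappa> v) \<le> e * norm v"
        using x t unfolding eq by (meson InterD)
      thus ?thesis using t unfolding fp_cstar_subalgebra_def fp_closed_def by blast
    qed
    thus "x \<in> fp_local I" unfolding eq by blast
  qed
  have ops: "fp_add x y \<in> fp_local I" "fp_mult x y \<in> fp_local I" "fp_scale c x \<in> fp_local I"
    "fp_star x \<in> fp_local I" if "x \<in> fp_local I" "y \<in> fp_local I" for x y :: "'a fp" and c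
    using that unfolding eq fp_cstar_subalgebra_def by auto
  show ?thesis unfolding fp_cstar_subalgebra_def by (intro conjI ballI allI ne cl ops)
qed

lemma fp_local_induct:
  assumes "fp_cstar_subalgebra S" "\<And>j a. j \<in> I \<Longrightarrow> fp_emb j a \<in> S"
  shows "fp_local I \<subseteq> S"
  unfolding fp_local_def by (rule hull_minimal) (use assms in auto)

lemma fp_emb_local: "j \<in> I \<Longrightarrow> fp_emb j a \<in> fp_local I"
  unfolding fp_local_def by (rule hull_inc) auto

lemma fp_emb_free_product: "fp_emb j a \<in> free_product"
  unfolding free_product_def by (rule fp_emb_local) simp

lemma
  shows fp_add_free: "x \<in> free_product \<Longrightarrow> y \<in> free_product \<Longrightarrow> fp_add x y \<in> free_product"
    and fp_mult_free: "x \<in> free_product \<Longrightarrow> y \<in> free_product \<Longrightarrow> fp_mult x y \<in> free_product"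
    and fp_scale_free: "x \<in> free_product \<Longrightarrow> fp_scale c x \<in> free_product"
    and fp_star_free: "x \<in> free_product \<Longrightarrow> fp_star x \<in> free_product"
    and fp_closed_free: "fp_closed (free_product :: 'a::unital_cstar_algebra fp set)"
  using fp_cstar_subalgebra_local[of UNIV] unfolding free_product_def fp_cstar_subalgebra_def by auto

lemma bounded_clinear_uniform_limit:
  fixes T :: "'h::chilbert_space \<Rightarrow> 'h"
  assumes "\<And>e. e > 0 \<Longrightarrow> \<exists>S. bounded_clinear S \<and> (\<forall>v. norm (T v - S v) \<le> e * norm v)"
  shows "bounded_clinear T"
proof -
  have "\<exists>S. bounded_clinear S \<and> (\<forall>v. norm (T v - S v) \<le> (1 / real (Suc n)) * norm v)" for n
    by (rule assms) simp
  then obtain S where S: "\<And>n. bounded_clinear (S n)"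
    and d: "\<And>n v. norm (T v - S n v) \<le> (1 / real (Suc n)) * norm v"
    by metis
  have lim: "(\<lambda>n. S n v) \<longlonglongrightarrow> T v" for v
  proof (rule LIM_zero_cancel, rule Lim_null_comparison)
    show "\<forall>\<^sub>F n in sequentially. norm (S n v - T v) \<le> (1 / real (Suc n)) * norm v"
      using d by (simp add: norm_minus_commute)
    show "(\<lambda>n. (1 / real (Suc n)) * norm v) \<longlonglongrightarrow> 0"
      by (rule tendsto_mult_left_zero) (rule LIMSEQ_inverse_real_of_nat[unfolded inverse_eq_divide])
  qed
  obtain B where B: "\<And>v. norm (S 0 v) \<le> B * norm v" using clinear_bound[OF S] by metis
  show ?thesis
  proof (rule bounded_clinearI)
    fix x y c
    have "(\<lambda>n. S n (x + y)) \<longlonglongrightarrow> T x + T y"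
      unfolding clinear_add[OF S] by (intro tendsto_add lim)
    thus "T (x + y) = T x + T y" by (rule LIMSEQ_unique[OF lim])
    have "(\<lambda>n. S n (c *\<^sub>C x)) \<longlonglongrightarrow> c *\<^sub>C T x"
      unfolding clinear_scaleC[OF S] by (intro bounded_linear.tendsto[OF bounded_linear_scaleC] lim)
    thus "T (c *\<^sub>C x) = c *\<^sub>C T x" by (rule LIMSEQ_unique[OF lim])
    show "norm (T x) \<le> (1 + B) * norm x"
      using norm_triangle_ineq[of "T x - S 0 x" "S 0 x"] d[of x 0] B[of x] by (simp add: distrib_right)
  qed
qed

lemma adj_zero: "adj (\<lambda>_. 0) = (\<lambda>_. 0)"
  by (rule adj_unique) (simp add: cinner.zero_left cinner.zero_right)

lemma fp_star_emb: "fp_star (fp_emb j a) = fp_emb j (star a)"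
proof
  fix \<kappa> :: "'a family"
  show "fp_star (fp_emb j a) \<kappa> = fp_emb j (star a) \<kappa>"
  proof (cases "\<kappa> \<in> families")
    case True
    hence "\<kappa> j (star a) = adj (\<kappa> j a)" by (simp add: families_def unital_star_rep_def)
    thus ?thesis using True by (simp add: fp_star_def fp_emb_def)
  next
    case False
    thus ?thesis by (simp add: fp_star_def fp_emb_def adj_zero)
  qed
qed

text \<open>The functions with both properties form a C*-subalgebra containing the letters, so the
  hull lies inside it. The bound of \<open>x \<kappa>\<close> obtained here may depend on
  \<open>\<kappa>\<close>.\<close>

lemma free_product_bounded:
  assumes "x \<in> free_product"
  shows "bounded_clinear (x \<kappa>)" and "\<kappa> \<notin> families \<Longrightarrow> x \<kappa> v = 0"
proof -
  let ?S = "{x :: 'a fp. \<forall>\<kappa>. bounded_clinear (x \<kappa>) \<and> (\<kappa> \<notin> families \<longrightarrow> (\<forall>v. x \<kappa> v = 0))}"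
  have 1: "fp_closed ?S"
    unfolding fp_closed_def
  proof (intro allI impI)
    fix x :: "'a fp"
    assume x: "\<forall>e>0. \<exists>y\<in>?S. \<forall>\<kappa> v. norm (x \<kappa> v - y \<kappa> v) \<le> e * norm v"
    have A: "bounded_clinear (x \<kappa>)" for \<kappa>
    proof (rule bounded_clinear_uniform_limit)
      fix e :: real assume "e > 0"
      then obtain y where "y \<in> ?S" "\<forall>\<kappa> v. norm (x \<kappa> v - y \<kappa> v) \<le> e * norm v" using x by blast
      thus "\<exists>S. bounded_clinear S \<and> (\<forall>v. norm (x \<kappa> v - S v) \<le> e * norm v)"
        by (intro exI[of _ "y \<kappa>"]) simp
    qed
    have B: "x \<kappa> v = 0" if \<kappa>: "\<kappa> \<notin> families" for \<kappa> v
    proof -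
      have le: "norm (x \<kappa> v) \<le> e * norm v" if e: "e > 0" for e
      proof -
        obtain y where "y \<in> ?S" "norm (x \<kappa> v - y \<kappa> v) \<le> e * norm v" using x e by blast
        thus ?thesis using \<kappa> by simp
      qed
      have "norm (x \<kappa> v) \<le> 0 + e" if "e > 0" for e
      proof -
        \<comment> \<open>The summand 1 avoids a division by zero at \<open>v = 0\<close>.\<close>
        have "norm (x \<kappa> v) \<le> (e / (1 + norm v)) * norm v" by (rule le) (use that in \<open>simp add: add_pos_nonneg\<close>)
        also have "\<dots> \<le> (e / (1 + norm v)) * (1 + norm v)" using that by (intro mult_left_mono) auto
        also have "\<dots> = e" using norm_ge_zero[of v] by (simp add: add_pos_nonneg less_imp_neq[symmetric])
        finally show ?thesis by simp
      qed
      hence "norm (x \<kappa> v) \<le> 0" by (rule field_le_epsilon)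
      thus "x \<kappa> v = 0" by simp
    qed
    show "x \<in> ?S" using A B by blast
  qed
  have 2: "fp_emb j a \<in> ?S" for j and a :: 'a
    unfolding mem_Collect_eq by (intro allI conjI impI fp_emb_bounded) (simp add: fp_emb_def)
  have 3: "fp_add x y \<in> ?S" "fp_mult x y \<in> ?S" "fp_scale c x \<in> ?S" if "x \<in> ?S" "y \<in> ?S" for x y c
    using that unfolding fp_add_def fp_mult_def fp_scale_def
    by (simp_all add: bounded_clinear_add bounded_clinear_comp bounded_clinear_scaleC scaleC_zero_right)
  have 4: "fp_star x \<in> ?S" if x: "x \<in> ?S" for x
  proof -
    have "adj (x \<kappa>) v = 0" if "\<kappa> \<notin> families" for \<kappa> v
    proof -
      have "x \<kappa> = (\<lambda>_. 0)" using x that by auto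
      thus ?thesis by (simp add: adj_zero)
    qed
    thus ?thesis using x unfolding fp_star_def by (simp add: bounded_clinear_adj)
  qed
  have "?S \<noteq> {}" using 2 by blast
  hence "fp_cstar_subalgebra ?S"
    unfolding fp_cstar_subalgebra_def by (intro conjI ballI allI 1 3 4)
  hence "free_product \<subseteq> ?S" unfolding free_product_def
    by (rule fp_local_induct) (rule 2)
  thus "bounded_clinear (x \<kappa>)" "\<kappa> \<notin> families \<Longrightarrow> x \<kappa> v = 0" using assms by auto
qed


text \<open>Index 0 is the one at which \<open>gt_rep\<close> fixes the unit; the element vanishes
  off \<open>families\<close>, so it is not the constant identity.\<close>

definition fp_one :: "'a::unital_cstar_algebra fp" where "fp_one = fp_emb 0 1"

lemma fp_one_apply: "fp_one \<kappa> v = (if \<kappa> \<in> families then v else 0)"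
  by (simp add: fp_one_def fp_emb_def families_def unital_star_rep_def)

fun fp_power :: "'a::unital_cstar_algebra fp \<Rightarrow> nat \<Rightarrow> 'a fp" where
  "fp_power h 0 = fp_one"
| "fp_power h (Suc k) = fp_mult (fp_power h k) h"

text \<open>Partial sums of the Neumann series. Zero is written as a multiple of
  \<open>fp_one\<close>, so that membership in \<open>free_product\<close> follows from its closure
  rules.\<close>

fun fp_geometric :: "'a::unital_cstar_algebra fp \<Rightarrow> nat \<Rightarrow> 'a fp" where
  "fp_geometric h 0 = fp_scale 0 fp_one"
| "fp_geometric h (Suc n) = fp_add (fp_geometric h n) (fp_power h n)"

text \<open>Completeness is available only in the form \<open>fp_closed\<close>. The Neumann series
  is therefore summed pointwise in \<open>\<kappa>\<close> and \<open>v\<close>, and a tail estimate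
  uniform in \<open>\<kappa>\<close> brings the sum back into the free product.\<close>

lemma fp_geometric_inverse:
  fixes h :: "'a::unital_cstar_algebra fp"
  assumes h: "h \<in> free_product" and q: "0 \<le> q" "q < 1" and hq: "\<And>\<kappa> v. norm (h \<kappa> v) \<le> q * norm v"
  obtains y where "y \<in> free_product" "\<And>\<kappa> v. y \<kappa> (v - h \<kappa> v) = fp_one \<kappa> v"
proof -
  have one: "fp_one \<in> (free_product :: 'a fp set)" unfolding fp_one_def by (rule fp_emb_free_product)
  have p: "fp_power h k \<in> free_product" for k
    by (induction k) (simp_all add: one fp_mult_free h)
  have S: "fp_geometric h n \<in> free_product" for n
    by (induction n) (simp_all add: fp_scale_free one fp_add_free p)
  have S_sum: "fp_geometric h n \<kappa> v = (\<Sum>k<n. fp_power h k \<kappa> v)" for n \<kappa> v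
    by (induction n) (simp_all add: fp_scale_def scaleC_zero_left fp_add_def)
  have bound: "norm (fp_power h k \<kappa> v) \<le> q ^ k * norm v" for k \<kappa> v
  proof (induction k arbitrary: v)
    case 0 thus ?case by (simp add: fp_one_apply)
  next
    case (Suc k)
    have "norm (fp_power h (Suc k) \<kappa> v) \<le> q ^ k * norm (h \<kappa> v)" using Suc[of "h \<kappa> v"] by (simp add: fp_mult_def)
    also have "\<dots> \<le> q ^ k * (q * norm v)" by (intro mult_left_mono hq) (simp add: q)
    finally show ?case by (simp add: mult_ac)
  qed
  have gs: "summable (\<lambda>k. q ^ k * norm v)" for v :: "'a word_space"
    by (intro summable_mult2 summable_geometric) (use q in simp)
  have sm: "summable (\<lambda>k. fp_power h k \<kappa> v)" for \<kappa> v
    by (rule summable_comparison_test'[OF gs, of 0]) (rule bound)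
  define y where "y \<kappa> v = (\<Sum>k. fp_power h k \<kappa> v)" for \<kappa> v
  have tail: "norm (y \<kappa> v - fp_geometric h n \<kappa> v) \<le> q ^ n / (1 - q) * norm v" for n \<kappa> v
  proof -
    have "y \<kappa> v - fp_geometric h n \<kappa> v = (\<Sum>k. fp_power h (k + n) \<kappa> v)"
      unfolding y_def S_sum by (rule suminf_minus_initial_segment[OF sm, symmetric])
    also have "norm \<dots> \<le> (\<Sum>k. q ^ (k + n) * norm v)"
    proof (rule norm_suminf_le)
      show "norm (fp_power h (k + n) \<kappa> v) \<le> q ^ (k + n) * norm v" for k by (rule bound)
      show "summable (\<lambda>k. q ^ (k + n) * norm v)"
        using gs[of v] by (subst summable_iff_shift)
    qed
    also have "\<dots> = (\<Sum>k. q ^ k * (q ^ n * norm v))" by (simp only: power_add mult.assoc)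
    also have "\<dots> = (\<Sum>k. q ^ k) * (q ^ n * norm v)"
      by (rule suminf_mult2[symmetric]) (use q in \<open>simp add: summable_geometric\<close>)
    also have "(\<Sum>k. q ^ k) = 1 / (1 - q)" by (rule suminf_geometric) (use q in simp)
    finally show ?thesis by simp
  qed
  have "y \<in> free_product"
  proof -
    have "\<exists>z\<in>free_product. \<forall>\<kappa> v. norm (y \<kappa> v - z \<kappa> v) \<le> e * norm v" if e: "e > 0" for e
    proof -
      obtain n where "q ^ n < e * (1 - q)" using real_arch_pow_inv[of "e * (1 - q)" q] e q by auto
      hence n: "q ^ n / (1 - q) \<le> e" using q by (simp add: field_simps)
      show ?thesis
        by (rule bexI[OF _ S[of n]]) (use tail n in \<open>meson mult_right_mono norm_ge_zero order_trans\<close>)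
    qed
    thus ?thesis using fp_closed_free[where 'a='a] unfolding fp_closed_def by blast
  qed
  moreover have "y \<kappa> (v - h \<kappa> v) = fp_one \<kappa> v" for \<kappa> v
  proof -
    have "fp_power h k \<kappa> (v - h \<kappa> v) = fp_power h k \<kappa> v - fp_power h (Suc k) \<kappa> v" for k
      using clinear_diff[OF free_product_bounded(1)[OF p]] by (simp add: fp_mult_def)
    hence "y \<kappa> (v - h \<kappa> v) = (\<Sum>k. fp_power h k \<kappa> v - fp_power h (Suc k) \<kappa> v)" by (simp add: y_def)
    also have "\<dots> = fp_power h 0 \<kappa> v - 0"
      by (rule sums_unique[symmetric], rule telescope_sums') (rule summable_LIMSEQ_zero[OF sm])
    finally show ?thesis by simp
  qed
  ultimately show ?thesis by (rule that)
qed

section \<open>Representations of the graded tensor product\<close>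

context
  fixes \<theta> :: "'a::unital_cstar_algebra \<Rightarrow> 'a" and \<pi> :: "'a gt \<Rightarrow> 'h::chilbert_space \<Rightarrow> 'h"
  assumes rep: "gt_rep \<theta> \<pi>"
begin

lemma
  shows gt_rep_bounded: "x \<in> free_product \<Longrightarrow> bounded_clinear (\<pi> (gt_coset \<theta> x))"
    and gt_rep_add: "x \<in> free_product \<Longrightarrow> y \<in> free_product \<Longrightarrow>
      \<pi> (gt_coset \<theta> (fp_add x y)) = (\<lambda>v. \<pi> (gt_coset \<theta> x) v + \<pi> (gt_coset \<theta> y) v)"
    and gt_rep_scale: "x \<in> free_product \<Longrightarrow> \<pi> (gt_coset \<theta> (fp_scale c x)) = (\<lambda>v. c *\<^sub>C \<pi> (gt_coset \<theta> x) v)"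
    and gt_rep_mult: "x \<in> free_product \<Longrightarrow> y \<in> free_product \<Longrightarrow>
      \<pi> (gt_coset \<theta> (fp_mult x y)) = \<pi> (gt_coset \<theta> x) \<circ> \<pi> (gt_coset \<theta> y)"
    and gt_rep_star: "x \<in> free_product \<Longrightarrow> \<pi> (gt_coset \<theta> (fp_star x)) = adj (\<pi> (gt_coset \<theta> x))"
    and gt_rep_one: "\<pi> (gt_coset \<theta> fp_one) = id"
  using rep unfolding gt_rep_def gt_emb_def fp_one_def by blast+

lemma fp_diff_eq: "fp_diff x y = fp_add x (fp_scale (-1) y)"
  by (simp add: fp_diff_def fp_add_def fp_scale_def scaleC_minus_one)

lemma fp_diff_free: "x \<in> free_product \<Longrightarrow> y \<in> free_product \<Longrightarrow> fp_diff x y \<in> free_product"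
  unfolding fp_diff_eq by (intro fp_add_free fp_scale_free)

lemma gt_rep_diff:
  assumes "x \<in> free_product" "y \<in> free_product"
  shows "\<pi> (gt_coset \<theta> (fp_diff x y)) v = \<pi> (gt_coset \<theta> x) v - \<pi> (gt_coset \<theta> y) v"
  using assms by (simp add: fp_diff_eq gt_rep_add gt_rep_scale fp_scale_free scaleC_minus_one)

text \<open>\<open>gt_rep\<close> is purely algebraic, so continuity is derived as in
  \<open>unital_star_rep_contraction\<close>, now with a Neumann series of ratio
  \<open>B\<^sup>2 / m\<^sup>2\<close>. The bound is taken on the representative \<open>x\<close>,
  so the quotient norm does not enter.\<close>

lemma gt_rep_contraction:
  assumes x: "x \<in> free_product" and "0 \<le> B" and xB: "\<And>\<kappa> v. norm (x \<kappa> v) \<le> B * norm v"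
  shows "norm (\<pi> (gt_coset \<theta> x) v) \<le> B * norm v"
proof (rule contraction_of_resolvents)
  let ?T = "\<pi> (gt_coset \<theta> x)"
  show "bounded_clinear ?T" by (rule gt_rep_bounded[OF x])
  show "0 \<le> B" by fact
  fix m assume m: "B < m"
  hence m0: "m > 0" using \<open>0 \<le> B\<close> by simp
  define h where "h = fp_scale (complex_of_real (1 / m\<^sup>2)) (fp_mult (fp_star x) x)"
  have h: "h \<in> free_product" unfolding h_def by (intro fp_scale_free fp_mult_free fp_star_free x)
  have hq: "norm (h \<kappa> v) \<le> (B\<^sup>2 / m\<^sup>2) * norm v" for \<kappa> v
  proof -
    have "norm (adj (x \<kappa>) (x \<kappa> v)) \<le> B * norm (x \<kappa> v)"
      by (rule adj_bound[OF free_product_bounded(1)[OF x] xB])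
    also have "\<dots> \<le> B * (B * norm v)" by (intro mult_left_mono xB \<open>0 \<le> B\<close>)
    finally have "(1 / m\<^sup>2) * norm (adj (x \<kappa>) (x \<kappa> v)) \<le> (1 / m\<^sup>2) * (B * (B * norm v))"
      by (rule mult_left_mono) simp
    thus ?thesis
      by (simp add: h_def fp_scale_def fp_mult_def fp_star_def norm_scaleC norm_divide norm_power mult.assoc power2_eq_square norm_mult)
  qed
  have "B\<^sup>2 / m\<^sup>2 < 1" using power_strict_mono[OF m \<open>0 \<le> B\<close>, of 2] m0 by simp
  then obtain y where y: "y \<in> free_product" "\<And>\<kappa> v. y \<kappa> (v - h \<kappa> v) = fp_one \<kappa> v"
    using fp_geometric_inverse[OF h _ _ hq] by auto
  have one: "fp_one \<in> (free_product :: 'a fp set)" unfolding fp_one_def by (rule fp_emb_free_product)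
  \<comment> \<open>Off \<open>families\<close> both sides are 0; on \<open>families\<close> the
    unit acts as the identity.\<close>
  have "fp_mult y (fp_diff fp_one h) = fp_one"
  proof (intro ext)
    fix \<kappa> v
    show "fp_mult y (fp_diff fp_one h) \<kappa> v = fp_one \<kappa> v"
      using y(2)[of \<kappa> v] clinear_zero[OF free_product_bounded(1)[OF y(1), of \<kappa>]]
        free_product_bounded(2)[OF h, of \<kappa> v]
      by (cases "\<kappa> \<in> families") (simp_all add: fp_mult_def fp_diff_def fp_one_apply)
  qed
  hence "\<pi> (gt_coset \<theta> y) \<circ> \<pi> (gt_coset \<theta> (fp_diff fp_one h)) = id"
    using gt_rep_mult[OF y(1) fp_diff_free[OF one h]] gt_rep_one by simp
  hence "\<pi> (gt_coset \<theta> y) (\<pi> (gt_coset \<theta> (fp_diff fp_one h)) v) = v" for v by (simp add: fun_eq_iff)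
  moreover have "\<pi> (gt_coset \<theta> (fp_diff fp_one h)) v = v - (1 / m\<^sup>2) *\<^sub>R adj ?T (?T v)" for v
    unfolding gt_rep_diff[OF one h] gt_rep_one
    by (simp only: h_def gt_rep_scale fp_mult_free fp_star_free x gt_rep_mult gt_rep_star o_apply id_apply
        scaleR_scaleC)
  ultimately have "\<pi> (gt_coset \<theta> y) (v - (1 / m\<^sup>2) *\<^sub>R adj ?T (?T v)) = v" for v by metis
  thus "\<exists>R. bounded_clinear R \<and> (\<forall>v. R (v - (1 / m\<^sup>2) *\<^sub>R adj ?T (?T v)) = v)"
    using gt_rep_bounded[OF y(1)] by blast
qed

lemma adj_closed_gt_emb: "adj_closed (\<Union>j\<in>I. range (\<lambda>a. \<pi> (gt_emb \<theta> j a)))"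
proof -
  have "adj (\<pi> (gt_emb \<theta> j a)) = \<pi> (gt_emb \<theta> j (star a))" for j a
    using gt_rep_star[OF fp_emb_free_product[of j a]] by (simp add: gt_emb_def fp_star_emb)
  moreover have "bounded_clinear (\<pi> (gt_emb \<theta> j a))" for j a
    unfolding gt_emb_def by (rule gt_rep_bounded[OF fp_emb_free_product])
  ultimately show ?thesis unfolding adj_closed_def by auto
qed

text \<open>The elements whose image lies in the bicommutant form a C*-subalgebra containing the
  letters; its norm closedness is where \<open>gt_rep_contraction\<close> enters.\<close>

lemma gt_rep_local_bicommutant:
  assumes "x \<in> fp_local I"
  shows "\<pi> (gt_coset \<theta> x) \<in> commutant (commutant (\<Union>j\<in>I. range (\<lambda>a. \<pi> (gt_emb \<theta> j a))))"
proof -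
  let ?C = "commutant (\<Union>j\<in>I. range (\<lambda>a. \<pi> (gt_emb \<theta> j a)))"
  let ?S = "{x \<in> free_product. \<pi> (gt_coset \<theta> x) \<in> commutant ?C}"
  have gen: "\<pi> (gt_emb \<theta> j a) \<in> commutant ?C" if "j \<in> I" for j a
    using that gt_rep_bounded[OF fp_emb_free_product] by (auto simp: commutant_iff gt_emb_def)
  have ac: "adj_closed (commutant ?C)" by (intro adj_closed_commutant adj_closed_gt_emb)
  have 1: "fp_closed ?S"
    unfolding fp_closed_def
  proof (intro allI impI)
    fix x :: "'a fp"
    assume x: "\<forall>e>0. \<exists>y\<in>?S. \<forall>\<kappa> v. norm (x \<kappa> v - y \<kappa> v) \<le> e * norm v"
    have xf: "x \<in> free_product"
    proof -
      have "\<forall>e>0. \<exists>y\<in>free_product. \<forall>\<kappa> v. norm (x \<kappa> v - y \<kappa> v) \<le> e * norm v"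
        using x by (metis (no_types, lifting) mem_Collect_eq)
      thus ?thesis using fp_closed_free[where 'a='a] unfolding fp_closed_def by blast
    qed
    have "\<pi> (gt_coset \<theta> x) (T v) = T (\<pi> (gt_coset \<theta> x) v)" if T: "T \<in> ?C" for T v
    proof -
      let ?X = "\<pi> (gt_coset \<theta> x)"
      have bT: "bounded_clinear T" by (rule commutant_bounded[OF T])
      obtain K where K: "K > 0" "\<And>v. norm (T v) \<le> K * norm v" using clinear_bound[OF bT] by blast
      \<comment> \<open>Chosen so that the two error terms, \<open>(e / c) * norm (T v)\<close> and
        \<open>K * ((e / c) * norm v)\<close>, add up to at most \<open>e\<close>; the 1 keeps it
        positive.\<close>
      define c where "c = 1 + norm (T v) + K * norm v"
      have c: "c > 0" using K(1) by (simp add: c_def add_pos_nonneg)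
      have "norm (?X (T v) - T (?X v)) \<le> 0 + e" if e: "e > 0" for e
      proof -
        obtain y where y: "y \<in> free_product" "\<pi> (gt_coset \<theta> y) \<in> commutant ?C"
          and d: "\<And>\<kappa> v. norm (x \<kappa> v - y \<kappa> v) \<le> (e / c) * norm v"
          using x[rule_format, of "e / c"] e c by auto
        let ?Y = "\<pi> (gt_coset \<theta> y)"
        have dd: "norm (?X w - ?Y w) \<le> (e / c) * norm w" for w
          unfolding gt_rep_diff[OF xf y(1), symmetric]
          by (rule gt_rep_contraction[OF fp_diff_free[OF xf y(1)]]) (use d e c in \<open>simp_all add: fp_diff_def\<close>)
        have YT: "?Y (T v) = T (?Y v)" using y(2) T by (simp add: commutant_iff)
        have "?X (T v) - T (?X v) = (?X (T v) - ?Y (T v)) - T (?X v - ?Y v)"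
          using YT clinear_diff[OF bT] by simp
        also have "norm \<dots> \<le> norm (?X (T v) - ?Y (T v)) + norm (T (?X v - ?Y v))"
          by (rule norm_triangle_ineq4)
        also have "\<dots> \<le> (e / c) * norm (T v) + K * ((e / c) * norm v)"
          by (intro add_mono dd order_trans[OF K(2)] mult_left_mono) (use K in simp)
        also have "\<dots> = (e / c) * (norm (T v) + K * norm v)" by (simp add: algebra_simps)
        also have "\<dots> \<le> (e / c) * c" using e c by (intro mult_left_mono) (auto simp: c_def)
        also have "\<dots> = e" using c by simp
        finally show ?thesis by simp
      qed
      hence "norm (?X (T v) - T (?X v)) \<le> 0" by (rule field_le_epsilon)
      thus ?thesis by simp
    qed
    hence "\<pi> (gt_coset \<theta> x) \<in> commutant ?C"
      using gt_rep_bounded[OF xf] unfolding commutant_iff[of _ ?C] by blast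
    thus "x \<in> ?S" using xf by blast
  qed
  have 2: "fp_add x y \<in> ?S" "fp_mult x y \<in> ?S" "fp_scale c x \<in> ?S" "fp_star x \<in> ?S"
    if "x \<in> ?S" "y \<in> ?S" for x y c
  proof -
    have xy: "x \<in> free_product" "y \<in> free_product" "\<pi> (gt_coset \<theta> x) \<in> commutant ?C" "\<pi> (gt_coset \<theta> y) \<in> commutant ?C"
      using that by auto
    have lin: "T (u + w) = T u + T w" "T (c *\<^sub>C u) = c *\<^sub>C T u" if "T \<in> ?C" for T u w
      using clinear_add clinear_scaleC commutant_bounded[OF that] by blast+
    show "fp_add x y \<in> ?S" "fp_scale c x \<in> ?S"
      using xy lin unfolding mem_Collect_eq commutant_iff[of _ ?C]
      by (simp_all add: fp_add_free fp_scale_free gt_rep_add gt_rep_scale bounded_clinear_add bounded_clinear_scaleC)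
    show "fp_mult x y \<in> ?S"
      using xy by (simp add: fp_mult_free gt_rep_mult commutant_comp)
    show "fp_star x \<in> ?S"
      using xy ac by (simp add: fp_star_free gt_rep_star adj_closed_def)
  qed
  have "fp_one \<in> ?S" using fp_emb_free_product[of 0 "1::'a"] gt_rep_one by (simp add: fp_one_def commutant_id)
  hence "?S \<noteq> {}" by blast
  hence "fp_cstar_subalgebra ?S"
    unfolding fp_cstar_subalgebra_def by (intro conjI ballI allI 1 2)
  hence "fp_local I \<subseteq> ?S"
    by (rule fp_local_induct) (use gen fp_emb_free_product in \<open>simp add: gt_emb_def\<close>)
  thus ?thesis using assms by blast
qed

text \<open>Norm closures and the restriction to finite index sets both disappear under
  bicommutants: each letter lies in a local algebra with one index, and each local algebra is
  represented inside the bicommutant of its letters.\<close>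

lemma tail_algebra_eq:
  "tail_algebra \<theta> \<pi> = (\<Inter>n\<in>{1..}. commutant (commutant (\<Union>j\<in>{n..}. range (\<lambda>a. \<pi> (gt_emb \<theta> j a)))))"
proof -
  define A where "A I = (\<Union>j\<in>I. range (\<lambda>a. \<pi> (gt_emb \<theta> j a)))" for I
  have acA: "adj_closed (A I)" for I unfolding A_def by (rule adj_closed_gt_emb)
  have bA: "bounded_clinear s" if "s \<in> A I" for s I using acA that unfolding adj_closed_def by blast
  have loc: "commutant (commutant (\<pi> ` gt_local \<theta> I)) = commutant (commutant (A I))" for I
  proof
    show "commutant (commutant (\<pi> ` gt_local \<theta> I)) \<subseteq> commutant (commutant (A I))"
      by (rule bicommutant_least) (use gt_rep_local_bicommutant in \<open>auto simp: A_def gt_local_def\<close>)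
    show "commutant (commutant (A I)) \<subseteq> commutant (commutant (\<pi> ` gt_local \<theta> I))"
      by (rule bicommutant_mono) (auto simp: A_def gt_local_def gt_emb_def intro!: imageI fp_emb_local)
  qed
  have "vN_gen (\<Union>I\<in>{I. finite I \<and> I \<subseteq> {n..}}. commutant (commutant (A I))) = commutant (commutant (A {n..}))" for n
  proof -
    let ?G = "\<Union>I\<in>{I. finite I \<and> I \<subseteq> {n..}}. commutant (commutant (A I))"
    have "adj_closed (commutant (commutant (A I)))" for I by (intro adj_closed_commutant acA)
    hence ac: "adj_closed ?G" unfolding adj_closed_def by blast
    have "A I \<subseteq> A {n..}" if "I \<subseteq> {n..}" for I unfolding A_def using that by blast
    hence 1: "?G \<subseteq> commutant (commutant (A {n..}))" using bicommutant_mono by blast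
    have "A {n..} \<subseteq> ?G"
    proof
      fix s assume "s \<in> A {n..}"
      then obtain j where j: "j \<ge> n" "s \<in> A {j}" by (auto simp: A_def)
      hence "s \<in> commutant (commutant (A {j}))"
        using commutant_commutant_superset[of "A {j}"] bA[of _ "{j}"] by blast
      moreover have "{j} \<in> {I. finite I \<and> I \<subseteq> {n..}}" using j by simp
      ultimately show "s \<in> ?G" by blast
    qed
    with bicommutant_mono bicommutant_least[OF 1] show ?thesis unfolding vN_gen_eq[OF ac] by blast
  qed
  thus ?thesis unfolding tail_algebra_def loc by (simp add: A_def)
qed

end

section \<open>Graded words\<close>

text \<open>\<open>True\<close> means odd, so that parities add by \<open>\<noteq>\<close>.\<close>

definition parity :: "('a::unital_cstar_algebra \<Rightarrow> 'a) \<Rightarrow> bool \<Rightarrow> 'a \<Rightarrow> bool" where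
  "parity \<theta> q a \<longleftrightarrow> \<theta> a = (if q then - a else a)"

text \<open>A relation and not a function: a word with an inhomogeneous letter has no parity, and a
  word containing the letter 0 may have both.\<close>

inductive word_parity :: "('a::unital_cstar_algebra \<Rightarrow> 'a) \<Rightarrow> bool \<Rightarrow> (nat \<times> 'a) list \<Rightarrow> bool"
  for \<theta> where
  Nil: "word_parity \<theta> False []"
| Cons: "parity \<theta> p a \<Longrightarrow> word_parity \<theta> q w \<Longrightarrow> word_parity \<theta> (p \<noteq> q) ((j, a) # w)"

definition koszul :: "bool \<Rightarrow> bool \<Rightarrow> real" where
  "koszul p q = (if p \<and> q then -1 else 1)"

definition relabel :: "(nat \<Rightarrow> nat) \<Rightarrow> (nat \<times> 'a) list \<Rightarrow> (nat \<times> 'a) list" where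
  "relabel f w = map (\<lambda>(j, a). (f j, a)) w"

definition word_star :: "(nat \<times> 'a::unital_cstar_algebra) list \<Rightarrow> (nat \<times> 'a) list" where
  "word_star w = rev (map (\<lambda>(j, a). (j, star a)) w)"

definition indices :: "(nat \<times> 'a) list \<Rightarrow> nat set" where
  "indices w = fst ` set w"

text \<open>Bounds the word operator without seeing the indices, hence bounds all relabelled copies
  of a word at once.\<close>

definition word_norm :: "(nat \<times> 'a::real_normed_vector) list \<Rightarrow> real" where
  "word_norm w = (\<Prod>p\<leftarrow>w. norm (snd p))"

lemma relabel_simps [simp]:
  "relabel f [] = []" "relabel f ((j, a) # w) = (f j, a) # relabel f w"
  "relabel f (u @ w) = relabel f u @ relabel f w"
  by (simp_all add: relabel_def)

lemma relabel_cong: "(\<And>j. j \<in> indices w \<Longrightarrow> f j = g j) \<Longrightarrow> relabel f w = relabel g w"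
  by (force simp: relabel_def indices_def)

lemma relabel_relabel: "relabel f (relabel g w) = relabel (f \<circ> g) w"
  by (simp add: relabel_def case_prod_unfold)

lemma relabel_id: "relabel id w = w"
  by (simp add: relabel_def case_prod_unfold)

lemma relabel_fixed: "(\<And>j. j \<in> indices w \<Longrightarrow> f j = j) \<Longrightarrow> relabel f w = w"
  using relabel_cong[of w f id] by (simp add: relabel_id)

lemma indices_simps [simp]:
  "indices [] = {}" "indices ((j, a) # w) = insert j (indices w)"
  "indices (u @ w) = indices u \<union> indices w" "indices (relabel f w) = f ` indices w"
  by (auto simp: indices_def relabel_def image_image case_prod_unfold)

lemma indices_word_star [simp]: "indices (word_star w) = indices w"
  by (force simp: indices_def word_star_def)

lemma finite_indices [simp]: "finite (indices w)"
  by (simp add: indices_def)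

lemma word_star_relabel: "word_star (relabel f w) = relabel f (word_star w)"
  by (simp add: word_star_def relabel_def rev_map case_prod_unfold)

lemma word_norm_relabel [simp]: "word_norm (relabel f w) = word_norm w"
  by (induction w) (auto simp: word_norm_def relabel_def)

lemma word_parity_relabel: "word_parity \<theta> q w \<Longrightarrow> word_parity \<theta> q (relabel f w)"
proof (induction rule: word_parity.induct)
  case (Cons p a q w j)
  show ?case using word_parity.Cons[OF Cons.hyps(1) Cons.IH, of "f j"] by simp
qed (simp add: word_parity.Nil)

lemma word_parity_append:
  assumes "word_parity \<theta> q w"
  shows "word_parity \<theta> p u \<Longrightarrow> word_parity \<theta> (p \<noteq> q) (u @ w)"
proof (induction rule: word_parity.induct)
  case Nil
  thus ?case using assms by simp
next
  case (Cons p a p' u j)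
  have "((p \<noteq> p') \<noteq> q) = (p \<noteq> (p' \<noteq> q))" by auto
  thus ?case using word_parity.Cons[OF Cons.hyps(1) Cons.IH] by simp
qed

lemma word_parity_single: "parity \<theta> q a \<Longrightarrow> word_parity \<theta> q [(j, a)]"
  using word_parity.Cons[OF _ word_parity.Nil, of \<theta> q a j] by simp

lemma word_op_append: "word_op \<iota> (u @ w) = word_op \<iota> u \<circ> word_op \<iota> w"
proof (induction u)
  case (Cons p u) thus ?case by (cases p) (simp add: o_assoc)
qed simp

locale graded =
  fixes \<theta> :: "'a::unital_cstar_algebra \<Rightarrow> 'a"
    and \<iota> :: "nat \<Rightarrow> 'a \<Rightarrow> 'h::chilbert_space \<Rightarrow> 'h"
    and \<xi> :: 'h
  assumes process: "graded_process \<theta> \<iota> \<xi>"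
begin

lemma
  shows theta_add: "\<theta> (a + b) = \<theta> a + \<theta> b"
    and theta_scale: "\<theta> (c *\<^sub>C a) = c *\<^sub>C \<theta> a"
    and theta_mult: "\<theta> (a * b) = \<theta> a * \<theta> b"
    and theta_star: "\<theta> (star a) = star (\<theta> a)"
    and theta_theta: "\<theta> (\<theta> a) = a"
    and rep: "unital_star_rep (\<iota> j)"
    and cyclic: "closure {T \<xi> | T. T \<in> vN_gen (\<Union>j. range (\<iota> j))} = UNIV"
  using process unfolding graded_process_def grading_def quantum_stochastic_process_def
  by (auto simp: fun_eq_iff)

lemma
  shows rep_bounded: "bounded_clinear (\<iota> j a)"
    and rep_add: "\<iota> j (a + b) v = \<iota> j a v + \<iota> j b v"
    and rep_mult: "\<iota> j (a * b) = \<iota> j a \<circ> \<iota> j b"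
    and rep_star: "adj (\<iota> j a) = \<iota> j (star a)"
  using rep[of j] unfolding unital_star_rep_def by auto

lemma star_minus: "star (- a) = - star (a :: 'a)"
  using star_scaleC[of "-1" a] by (simp add: scaleC_minus_one)

lemma theta_minus: "\<theta> (- a) = - \<theta> a"
  using theta_scale[of "-1" a] by (simp add: scaleC_minus_one)

lemma parity_mult: "parity \<theta> p a \<Longrightarrow> parity \<theta> q b \<Longrightarrow> parity \<theta> (p \<noteq> q) (a * b)"
  by (auto simp: parity_def theta_mult)

lemma parity_star: "parity \<theta> p a \<Longrightarrow> parity \<theta> p (star a)"
  by (auto simp: parity_def theta_star star_minus)

lemma parity_decomposition:
  obtains b c where "a = b + c" "parity \<theta> False b" "parity \<theta> True c"
proof
  have minus: "\<theta> (x - y) = \<theta> x - \<theta> y" for x y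
    using theta_add[of x "- y"] by (simp add: theta_minus)
  have half: "\<theta> ((1/2) *\<^sub>R x) = (1/2) *\<^sub>R \<theta> x" for x by (simp only: scaleR_scaleC theta_scale)
  show "a = (1/2) *\<^sub>R (a + \<theta> a) + (1/2) *\<^sub>R (a - \<theta> a)"
    by (simp add: scaleR_add_right[symmetric] del: scaleR_add_right)
  show "parity \<theta> False ((1/2) *\<^sub>R (a + \<theta> a))"
    unfolding parity_def half theta_add theta_theta by (simp add: add.commute)
  show "parity \<theta> True ((1/2) *\<^sub>R (a - \<theta> a))"
    unfolding parity_def half minus theta_theta by (simp add: scaleR_right_diff_distrib)
qed

lemma word_parity_star: "word_parity \<theta> q w \<Longrightarrow> word_parity \<theta> q (word_star w)"
proof (induction rule: word_parity.induct)
  case Nil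
  thus ?case by (simp add: word_star_def word_parity.Nil)
next
  case (Cons p a q w j)
  have "word_parity \<theta> (q \<noteq> p) (word_star w @ [(j, star a)])"
    by (rule word_parity_append[OF word_parity_single[OF parity_star[OF Cons.hyps(1)]] Cons.IH])
  thus ?case by (simp add: word_star_def neq_commute eq_commute)
qed

section \<open>Word operators and graded commutation\<close>

abbreviation W :: "(nat \<times> 'a) list \<Rightarrow> 'h \<Rightarrow> 'h" where
  "W \<equiv> word_op \<iota>"

lemma W_bounded: "bounded_clinear (W w)"
proof (induction w)
  case (Cons p w)
  thus ?case by (cases p) (simp only: word_op.simps bounded_clinear_comp rep_bounded)
qed (simp only: word_op.simps bounded_clinear_id)

lemma W_append: "W (u @ w) v = W u (W w v)"
  by (simp add: word_op_append)

lemma adj_W: "adj (W w) = W (word_star w)"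
proof (induction w)
  case Nil
  show ?case by (simp only: word_op.simps adj_id word_star_def list.map rev.simps)
next
  case (Cons p w)
  obtain j a where p: "p = (j, a)" by (cases p)
  have "adj (W (p # w)) = W (word_star w) \<circ> \<iota> j (star a)"
    unfolding p word_op.simps by (simp add: adj_comp rep_bounded W_bounded Cons.IH rep_star)
  also have "\<dots> = W (word_star (p # w))" by (simp add: p word_star_def word_op_append)
  finally show ?case .
qed

lemma cinner_W: "cinner (W w u) v = cinner u (W (word_star w) v)"
  by (simp add: cinner_adj[OF W_bounded] adj_W)

lemma W_norm: "norm (W w v) \<le> word_norm w * norm v"
proof (induction w)
  case (Cons p w)
  obtain j a where p: "p = (j, a)" by (cases p)
  have "norm (W (p # w) v) \<le> norm a * norm (W w v)"
    unfolding p using unital_star_rep_contraction[OF rep] by simp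
  also have "\<dots> \<le> norm a * (word_norm w * norm v)" by (intro mult_left_mono Cons.IH) simp
  finally show ?case by (simp add: p word_norm_def mult.assoc)
qed (simp add: word_norm_def)

lemma commute_letters:
  assumes "j \<noteq> k" "parity \<theta> p a" "parity \<theta> q b"
  shows "\<iota> j a (\<iota> k b v) = koszul p q *\<^sub>R \<iota> k b (\<iota> j a v)"
proof -
  have h: "homogeneous \<theta> a" "homogeneous \<theta> b"
    using assms by (auto simp: parity_def homogeneous_def even_elt_def odd_elt_def split: if_splits)
  have c: "(even_elt \<theta> a \<or> even_elt \<theta> b \<longrightarrow> (\<forall>v. \<iota> j a (\<iota> k b v) = \<iota> k b (\<iota> j a v))) \<and>
      (odd_elt \<theta> a \<and> odd_elt \<theta> b \<longrightarrow> (\<forall>v. \<iota> j a (\<iota> k b v) = - \<iota> k b (\<iota> j a v)))"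
    using process h assms(1) unfolding graded_process_def by blast
  show ?thesis
  proof (cases "p \<and> q")
    case True
    hence "odd_elt \<theta> a \<and> odd_elt \<theta> b" using assms by (simp add: parity_def odd_elt_def)
    thus ?thesis using c True by (simp add: koszul_def)
  next
    case False
    hence "even_elt \<theta> a \<or> even_elt \<theta> b" using assms by (auto simp: parity_def even_elt_def)
    hence "\<iota> j a (\<iota> k b v) = \<iota> k b (\<iota> j a v)" using conjunct1[OF c] by blast
    thus ?thesis using False by (auto simp: koszul_def)
  qed
qed

lemma koszul_mult: "koszul p q * koszul p q' = koszul p (q \<noteq> q')" "koszul q' p * koszul q p = koszul (q \<noteq> q') p"
  by (auto simp: koszul_def)

lemma koszul_False [simp]: "koszul False q = 1" "koszul p False = 1"
  by (simp_all add: koszul_def)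

lemma koszul_square: "koszul p q * koszul p q = 1"
  by (simp add: koszul_def)

lemma commute_letter_word:
  assumes a: "parity \<theta> p a" and w: "word_parity \<theta> q w"
  shows "j \<notin> indices w \<Longrightarrow> \<iota> j a (W w v) = koszul p q *\<^sub>R W w (\<iota> j a v)"
  using w
proof (induction rule: word_parity.induct)
  case (Cons r b q w k)
  hence "j \<noteq> k" "j \<notin> indices w" by auto
  thus ?case using Cons.IH commute_letters[OF _ a Cons.hyps(1)]
    by (simp add: clinear_scaleR[OF rep_bounded] koszul_mult)
qed simp

lemma commute_words:
  assumes u: "word_parity \<theta> p u" and w: "word_parity \<theta> q w"
  shows "indices u \<inter> indices w = {} \<Longrightarrow> W u (W w v) = koszul p q *\<^sub>R W w (W u v)"
  using u
proof (induction rule: word_parity.induct)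
  case (Cons r b p u k)
  hence k: "k \<notin> indices w" and IH: "W u (W w v) = koszul p q *\<^sub>R W w (W u v)" by auto
  show ?case using IH commute_letter_word[OF Cons.hyps(1) w k, of "W u v"]
    by (simp add: clinear_scaleR[OF rep_bounded] koszul_mult)
qed simp

text \<open>\<open>exchangeable\<close> speaks only of words with distinct neighbouring indices.
  Adjacent letters of equal index are multiplied together; merged letters share their index under
  every \<open>f\<close>, so one word serves all relabellings.\<close>

lemma word_merge:
  "\<exists>w'. successively (\<lambda>p q. fst p \<noteq> fst q) w' \<and> (\<forall>f. W (relabel f w') = W (relabel f w))"
proof (induction w)
  case Nil
  show ?case by (rule exI[of _ "[]"]) simp
next
  case (Cons p w)
  obtain j a where p: "p = (j, a)" by (cases p)
  obtain w' where s: "successively (\<lambda>p q. fst p \<noteq> fst q) w'" and w': "\<And>f. W (relabel f w') = W (relabel f w)"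
    using Cons.IH by blast
  show ?case
  proof (cases w')
    case Nil
    thus ?thesis using w' by (intro exI[of _ "[p]"]) (simp add: p flip: w')
  next
    case (Cons r v)
    obtain k b where r: "r = (k, b)" by (cases r)
    show ?thesis
    proof (cases "j = k")
      case True
      have "W (relabel f ((j, a * b) # v)) = W (relabel f (p # w))" for f
        using w'[of f] by (simp add: p Cons r True rep_mult o_assoc flip: w'[of f])
      moreover have "successively (\<lambda>p q. fst p \<noteq> fst q) ((j, a * b) # v)"
        using s by (cases v) (simp_all add: Cons r True)
      ultimately show ?thesis by blast
    next
      case False
      thus ?thesis using s w' by (intro exI[of _ "p # w'"]) (simp add: p Cons r flip: w')
    qed
  qed
qed

text \<open>Inside the union of \<open>F\<close> with its image, the points outside \<open>F\<close>
  and those outside the image are equally many, so any bijection between them completes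
  \<open>f\<close>.\<close>

lemma inj_extends_to_permutation:
  fixes f :: "nat \<Rightarrow> nat"
  assumes F: "finite F" and f: "inj_on f F"
  obtains \<sigma> where "bij \<sigma>" "finite {j. \<sigma> j \<noteq> j}" "\<And>j. j \<in> F \<Longrightarrow> \<sigma> j = f j"
proof -
  let ?U = "F \<union> f ` F"
  have fin: "finite ?U" using F by simp
  have "card (?U - F) = card (?U - f ` F)"
    using F card_image[OF f] by (simp add: card_Diff_subset)
  then obtain g where g: "bij_betw g (?U - F) (?U - f ` F)"
    using finite_same_card_bij[of "?U - F" "?U - f ` F"] fin by auto
  define \<sigma> where "\<sigma> j = (if j \<in> F then f j else if j \<in> ?U then g j else j)" for j
  have "bij_betw \<sigma> F (f ` F)" using f by (auto simp: bij_betw_def \<sigma>_def inj_on_def)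
  moreover have "bij_betw \<sigma> (?U - F) (?U - f ` F)"
    using g by (subst bij_betw_cong[of _ _ g]) (auto simp: \<sigma>_def)
  moreover have "bij_betw \<sigma> (- ?U) (- ?U)"
    using bij_betw_id by (subst bij_betw_cong[of _ _ id]) (auto simp: \<sigma>_def)
  ultimately have "bij_betw \<sigma> (F \<union> (?U - F) \<union> (- ?U)) (f ` F \<union> (?U - f ` F) \<union> (- ?U))"
    by (intro bij_betw_combine) auto
  moreover have "F \<union> (?U - F) \<union> (- ?U) = UNIV" "f ` F \<union> (?U - f ` F) \<union> (- ?U) = UNIV" by auto
  ultimately have "bij \<sigma>" by simp
  moreover have "finite {j. \<sigma> j \<noteq> j}"
    by (rule finite_subset[OF _ fin]) (auto simp: \<sigma>_def)
  ultimately show ?thesis by (rule that) (simp add: \<sigma>_def)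
qed

text \<open>A word has finitely many indices, so a map injective on them agrees there with a
  finitely supported permutation.\<close>

lemma exchangeable_inj:
  assumes "exchangeable \<iota> \<xi>" "inj_on f (indices w)"
  shows "cinner (W w \<xi>) \<xi> = cinner (W (relabel f w) \<xi>) \<xi>"
proof -
  obtain w' where s: "successively (\<lambda>p q. fst p \<noteq> fst q) w'" and w': "\<And>f. W (relabel f w') = W (relabel f w)"
    using word_merge by blast
  obtain \<sigma> where \<sigma>: "bij \<sigma>" "finite {j. \<sigma> j \<noteq> j}" "\<And>j. j \<in> indices w \<Longrightarrow> \<sigma> j = f j"
    using inj_extends_to_permutation[OF finite_indices assms(2)] by blast
  have "cinner (W w' \<xi>) \<xi> = cinner (W (relabel \<sigma> w') \<xi>) \<xi>"
    using assms(1) s \<sigma>(1,2) unfolding exchangeable_def relabel_def by blast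
  thus ?thesis using w'[of id] w'[of \<sigma>] relabel_cong[of w \<sigma> f] \<sigma>(3) by (simp add: relabel_id)
qed

lemma exchangeable_inj_inner:
  assumes "exchangeable \<iota> \<xi>" "inj_on f (indices u \<union> indices w)"
  shows "cinner (W u \<xi>) (W w \<xi>) = cinner (W (relabel f u) \<xi>) (W (relabel f w) \<xi>)"
proof -
  have "cinner (W u \<xi>) (W w \<xi>) = cinner (W (word_star w @ u) \<xi>) \<xi>" for u w
    by (simp add: W_append cinner_W word_star_def rev_map o_def case_prod_unfold star_star)
  thus ?thesis using exchangeable_inj[OF assms(1), of f "word_star w @ u"] assms(2)
    by (simp add: Un_commute word_star_relabel)
qed

text \<open>Restricted to homogeneous letters, so that graded commutation applies to every
  generator; by \<open>commutant_gens\<close> the commutant is the same as for all letters.\<close>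

definition gens :: "nat set \<Rightarrow> ('h \<Rightarrow> 'h) set" where
  "gens I = {\<iota> j a | j a. j \<in> I \<and> (\<exists>q. parity \<theta> q a)}"

lemma gensI: "j \<in> I \<Longrightarrow> parity \<theta> q a \<Longrightarrow> \<iota> j a \<in> gens I"
  unfolding gens_def by blast

lemma gens_mono: "I \<subseteq> J \<Longrightarrow> gens I \<subseteq> gens J"
  unfolding gens_def by blast

lemma gens_bounded: "s \<in> gens I \<Longrightarrow> bounded_clinear s"
  unfolding gens_def using rep_bounded by blast

lemma adj_closed_gens: "adj_closed (gens I)"
  unfolding adj_closed_def
proof (intro ballI conjI)
  fix s assume "s \<in> gens I"
  then obtain j a q where "s = \<iota> j a" "j \<in> I" "parity \<theta> q a" unfolding gens_def by blast
  thus "bounded_clinear s" "adj s \<in> gens I" using gensI[OF _ parity_star] by (auto simp: rep_bounded rep_star)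
qed

lemma adj_closed_range: "adj_closed (\<Union>j\<in>I. range (\<iota> j))"
  unfolding adj_closed_def by (auto simp: rep_bounded rep_star)

lemma commutant_gens: "commutant (\<Union>j\<in>I. range (\<iota> j)) = commutant (gens I)"
proof
  show "commutant (\<Union>j\<in>I. range (\<iota> j)) \<subseteq> commutant (gens I)"
    by (rule commutant_antimono) (auto simp: gens_def)
  show "commutant (gens I) \<subseteq> commutant (\<Union>j\<in>I. range (\<iota> j))"
  proof
    fix T assume T: "T \<in> commutant (gens I)"
    have bT: "bounded_clinear T" by (rule commutant_bounded[OF T])
    have "T (\<iota> j a v) = \<iota> j a (T v)" if "j \<in> I" for j a v
    proof -
      obtain b c where d: "a = b + c" "parity \<theta> False b" "parity \<theta> True c" by (rule parity_decomposition)
      have "T (\<iota> j b v) = \<iota> j b (T v)" "T (\<iota> j c v) = \<iota> j c (T v)"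
        using T gensI[OF that d(2)] gensI[OF that d(3)] by (simp_all add: commutant_iff)
      thus ?thesis by (simp add: d(1) rep_add clinear_add[OF bT])
    qed
    thus "T \<in> commutant (\<Union>j\<in>I. range (\<iota> j))" using bT by (auto simp: commutant_iff)
  qed
qed

abbreviation alg :: "nat set \<Rightarrow> ('h \<Rightarrow> 'h) set" where
  "alg I \<equiv> commutant (commutant (gens I))"

lemma vN_gen_range: "vN_gen (\<Union>j\<in>I. range (\<iota> j)) = alg I"
  by (simp add: vN_gen_eq[OF adj_closed_range] commutant_gens)

lemma gens_alg: "gens I \<subseteq> alg I"
  by (rule commutant_commutant_superset) (rule gens_bounded)

lemma rep_alg: "j \<in> I \<Longrightarrow> \<iota> j a \<in> alg I"
  unfolding commutant_gens[symmetric]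
  using commutant_commutant_superset[of "\<Union>j\<in>I. range (\<iota> j)"] rep_bounded by blast

lemma W_alg: "indices w \<subseteq> I \<Longrightarrow> W w \<in> alg I"
  by (induction w) (auto simp: commutant_id simp del: o_apply intro!: commutant_comp rep_alg)

lemma adj_closed_alg: "adj_closed (alg I)"
  by (intro adj_closed_commutant adj_closed_gens)

lemma alg_mono: "I \<subseteq> J \<Longrightarrow> alg I \<subseteq> alg J"
  by (intro bicommutant_mono gens_mono)

text \<open>Orthogonality passes to closed spans, so the plain set of word vectors can serve as the
  invariant set in \<open>bicommutant_density\<close>.\<close>

lemma alg_density:
  assumes T: "T \<in> alg I" and u: "\<And>w q. word_parity \<theta> q w \<Longrightarrow> indices w \<subseteq> I \<Longrightarrow> cinner (W w \<xi>) u = 0"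
  shows "cinner (T \<xi>) u = 0"
proof (rule bicommutant_density[OF adj_closed_gens _ T])
  let ?V = "{W w \<xi> | w q. word_parity \<theta> q w \<and> indices w \<subseteq> I}"
  show "s v \<in> ?V" if s: "s \<in> gens I" and v: "v \<in> ?V" for s v
  proof -
    obtain j a p where s: "s = \<iota> j a" "j \<in> I" "parity \<theta> p a" using s unfolding gens_def by blast
    obtain w q where w: "v = W w \<xi>" "word_parity \<theta> q w" "indices w \<subseteq> I" using v by blast
    have "s v = W ((j, a) # w) \<xi>" "indices ((j, a) # w) \<subseteq> I" using s w by simp_all
    thus ?thesis using word_parity.Cons[OF s(3) w(2)] by blast
  qed
  have "\<xi> = W [] \<xi>" "word_parity \<theta> False []" "indices [] \<subseteq> I" by (simp_all add: word_parity.Nil)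
  thus "\<xi> \<in> ?V" by blast
  show "cinner v u = 0" if "v \<in> ?V" for v using that u by blast
qed

text \<open>Cyclicity, transferred from the generated von Neumann algebra to homogeneous
  words.\<close>

lemma words_total:
  assumes u: "\<And>w q. word_parity \<theta> q w \<Longrightarrow> cinner (W w \<xi>) u = 0"
  shows "u = 0"
proof -
  let ?K = "{v. cinner v u = 0}"
  have "closed ?K" by (intro closed_Collect_eq cinner.continuous_on continuous_on_id continuous_on_const)
  moreover have "{T \<xi> | T. T \<in> vN_gen (\<Union>j. range (\<iota> j))} \<subseteq> ?K"
    using alg_density[of _ UNIV u] u by (auto simp: vN_gen_range)
  ultimately have "closure {T \<xi> | T. T \<in> vN_gen (\<Union>j. range (\<iota> j))} \<subseteq> ?K" by (rule closure_minimal[rotated])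
  hence "u \<in> ?K" unfolding cyclic by blast
  thus ?thesis by (simp add: cinner_eq_zero)
qed

text \<open>The adjoint of the difference takes values orthogonal to all word vectors, so
  \<open>words_total\<close> makes it vanish.\<close>

lemma eq_on_words:
  assumes S: "bounded_clinear S" and T: "bounded_clinear T"
    and eq: "\<And>w q. word_parity \<theta> q w \<Longrightarrow> S (W w \<xi>) = T (W w \<xi>)"
  shows "S = T"
proof
  fix v
  have "cinner u (S v - T v) = 0" for u
  proof -
    let ?D = "\<lambda>v. S v - T v"
    have D: "bounded_clinear ?D" by (intro bounded_clinear_diff S T)
    have "adj ?D u = 0"
    proof (rule words_total)
      fix w q assume "word_parity \<theta> q w"
      thus "cinner (W w \<xi>) (adj ?D u) = 0"
        by (simp add: cinner_adj[OF D, symmetric] eq cinner.zero_left)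
    qed
    thus ?thesis using cinner_adj[OF D, of v u] cinner_swap_zero[of u "S v - T v"] by (simp add: cinner.zero_right)
  qed
  hence "S v - T v = 0" using cinner_eq_zero by blast
  thus "S v = T v" by simp
qed

end

section \<open>Conditional independence implies exchangeability\<close>

context graded
begin

text \<open>The form that \<open>tail_algebra\<close> takes after \<open>tail_algebra_eq\<close> and
  \<open>commutant_gens\<close>.\<close>

definition tail :: "('h \<Rightarrow> 'h) set" where
  "tail = (\<Inter>n\<in>{1..}. alg {n..})"

lemma tail_subset_alg: "tail \<subseteq> alg {n..}"
proof -
  have "alg {Suc n..} \<subseteq> alg {n..}" by (rule alg_mono) auto
  thus ?thesis unfolding tail_def by force
qed

lemma tail_subset_alg_UNIV: "tail \<subseteq> alg UNIV"
  using tail_subset_alg[of 0] alg_mono[of "{0..}" UNIV] by blast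

lemma tail_bounded: "T \<in> tail \<Longrightarrow> bounded_clinear T"
  using tail_subset_alg commutant_bounded by blast

lemma tail_adj: "T \<in> tail \<Longrightarrow> adj T \<in> tail"
  using adj_closed_alg unfolding tail_def adj_closed_def by blast

lemma tail_id: "id \<in> tail"
  unfolding tail_def by (rule INT_I) (rule commutant_id)

lemma tail_comp: "S \<in> tail \<Longrightarrow> T \<in> tail \<Longrightarrow> S \<circ> T \<in> tail"
  unfolding tail_def by (intro INT_I commutant_comp) blast+

lemma tail_diff: "S \<in> tail \<Longrightarrow> T \<in> tail \<Longrightarrow> (\<lambda>v. S v - T v) \<in> tail"
  unfolding tail_def by (intro INT_I commutant_diff) (auto dest: commutant_bounded)

lemma vN_gen_join_tail:
  "vN_gen (vN_gen (\<Union>j\<in>I. range (\<iota> j)) \<union> tail) = commutant (commutant (gens I \<union> tail))"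
proof -
  have ac: "adj_closed (alg I \<union> tail)"
    using adj_closed_alg[of I] tail_adj tail_bounded unfolding adj_closed_def by blast
  have b: "bounded_clinear s" if "s \<in> gens I \<union> tail" for s
    using that gens_bounded tail_bounded by blast
  have sup: "gens I \<union> tail \<subseteq> commutant (commutant (gens I \<union> tail))"
    by (rule commutant_commutant_superset) (rule b)
  have "alg I \<subseteq> commutant (commutant (gens I \<union> tail))" by (rule bicommutant_mono) simp
  with sup have "alg I \<union> tail \<subseteq> commutant (commutant (gens I \<union> tail))" by simp
  hence 1: "commutant (commutant (alg I \<union> tail)) \<subseteq> commutant (commutant (gens I \<union> tail))"
    by (rule bicommutant_least)
  have 2: "commutant (commutant (gens I \<union> tail)) \<subseteq> commutant (commutant (alg I \<union> tail))"
    by (rule bicommutant_mono) (use gens_alg in blast)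
  show ?thesis unfolding vN_gen_range vN_gen_eq[OF ac] using 1 2 by simp
qed

lemma alg_subset_join_tail: "alg I \<subseteq> commutant (commutant (gens I \<union> tail))"
  by (rule bicommutant_mono) simp

text \<open>Homogeneity letter by letter survives cutting, joining and merging words, without
  computing the resulting parity.\<close>

lemma word_parity_iff: "(\<exists>q. word_parity \<theta> q w) \<longleftrightarrow> (\<forall>p\<in>set w. \<exists>q. parity \<theta> q (snd p))"
proof
  assume "\<exists>q. word_parity \<theta> q w"
  then obtain q where "word_parity \<theta> q w" by blast
  thus "\<forall>p\<in>set w. \<exists>q. parity \<theta> q (snd p)" by (induction rule: word_parity.induct) auto
next
  assume "\<forall>p\<in>set w. \<exists>q. parity \<theta> q (snd p)"
  thus "\<exists>q. word_parity \<theta> q w"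
  proof (induction w)
    case Nil
    show ?case using word_parity.Nil by blast
  next
    case (Cons p w)
    obtain j a where p: "p = (j, a)" by (cases p)
    obtain q r where "word_parity \<theta> q w" "parity \<theta> r a" using Cons p by auto
    thus ?case unfolding p using word_parity.Cons by blast
  qed
qed

text \<open>Graded commutation sorts a word by first occurrence of the indices; the sign depends only on
  the parities and on which indices coincide, so it is not changed by an injective relabelling.\<close>

lemma distinct_normal_form:
  assumes "word_parity \<theta> q w"
  shows "\<exists>s w' q'. word_parity \<theta> q' w' \<and> distinct (map fst w') \<and>
    (\<forall>f v. inj f \<longrightarrow> W (relabel f w) v = s *\<^sub>R W (relabel f w') v)"
  using assms
proof (induction rule: word_parity.induct)
  case Nil
  show ?case by (rule exI[of _ 1], rule exI[of _ "[]"], rule exI[of _ False]) (simp add: word_parity.Nil)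
next
  case (Cons p a q w j)
  then obtain s w' q' where w': "word_parity \<theta> q' w'" "distinct (map fst w')"
    and eq: "\<And>f v. inj f \<Longrightarrow> W (relabel f w) v = s *\<^sub>R W (relabel f w') v"
    by blast
  show ?case
  proof (cases "j \<in> indices w'")
    case False
    have "word_parity \<theta> (p \<noteq> q') ((j, a) # w')" by (rule word_parity.Cons[OF Cons.hyps(1) w'(1)])
    moreover have "distinct (map fst ((j, a) # w'))" using False w'(2) by (simp add: indices_def)
    moreover have "W (relabel f ((j, a) # w)) v = s *\<^sub>R W (relabel f ((j, a) # w')) v" if "inj f" for f v
      using eq[OF that] by (simp add: clinear_scaleR[OF rep_bounded])
    ultimately show ?thesis by blast
  next
    case True
    then obtain b where "(j, b) \<in> set w'" by (auto simp: indices_def)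
    then obtain u v where uv: "w' = u @ (j, b) # v" by (meson split_list)
    have hom: "\<forall>x\<in>set w'. \<exists>q. parity \<theta> q (snd x)" using w'(1) word_parity_iff by blast
    obtain r where r: "word_parity \<theta> r u" using hom uv word_parity_iff[of u] by auto
    obtain t where t: "parity \<theta> t b" using hom uv by auto
    have "\<forall>x\<in>set (u @ (j, a * b) # v). \<exists>q. parity \<theta> q (snd x)"
      using hom uv parity_mult[OF Cons.hyps(1) t] by auto
    then obtain q'' where "word_parity \<theta> q'' (u @ (j, a * b) # v)" using word_parity_iff by blast
    moreover have "distinct (map fst (u @ (j, a * b) # v))" using w'(2) by (simp add: uv)
    \<comment> \<open>The new letter is carried past \<open>u\<close>, which by distinctness does
      not contain \<open>j\<close>, and multiplied with the old letter of index
      \<open>j\<close>.\<close>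
    moreover have "W (relabel f ((j, a) # w)) x
        = (s * koszul p r) *\<^sub>R W (relabel f (u @ (j, a * b) # v)) x" if f: "inj f" for f x
    proof -
      have "j \<notin> indices u" using w'(2) by (auto simp: uv indices_def)
      hence "f j \<notin> indices (relabel f u)" using f by (auto simp: inj_def)
      from commute_letter_word[OF Cons.hyps(1) word_parity_relabel[OF r] this]
      show ?thesis
        using eq[OF f] by (simp add: uv W_append clinear_scaleR[OF rep_bounded] rep_mult)
    qed
    ultimately show ?thesis by blast
  qed
qed

text \<open>Both sides are additive in each letter. The induction splits one letter at a time into
  its even and odd part and moves it into the homogeneous prefix \<open>u\<close>.\<close>

lemma exchangeable_of_homogeneous:
  assumes hom: "\<And>w q \<sigma>. word_parity \<theta> q w \<Longrightarrow> bij \<sigma> \<Longrightarrow> cinner (W w \<xi>) \<xi> = cinner (W (relabel \<sigma> w) \<xi>) \<xi>"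
  shows "exchangeable \<iota> \<xi>"
proof -
  have gen: "cinner (W (u @ w) \<xi>) \<xi> = cinner (W (relabel \<sigma> (u @ w)) \<xi>) \<xi>"
    if \<sigma>: "bij \<sigma>" and "word_parity \<theta> q u" for u w q \<sigma>
    using that(2)
  proof (induction w arbitrary: u q)
    case Nil
    thus ?case using hom[OF _ \<sigma>] by simp
  next
    case (Cons p w)
    obtain j a where p: "p = (j, a)" by (cases p)
    obtain b c where d: "a = b + c" "parity \<theta> False b" "parity \<theta> True c" by (rule parity_decomposition)
    have spl: "cinner (W (x @ (k, a) # y) \<xi>) \<xi>
        = cinner (W ((x @ [(k, b)]) @ y) \<xi>) \<xi> + cinner (W ((x @ [(k, c)]) @ y) \<xi>) \<xi>" for x y k
      by (simp add: d(1) W_append rep_add clinear_add[OF W_bounded] cinner_add_left)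
    have "cinner (W ((u @ [(j, b)]) @ w) \<xi>) \<xi> = cinner (W (relabel \<sigma> ((u @ [(j, b)]) @ w)) \<xi>) \<xi>"
      "cinner (W ((u @ [(j, c)]) @ w) \<xi>) \<xi> = cinner (W (relabel \<sigma> ((u @ [(j, c)]) @ w)) \<xi>) \<xi>"
      by (rule Cons.IH, rule word_parity_append[OF word_parity_single[OF d(2)] Cons.prems])
        (rule Cons.IH, rule word_parity_append[OF word_parity_single[OF d(3)] Cons.prems])
    thus ?case
      using spl[of u j w] spl[of "relabel \<sigma> u" "\<sigma> j" "relabel \<sigma> w"] by (simp add: p)
  qed
  show ?thesis
    unfolding exchangeable_def relabel_def[symmetric]
  proof (intro allI impI)
    fix w :: "(nat \<times> 'a) list" and \<sigma> :: "nat \<Rightarrow> nat" assume "bij \<sigma>"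
    from gen[OF this word_parity.Nil, of w] show "cinner (W w \<xi>) \<xi> = cinner (W (relabel \<sigma> w) \<xi>) \<xi>"
      by (simp only: append_Nil)
  qed
qed

end

text \<open>Formulated on \<open>alg UNIV\<close>; the theorem supplies these properties by
  restriction from \<open>M\<close>, which contains it.\<close>

locale graded_expectation = graded \<theta> \<iota> \<xi>
  for \<theta> :: "'a::unital_cstar_algebra \<Rightarrow> 'a"
    and \<iota> :: "nat \<Rightarrow> 'a \<Rightarrow> 'h::chilbert_space \<Rightarrow> 'h"
    and \<xi> :: 'h +
  fixes E :: "('h \<Rightarrow> 'h) \<Rightarrow> 'h \<Rightarrow> 'h"
  assumes E_tail: "X \<in> alg UNIV \<Longrightarrow> E X \<in> tail"
    and E_fix: "T \<in> tail \<Longrightarrow> E T = T"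
    and E_module: "X \<in> alg UNIV \<Longrightarrow> S \<in> tail \<Longrightarrow> T \<in> tail \<Longrightarrow> E (S \<circ> X \<circ> T) = S \<circ> E X \<circ> T"
    and E_state: "X \<in> alg UNIV \<Longrightarrow> cinner (E X \<xi>) \<xi> = cinner (X \<xi>) \<xi>"
begin

lemma exchangeable_if:
  assumes ci: "conditionally_independent \<iota> tail E" and idd: "identically_distributed \<iota> E"
  shows "exchangeable \<iota> \<xi>"
proof -
  have ci': "E (X \<circ> Y) = E X \<circ> E Y"
    if "finite I" "finite J" "I \<inter> J = {}" "X \<in> alg I" "Y \<in> alg J" for I J X Y
    using ci[unfolded conditionally_independent_def vN_gen_join_tail, rule_format, of I J X Y] that
      subsetD[OF alg_subset_join_tail[of I]] subsetD[OF alg_subset_join_tail[of J]] by simp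
  \<comment> \<open>The right side contains the elements of the word but none of its indices; index
    0 is an arbitrary reference for the common expectation.\<close>
  have factor: "E (W w) = foldr (\<lambda>a T. E (\<iota> 0 a) \<circ> T) (map snd w) id" if "distinct (map fst w)" for w
    using that
  proof (induction w)
    case Nil
    show ?case using E_fix[OF tail_id] by (simp add: id_def)
  next
    case (Cons p w)
    obtain j a where p: "p = (j, a)" by (cases p)
    have "E (W (p # w)) = E (\<iota> j a) \<circ> E (W w)"
      unfolding p word_op.simps
      by (rule ci'[of "{j}" "indices w"])
        (use Cons.prems in \<open>auto simp: p indices_def intro: rep_alg W_alg\<close>)
    also have "E (\<iota> j a) = E (\<iota> 0 a)" using idd unfolding identically_distributed_def by blast
    finally show ?case using Cons by (simp add: p)
  qed
  show ?thesis
  proof (rule exchangeable_of_homogeneous)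
    fix w q \<sigma> assume w: "word_parity \<theta> q w" and \<sigma>: "bij (\<sigma> :: nat \<Rightarrow> nat)"
    obtain s w' where w': "distinct (map fst w')"
      and eq: "\<And>f v. inj f \<Longrightarrow> W (relabel f w) v = s *\<^sub>R W (relabel f w') v"
      using distinct_normal_form[OF w] by blast
    have fst: "map fst (relabel \<sigma> w') = map \<sigma> (map fst w')" and snd: "map snd (relabel \<sigma> w') = map snd w'"
      by (simp_all add: relabel_def case_prod_unfold)
    have "distinct (map fst (relabel \<sigma> w'))"
      unfolding fst using w' bij_is_inj[OF \<sigma>] by (simp add: distinct_map inj_on_def)
    hence "E (W w') = E (W (relabel \<sigma> w'))" using factor[OF w'] factor snd by metis
    hence "cinner (W w' \<xi>) \<xi> = cinner (W (relabel \<sigma> w') \<xi>) \<xi>" using E_state[OF W_alg] by (metis subset_UNIV)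
    thus "cinner (W w \<xi>) \<xi> = cinner (W (relabel \<sigma> w) \<xi>) \<xi>"
      using eq[of id] eq[OF bij_is_inj[OF \<sigma>]] by (simp add: relabel_id cinner.scaleR_left)
  qed
qed

end

section \<open>The parity operator and centrality of the tail algebra\<close>

text \<open>Applied to commutators with the copies of a word, which vanish once the copies lie far
  enough out.\<close>

lemma cesaro_null:
  fixes d :: "nat \<Rightarrow> 'a::real_normed_vector"
  assumes d: "\<And>m. m \<ge> m0 \<Longrightarrow> d m = 0"
  shows "(\<lambda>N. (1 / real N) *\<^sub>R (\<Sum>m<N. d m)) \<longlonglongrightarrow> 0"
proof -
  let ?D = "\<Sum>m<m0. d m"
  have sum: "(\<Sum>m<N. d m) = ?D" if "N \<ge> m0" for N
    by (rule sum.mono_neutral_right) (use that d in auto)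
  have "(\<lambda>N. (1 / real N) *\<^sub>R ?D) \<longlonglongrightarrow> 0 *\<^sub>R ?D"
    by (intro tendsto_scaleR lim_1_over_n tendsto_const)
  hence lim: "(\<lambda>N. (1 / real N) *\<^sub>R ?D) \<longlonglongrightarrow> 0" by simp
  have "\<forall>\<^sub>F N in sequentially. (1 / real N) *\<^sub>R ?D = (1 / real N) *\<^sub>R (\<Sum>m<N. d m)"
    unfolding eventually_sequentially
  proof (intro exI[of _ m0] allI impI)
    fix N assume "m0 \<le> N"
    from sum[OF this] show "(1 / real N) *\<^sub>R ?D = (1 / real N) *\<^sub>R (\<Sum>m<N. d m)" by simp
  qed
  thus ?thesis by (rule Lim_transform_eventually[OF lim])
qed

text \<open>For \<open>0 < N \<le> M\<close> the Gram matrix gives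
  \<open>cinner (A N) (A M) = c + (d - c) / M\<close>. Hence the squared distance is
  \<open>Re (d - c) * (1 / N - 1 / M)\<close>, and the squared norms tend to
  \<open>Re c\<close>.\<close>

lemma averages_constant_gram:
  fixes x :: "nat \<Rightarrow> 'h::chilbert_space"
  assumes off: "\<And>m n. m \<noteq> n \<Longrightarrow> cinner (x m) (x n) = c" and diag: "\<And>m. cinner (x m) (x m) = d"
  obtains \<eta> where "(\<lambda>N. (1 / real N) *\<^sub>R (\<Sum>m<N. x m)) \<longlonglongrightarrow> \<eta>" "(norm \<eta>)\<^sup>2 = Re c"
proof -
  define A where "A N = (1 / real N) *\<^sub>R (\<Sum>m<N. x m)" for N
  have gram: "cinner (A N) (A M) = c + (d - c) / of_nat M" if "0 < N" "N \<le> M" for N M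
  proof -
    have "cinner (x m) (x n) = c + (if m = n then d - c else 0)" for m n using off diag by simp
    hence "(\<Sum>m<N. \<Sum>n<M. cinner (x m) (x n)) = (\<Sum>m<N. \<Sum>n<M. c + (if m = n then d - c else 0))" by simp
    \<comment> \<open>As \<open>N \<le> M\<close>, every row \<open>m < N\<close> meets the diagonal
      exactly once.\<close>
    also have "\<dots> = (\<Sum>m<N. of_nat M * c + (d - c))"
      by (rule sum.cong) (use that in \<open>auto simp: sum.distrib\<close>)
    also have "\<dots> = of_nat N * (of_nat M * c + (d - c))" by simp
    finally have "cinner (\<Sum>m<N. x m) (\<Sum>n<M. x n) = of_nat N * (of_nat M * c + (d - c))"
      unfolding cinner.sum_left unfolding cinner.sum_right .
    hence "cinner (A N) (A M) = (1 / real N) *\<^sub>R (1 / real M) *\<^sub>R (of_nat N * (of_nat M * c + (d - c)))"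
      unfolding A_def cinner.scaleR_left cinner.scaleR_right by simp
    also have "\<dots> = c + (d - c) / of_nat M"
      using that by (simp add: scaleR_conv_of_real field_simps)
    finally show ?thesis .
  qed
  have nsq: "(norm (A N))\<^sup>2 = Re c + Re (d - c) / real N" if "N > 0" for N
    using gram[OF that order_refl] unfolding norm_sq_cinner by (simp add: Re_divide_of_nat)
  have diff: "(norm (A N - A M))\<^sup>2 \<le> \<bar>Re (d - c)\<bar> / real N" if "0 < N" "N \<le> M" for N M
  proof -
    have "(norm (A N - A M))\<^sup>2 = Re (d - c) / real N - Re (d - c) / real M"
      unfolding norm_diff_sq gram[OF that] using nsq[OF that(1)] nsq[of M] that by (simp add: Re_divide_of_nat)
    also have "\<dots> = Re (d - c) * (1 / real N - 1 / real M)" by (simp add: field_simps)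
    also have "\<dots> \<le> \<bar>Re (d - c)\<bar> * (1 / real N)"
      using that by (intro mult_mono) (auto simp: field_simps)
    finally show ?thesis by simp
  qed
  have "Cauchy A"
  proof (rule CauchyI')
    fix e :: real assume e: "0 < e"
    obtain N where N: "\<bar>Re (d - c)\<bar> / e\<^sup>2 < real N" using reals_Archimedean2 by blast
    have "norm (A m - A n) < e" if "m \<ge> Suc N" "n > m" for m n
    proof -
      have "(norm (A m - A n))\<^sup>2 \<le> \<bar>Re (d - c)\<bar> / real m" by (rule diff) (use that in auto)
      also have "\<dots> < e\<^sup>2"
      proof -
        have "\<bar>Re (d - c)\<bar> < real N * e\<^sup>2" using N e by (simp add: divide_less_eq)
        also have "\<dots> \<le> real m * e\<^sup>2" using that by (intro mult_right_mono) auto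
        finally show ?thesis using that by (simp add: divide_less_eq mult.commute)
      qed
      finally show ?thesis using e by (simp add: power2_less_imp_less)
    qed
    thus "\<exists>M. \<forall>m\<ge>M. \<forall>n>m. dist (A m) (A n) < e" unfolding dist_norm by blast
  qed
  then obtain \<eta> where \<eta>: "A \<longlonglongrightarrow> \<eta>" using Cauchy_convergent convergent_def by blast
  have "(\<lambda>N. (norm (A N))\<^sup>2) \<longlonglongrightarrow> (norm \<eta>)\<^sup>2" by (intro tendsto_intros \<eta>)
  moreover have "(\<lambda>N. (norm (A N))\<^sup>2) \<longlonglongrightarrow> Re c"
  proof -
    have "(\<lambda>N. Re c + Re (d - c) * (1 / real N)) \<longlonglongrightarrow> Re c + Re (d - c) * 0"
      by (intro tendsto_intros lim_1_over_n)
    moreover have "\<forall>\<^sub>F N in sequentially. Re c + Re (d - c) * (1 / real N) = (norm (A N))\<^sup>2"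
      using eventually_gt_at_top[of 0] by eventually_elim (simp add: nsq)
    ultimately show ?thesis by (simp add: tendsto_cong)
  qed
  ultimately have "(norm \<eta>)\<^sup>2 = Re c" by (rule LIMSEQ_unique)
  moreover have "(\<lambda>N. (1 / real N) *\<^sub>R (\<Sum>m<N. x m)) \<longlonglongrightarrow> \<eta>" using \<eta> unfolding A_def .
  ultimately show ?thesis by (intro that)
qed

lemma proj_selfadjoint:
  assumes K: "closed_csubspace K"
  shows "cinner (proj K x) y = cinner x (proj K y)"
proof -
  have "cinner (proj K x) (y - proj K y) = 0"
    using proj_orth[OF K proj_in[OF K], of y x] cinner_swap_zero by blast
  moreover have "cinner (x - proj K x) (proj K y) = 0" by (rule proj_orth[OF K proj_in[OF K]])
  ultimately show ?thesis by (simp add: cinner.diff_left cinner.diff_right)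
qed

lemma bounded_clinear_scaleR: "bounded_clinear T \<Longrightarrow> bounded_clinear (\<lambda>v. r *\<^sub>R T v)"
  by (simp add: scaleR_scaleC bounded_clinear_scaleC)

text \<open>For a word with indices below \<open>L\<close>, copy \<open>m\<close> occupies the block
  \<open>{m * L..<Suc m * L}\<close>, so distinct copies share no index.\<close>

definition copy :: "nat \<Rightarrow> nat \<Rightarrow> (nat \<times> 'a) list \<Rightarrow> (nat \<times> 'a) list" where
  "copy L m w = relabel (\<lambda>j. j + m * L) w"

lemma copy_indices: "indices w \<subseteq> {..<L} \<Longrightarrow> indices (copy L m w) \<subseteq> {m * L..<Suc m * L}"
  by (auto simp: copy_def)

lemma copy_disjoint:
  assumes "indices w \<subseteq> {..<L}" "indices u \<subseteq> {..<L}" "m \<noteq> n"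
  shows "indices (copy L m w) \<inter> indices (copy L n u) = {}"
proof -
  have "i div L = m" if "i \<in> {m * L..<Suc m * L}" for i m
    using that by (intro div_nat_eqI) (auto simp: mult.commute)
  thus ?thesis using copy_indices[OF assms(1), of m] copy_indices[OF assms(2), of n] assms(3) by blast
qed

section \<open>Averages over disjoint copies of a word\<close>

context graded
begin

definition average :: "nat \<Rightarrow> (nat \<times> 'a) list \<Rightarrow> nat \<Rightarrow> 'h \<Rightarrow> 'h" where
  "average L w N v = (1 / real N) *\<^sub>R (\<Sum>m<N. W (copy L m w) v)"

lemma average_norm: "norm (average L w N v) \<le> word_norm w * norm v"
proof (cases "N = 0")
  case True
  have "0 \<le> word_norm w * norm v" by (rule order_trans[OF norm_ge_zero W_norm])
  thus ?thesis by (simp add: average_def True)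
next
  case False
  have "norm (\<Sum>m<N. W (copy L m w) v) \<le> (\<Sum>m<N. word_norm w * norm v)"
    by (rule sum_norm_le) (use W_norm[of "copy L _ w" v] in \<open>simp add: copy_def\<close>)
  thus ?thesis using False by (simp add: average_def field_simps)
qed

lemma average_bounded: "bounded_clinear (average L w N)"
proof (rule bounded_clinearI)
  show "average L w N (x + y) = average L w N x + average L w N y" for x y
    by (simp add: average_def clinear_add[OF W_bounded] sum.distrib scaleR_add_right)
  show "average L w N (c *\<^sub>C x) = c *\<^sub>C average L w N x" for c x
  proof -
    have s: "(\<Sum>m<N. c *\<^sub>C f m) = c *\<^sub>C (\<Sum>m<N. f m)" for f :: "nat \<Rightarrow> 'h"
      using bounded_linear.linear[OF bounded_linear_scaleC[of c, where 'a='h]] by (simp add: linear_sum)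
    show ?thesis by (simp add: average_def clinear_scaleC[OF W_bounded] s scaleR_scaleC_commute)
  qed
  show "norm (average L w N x) \<le> word_norm w * norm x" for x by (rule average_norm)
qed

text \<open>Positivity of \<open>L\<close> makes the copies leave every initial segment of indices,
  as \<open>mean_in_tail\<close> requires.\<close>

lemma bound_indices:
  assumes "finite I"
  obtains L :: nat where "0 < L" "I \<subseteq> {..<L}"
proof -
  obtain k where "I \<subseteq> {..<k}" using finite_nat_bounded[OF assms] by blast
  hence "I \<subseteq> {..<Suc k}" by auto
  thus ?thesis using that[of "Suc k"] by simp
qed

end

locale graded_exchangeable = graded \<theta> \<iota> \<xi>
  for \<theta> :: "'a::unital_cstar_algebra \<Rightarrow> 'a"
    and \<iota> :: "nat \<Rightarrow> 'a \<Rightarrow> 'h::chilbert_space \<Rightarrow> 'h"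
    and \<xi> :: 'h +
  assumes exch: "exchangeable \<iota> \<xi>"
begin

lemma copies_gram:
  assumes w: "indices w \<subseteq> {..<L}" and u: "indices u \<subseteq> {..<L}"
  shows "m \<noteq> n \<Longrightarrow> cinner (W (copy L m w) \<xi>) (W (copy L n u) \<xi>) = cinner (W (copy L 0 w) \<xi>) (W (copy L 1 u) \<xi>)"
    and "cinner (W (copy L m w) \<xi>) (W (copy L m u) \<xi>) = cinner (W (copy L 0 w) \<xi>) (W (copy L 0 u) \<xi>)"
proof -
  assume mn: "m \<noteq> n"
  \<comment> \<open>Sends block 0 to block \<open>m\<close> and block 1 to block \<open>n\<close>;
    both words involved have their indices below \<open>2 * L\<close>, where \<open>f\<close> is
    injective.\<close>
  define f where "f j = (if j < L then j + m * L else j - L + n * L)" for j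
  have f: "f j = j mod L + (if j < L then m else n) * L" if "j < 2 * L" for j
    using that by (auto simp: f_def le_mod_geq)
  have j: "j = j mod L + (if j < L then 0 else L)" if "j < 2 * L" for j
    using that by (auto simp: le_mod_geq)
  have ind: "indices (copy L 0 w) \<union> indices (copy L 1 u) \<subseteq> {..<2 * L}"
    using copy_indices[OF w, of 0] copy_indices[OF u, of 1] by fastforce
  have "inj_on f {..<2 * L}"
  proof (rule inj_onI)
    fix i j assume ij: "i \<in> {..<2 * L}" "j \<in> {..<2 * L}" and eq: "f i = f j"
    have L: "0 < L" using ij by auto
    have "f i div L = f j div L" "f i mod L = f j mod L" using eq by simp_all
    hence "(if i < L then m else n) = (if j < L then m else n)" "i mod L = j mod L"
      using f[of i] f[of j] ij L by simp_all
    thus "i = j" using mn j[of i] j[of j] ij by (auto split: if_splits)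
  qed
  hence "inj_on f (indices (copy L 0 w) \<union> indices (copy L 1 u))" using ind inj_on_subset by blast
  from exchangeable_inj_inner[OF exch this]
  have "cinner (W (copy L 0 w) \<xi>) (W (copy L 1 u) \<xi>)
    = cinner (W (relabel f (copy L 0 w)) \<xi>) (W (relabel f (copy L 1 u)) \<xi>)" .
  moreover have "relabel f (copy L 0 w) = copy L m w" "relabel f (copy L 1 u) = copy L n u"
    unfolding copy_def relabel_relabel
    by (rule relabel_cong; use w u in \<open>auto simp: f_def\<close>)+
  ultimately show "cinner (W (copy L m w) \<xi>) (W (copy L n u) \<xi>) = cinner (W (copy L 0 w) \<xi>) (W (copy L 1 u) \<xi>)"
    by simp
next
  have "inj_on (\<lambda>j. j + m * L) (indices (copy L 0 w) \<union> indices (copy L 0 u))" by (simp add: inj_on_def)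
  from exchangeable_inj_inner[OF exch this]
  show "cinner (W (copy L m w) \<xi>) (W (copy L m u) \<xi>) = cinner (W (copy L 0 w) \<xi>) (W (copy L 0 u) \<xi>)"
    by (simp add: copy_def relabel_relabel o_def)
qed

lemma average_xi:
  assumes w: "indices w \<subseteq> {..<L}"
  obtains \<eta> where "(\<lambda>N. average L w N \<xi>) \<longlonglongrightarrow> \<eta>"
    "(norm \<eta>)\<^sup>2 = Re (cinner (W (copy L 0 w) \<xi>) (W (copy L 1 w) \<xi>))"
proof (rule averages_constant_gram[of "\<lambda>m. W (copy L m w) \<xi>"])
  show "cinner (W (copy L m w) \<xi>) (W (copy L n w) \<xi>) = cinner (W (copy L 0 w) \<xi>) (W (copy L 1 w) \<xi>)"
    if "m \<noteq> n" for m n using copies_gram(1)[OF w w that] .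
  show "cinner (W (copy L m w) \<xi>) (W (copy L m w) \<xi>) = cinner (W (copy L 0 w) \<xi>) (W (copy L 0 w) \<xi>)" for m
    by (rule copies_gram(2)[OF w w])
qed (use that in \<open>simp add: average_def\<close>)

text \<open>Disjoint copies \<open>y\<^sub>0\<close>, \<open>y\<^sub>1\<close> of an odd word anticommute, so the correlations
  \<open>\<langle>y\<^sub>0\<xi>, y\<^sub>1\<xi>\<rangle>\<close> and \<open>\<langle>y\<^sub>0\<^sup>*\<xi>, y\<^sub>1\<^sup>*\<xi>\<rangle>\<close> have opposite real parts; both are squared norms of limits
  of averages, hence zero.\<close>

lemma average_odd:
  assumes w: "indices w \<subseteq> {..<L}" and odd: "word_parity \<theta> True w"
  shows "(\<lambda>N. average L w N \<xi>) \<longlonglongrightarrow> 0"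
proof -
  let ?s = "word_star w"
  obtain \<eta> where \<eta>: "(\<lambda>N. average L w N \<xi>) \<longlonglongrightarrow> \<eta>"
    "(norm \<eta>)\<^sup>2 = Re (cinner (W (copy L 0 w) \<xi>) (W (copy L 1 w) \<xi>))"
    by (rule average_xi[OF w])
  have s: "indices ?s \<subseteq> {..<L}" using w by simp
  obtain \<eta>' where "(\<lambda>N. average L ?s N \<xi>) \<longlonglongrightarrow> \<eta>'" and \<eta>': "(norm \<eta>')\<^sup>2 = Re (cinner (W (copy L 0 ?s) \<xi>) (W (copy L 1 ?s) \<xi>))"
    by (rule average_xi[OF s])
  have star: "word_star (copy L m w) = copy L m ?s" "word_star (copy L m ?s) = copy L m w" for m
    by (simp_all add: copy_def word_star_relabel)
       (simp add: word_star_def rev_map case_prod_unfold o_def star_star relabel_def)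
  have "cinner (W (copy L 0 ?s) \<xi>) (W (copy L 1 ?s) \<xi>) = cinner (W (copy L 1 w) (W (copy L 0 ?s) \<xi>)) \<xi>"
    by (simp add: cinner_W star)
  also have "W (copy L 1 w) (W (copy L 0 ?s) \<xi>) = koszul True True *\<^sub>R W (copy L 0 ?s) (W (copy L 1 w) \<xi>)"
    unfolding copy_def
    by (intro commute_words word_parity_relabel odd word_parity_star copy_disjoint[unfolded copy_def] w s) simp
  also have "cinner \<dots> \<xi> = - cinner (W (copy L 1 w) \<xi>) (W (copy L 0 w) \<xi>)"
    by (simp add: koszul_def cinner.minus_left cinner_W star)
  finally have "Re (cinner (W (copy L 0 ?s) \<xi>) (W (copy L 1 ?s) \<xi>))
      = - Re (cinner (W (copy L 0 w) \<xi>) (W (copy L 1 w) \<xi>))"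
    using cinner_commute[of "W (copy L 1 w) \<xi>" "W (copy L 0 w) \<xi>"] by simp
  hence "(norm \<eta>')\<^sup>2 = - (norm \<eta>)\<^sup>2" using \<eta>' \<eta>(2) by simp
  hence "(norm \<eta>)\<^sup>2 \<le> 0" using zero_le_power2[of "norm \<eta>'"] by linarith
  thus ?thesis using \<eta>(1) by simp
qed

text \<open>All copies of a word have the same expectation, so it equals the expectation of the
  averages, and these tend to 0 at \<open>\<xi>\<close>.\<close>

lemma odd_state:
  assumes "word_parity \<theta> True w"
  shows "cinner (W w \<xi>) \<xi> = 0"
proof -
  obtain L where L: "indices w \<subseteq> {..<L}" using bound_indices[OF finite_indices] by blast
  have lim: "(\<lambda>N. cinner (average L w N \<xi>) \<xi>) \<longlonglongrightarrow> cinner 0 \<xi>"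
    by (rule cinner.tendsto[OF average_odd[OF L assms] tendsto_const])
  have c: "cinner (average L w N \<xi>) \<xi> = cinner (W w \<xi>) \<xi>" if "N > 0" for N
  proof -
    have "cinner (W (copy L m w) \<xi>) \<xi> = cinner (W w \<xi>) \<xi>" for m
      unfolding copy_def by (rule exchangeable_inj[OF exch, symmetric]) (simp add: inj_on_def)
    thus ?thesis using that
      by (simp add: average_def cinner.scaleR_left cinner.sum_left scaleR_conv_of_real)
  qed
  have "\<forall>\<^sub>F N in sequentially. cinner (average L w N \<xi>) \<xi> = cinner (W w \<xi>) \<xi>"
    by (rule eventually_mono[OF eventually_gt_at_top[of "0::nat"]]) (rule c)
  hence "(\<lambda>N. cinner (W w \<xi>) \<xi>) \<longlonglongrightarrow> cinner 0 \<xi>" by (rule Lim_transform_eventually[OF lim])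
  thus ?thesis by (simp add: LIMSEQ_const_iff cinner.zero_left)
qed

text \<open>The reflection in the orthogonal complement of the odd word vectors. Through the
  projection it is defined at once on the whole space; that it fixes even word vectors follows from
  \<open>odd_state\<close>.\<close>

definition parity_op :: "'h \<Rightarrow> 'h" where
  "parity_op v = 2 *\<^sub>R proj (orth {W w \<xi> | w. word_parity \<theta> True w}) v - v"

lemma parity_op_bounded: "bounded_clinear parity_op"
  unfolding parity_op_def
  by (intro bounded_clinear_diff bounded_clinear_scaleR bounded_clinear_proj closed_csubspace_orth
      bounded_clinear_id)

lemma parity_op_selfadjoint: "cinner (parity_op x) y = cinner x (parity_op y)"
  by (simp add: parity_op_def cinner.diff_left cinner.diff_right cinner.scaleR_left cinner.scaleR_right
      proj_selfadjoint[OF closed_csubspace_orth])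

lemma parity_op_word:
  assumes "word_parity \<theta> q w"
  shows "parity_op (W w \<xi>) = koszul True q *\<^sub>R W w \<xi>"
proof (cases q)
  case True
  have "proj (orth {W w \<xi> | w. word_parity \<theta> True w}) (W w \<xi>) = 0"
    by (rule proj_eqI[OF closed_csubspace_orth csubspace_zero[OF closed_csubspace_orth]])
      (use assms True in \<open>auto simp: orth_def\<close>)
  thus ?thesis by (simp add: parity_op_def koszul_def True)
next
  case False
  have "cinner (W u \<xi>) (W w \<xi>) = 0" if "word_parity \<theta> True u" for u
  proof -
    have "word_parity \<theta> (False \<noteq> True) (word_star w @ u)"
      by (rule word_parity_append[OF that word_parity_star]) (use assms False in simp)
    hence "cinner (W (word_star w @ u) \<xi>) \<xi> = 0" by (intro odd_state) simp
    hence "cinner (W (word_star w) (W u \<xi>)) \<xi> = 0" by (simp add: W_append)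
    thus ?thesis by (simp add: cinner_adj'[OF W_bounded, symmetric] adj_W[symmetric])
  qed
  hence "W w \<xi> \<in> orth {W w \<xi> | w. word_parity \<theta> True w}" by (auto simp: orth_def)
  hence "proj (orth {W w \<xi> | w. word_parity \<theta> True w}) (W w \<xi>) = W w \<xi>"
    by (intro proj_eqI[OF closed_csubspace_orth]) (simp_all add: cinner.zero_left)
  thus ?thesis by (simp add: parity_op_def koszul_def False scaleR_2)
qed

lemma parity_op_involution: "parity_op (parity_op v) = v"
proof -
  have "parity_op \<circ> parity_op = id"
    by (rule eq_on_words[OF bounded_clinear_comp[OF parity_op_bounded parity_op_bounded] bounded_clinear_id(1)])
      (simp add: parity_op_word clinear_scaleR[OF parity_op_bounded] koszul_square)
  thus ?thesis by (simp add: fun_eq_iff)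
qed

lemma parity_op_rep:
  assumes a: "parity \<theta> p a"
  shows "parity_op (\<iota> k a v) = koszul True p *\<^sub>R \<iota> k a (parity_op v)"
proof -
  have "parity_op \<circ> \<iota> k a = (\<lambda>v. koszul True p *\<^sub>R \<iota> k a (parity_op v))"
  proof (rule eq_on_words)
    show "bounded_clinear (parity_op \<circ> \<iota> k a)" by (intro bounded_clinear_comp parity_op_bounded rep_bounded)
    show "bounded_clinear (\<lambda>v. koszul True p *\<^sub>R \<iota> k a (parity_op v))"
      using bounded_clinear_scaleR[OF bounded_clinear_comp[OF rep_bounded parity_op_bounded]] by (simp add: o_def)
    fix w q assume w: "word_parity \<theta> q w"
    show "(parity_op \<circ> \<iota> k a) (W w \<xi>) = koszul True p *\<^sub>R \<iota> k a (parity_op (W w \<xi>))"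
      using parity_op_word[OF word_parity.Cons[OF a w, of k]] parity_op_word[OF w]
      by (simp add: clinear_scaleR[OF rep_bounded] koszul_mult)
  qed
  thus ?thesis by (simp add: fun_eq_iff)
qed

text \<open>Conjugation by \<open>parity_op\<close> maps each homogeneous generator to plus or minus
  itself, hence preserves the commutant and then the bicommutant.\<close>

lemma parity_op_alg:
  assumes T: "T \<in> alg I"
  shows "parity_op \<circ> T \<circ> parity_op \<in> alg I"
proof -
  have b: "bounded_clinear (parity_op \<circ> X \<circ> parity_op)" if "bounded_clinear X" for X
    by (intro bounded_clinear_comp parity_op_bounded that)
  have comm: "parity_op \<circ> S \<circ> parity_op \<in> commutant (gens I)" if S: "S \<in> commutant (gens I)" for S
  proof -
    have bS: "bounded_clinear S" by (rule commutant_bounded[OF S])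
    have "(parity_op \<circ> S \<circ> parity_op) (s v) = s ((parity_op \<circ> S \<circ> parity_op) v)" if s: "s \<in> gens I" for s v
    proof -
      obtain k a p where a: "s = \<iota> k a" "parity \<theta> p a" using s unfolding gens_def by blast
      have "S (s u) = s (S u)" for u using S s by (simp add: commutant_iff)
      thus ?thesis
        by (simp add: a(1) parity_op_rep[OF a(2)] clinear_scaleR[OF bS] clinear_scaleR[OF parity_op_bounded] koszul_square)
    qed
    thus ?thesis using b[OF bS] by (simp add: commutant_iff)
  qed
  have "(parity_op \<circ> T \<circ> parity_op) (S v) = S ((parity_op \<circ> T \<circ> parity_op) v)" if S: "S \<in> commutant (gens I)" for S v
  proof -
    have "T ((parity_op \<circ> S \<circ> parity_op) (parity_op v)) = (parity_op \<circ> S \<circ> parity_op) (T (parity_op v))"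
      using T comm[OF S] unfolding commutant_iff[of T] by blast
    thus ?thesis by (simp add: parity_op_involution)
  qed
  thus ?thesis using b[OF commutant_bounded[OF T]] by (simp add: commutant_iff)
qed

text \<open>An odd generator composed with the parity operator commutes with all generators of other
  indices, hence with \<open>T\<close>. So the odd part \<open>D\<close> of \<open>T\<close> anticommutes with every odd element, in
  particular with \<open>D\<^sup>*\<close>, and \<open>D D\<^sup>* = - D\<^sup>* D\<close> forces \<open>D = 0\<close>.\<close>

lemma tail_central:
  assumes T: "T \<in> tail"
  shows "T \<in> commutant (gens UNIV)"
proof -
  define T' where "T' = parity_op \<circ> T \<circ> parity_op"
  have T': "T' \<in> tail" using T parity_op_alg unfolding T'_def tail_def by blast
  have bT: "bounded_clinear T" "bounded_clinear T'" using T T' tail_bounded by blast+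
  have even: "S (\<iota> k a v) = \<iota> k a (S v)" if "S \<in> tail" "parity \<theta> False a" for S k a v
  proof -
    have "\<iota> k a \<in> commutant (gens {Suc k..})"
      unfolding commutant_iff gens_def using commute_letters[OF _ that(2)] rep_bounded by auto
    thus ?thesis using that(1) tail_subset_alg[of "Suc k"] unfolding commutant_iff[of S] by (auto simp: commutant_iff)
  qed
  have odd: "S (\<iota> k a v) = \<iota> k a (parity_op (S (parity_op v)))" if S: "S \<in> tail" and a: "parity \<theta> True a" for S k a v
  proof -
    \<comment> \<open>The sign from moving \<open>parity_op\<close> past a distant odd letter
      cancels the sign from moving \<open>\<iota> k a\<close> past it.\<close>
    have "parity_op \<circ> \<iota> k a \<in> commutant (gens {Suc k..})"
      unfolding commutant_iff gens_def
      using commute_letters[OF _ a] parity_op_rep bounded_clinear_comp[OF parity_op_bounded rep_bounded]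
      by (auto simp: clinear_scaleR[OF parity_op_bounded] koszul_square)
    moreover have "S \<in> alg {Suc k..}" using S tail_subset_alg by blast
    ultimately have "S (parity_op (\<iota> k a (parity_op v))) = parity_op (\<iota> k a (S (parity_op v)))"
      unfolding commutant_iff[of S] by (metis o_apply)
    moreover have "parity_op (\<iota> k a (parity_op v)) = - \<iota> k a v"
      "parity_op (\<iota> k a (S (parity_op v))) = - \<iota> k a (parity_op (S (parity_op v)))"
      using parity_op_rep[OF a] by (simp_all add: parity_op_involution koszul_def)
    ultimately show ?thesis using clinear_minus[OF tail_bounded[OF S]] by simp
  qed
  \<comment> \<open>Twice the odd part of \<open>T\<close>; it anticommutes with
    \<open>parity_op\<close>.\<close>
  define D where "D v = T v - T' v" for v
  have D: "D \<in> tail" using tail_diff[OF T T'] unfolding D_def .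
  have bD: "bounded_clinear D" by (rule tail_bounded[OF D])
  have UD: "parity_op (D v) = - D (parity_op v)" for v
    by (simp add: D_def T'_def clinear_diff[OF parity_op_bounded] parity_op_involution)
  have "parity_op \<circ> D \<in> commutant (gens UNIV)"
  proof -
    have "parity_op (D (\<iota> k a v)) = \<iota> k a (parity_op (D v))" if a: "parity \<theta> p a" for k a p v
    proof (cases p)
      case True
      hence "D (\<iota> k a v) = \<iota> k a (parity_op (D (parity_op v)))" using odd[OF D] a by simp
      also have "parity_op (D (parity_op v)) = - D v" by (simp add: UD parity_op_involution)
      finally show ?thesis using parity_op_rep[OF a] True
        by (simp add: clinear_minus[OF parity_op_bounded] clinear_minus[OF rep_bounded] koszul_def)
    next
      case False
      thus ?thesis using even[OF D] a parity_op_rep[OF a] by simp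
    qed
    thus ?thesis using bounded_clinear_comp[OF parity_op_bounded bD] by (auto simp: commutant_iff gens_def)
  qed
  moreover have "adj D \<in> alg UNIV" using tail_adj[OF D] tail_subset_alg_UNIV by blast
  ultimately have comm: "adj D (parity_op (D v)) = parity_op (D (adj D v))" for v
    unfolding commutant_iff[of "adj D"] by (metis o_apply)
  have adjU: "adj D (parity_op v) = - parity_op (adj D v)" for v
  proof (rule cinner_eqI)
    fix u
    have "cinner u (adj D (parity_op v)) = cinner (parity_op (D u)) v" by (simp add: cinner_adj[OF bD, symmetric] parity_op_selfadjoint)
    also have "\<dots> = cinner u (- parity_op (adj D v))"
      by (simp add: UD cinner.minus_left cinner.minus_right cinner_adj[OF bD] parity_op_selfadjoint)
    finally show "cinner u (adj D (parity_op v)) = cinner u (- parity_op (adj D v))" .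
  qed
  have D0: "D v = 0" for v
  proof -
    have "- adj D (D v) = D (adj D v)"
      using comm[of v] adjU[of "D v"] by (metis parity_op_involution clinear_minus[OF parity_op_bounded])
    hence "cinner (- adj D (D v)) v = cinner (D (adj D v)) v" by simp
    \<comment> \<open>A nonpositive number equals a nonnegative one, so both vanish.\<close>
    hence "- cinner (D v) (D v) = cinner (adj D v) (adj D v)"
      by (simp add: cinner.minus_left cinner_adj'[OF bD] cinner_adj[OF bD])
    hence "- (norm (D v))\<^sup>2 = (norm (adj D v))\<^sup>2" by (metis norm_sq_cinner uminus_complex.sel(1))
    hence "(norm (D v))\<^sup>2 \<le> 0" using zero_le_power2[of "norm (adj D v)"] by linarith
    thus ?thesis by simp
  qed
  have T_even: "parity_op (T (parity_op v)) = T v" for v using D0[of v] unfolding D_def T'_def o_apply by simp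
  have "T (\<iota> k a v) = \<iota> k a (T v)" if "parity \<theta> p a" for k a p v
    using that odd[OF T, of a k v] even[OF T, of a k v] by (cases p) (simp_all add: T_even)
  thus ?thesis using bT by (auto simp: commutant_iff gens_def)
qed

end

section \<open>Exchangeability implies conditional independence\<close>

context graded_exchangeable
begin

lemma tail_commutes:
  assumes "T \<in> tail" "X \<in> alg UNIV"
  shows "T (X v) = X (T v)"
  using assms(2) tail_central[OF assms(1)] unfolding commutant_iff[of X] by auto

lemma tail_commutes_word: "T \<in> tail \<Longrightarrow> T (W w v) = W w (T v)"
  by (rule tail_commutes) (auto intro: W_alg)

text \<open>Distant copies of an even word commute with \<open>W u\<close> without sign, so
  convergence at \<open>W u \<xi>\<close> is inherited from \<open>\<xi>\<close>. By the uniform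
  bound \<open>average_norm\<close> the vectors of convergence form a closed subspace, and word
  vectors are total.\<close>

lemma average_converges:
  assumes w: "indices w \<subseteq> {..<L}" and even: "word_parity \<theta> False w"
  shows "convergent (\<lambda>N. average L w N v)"
proof -
  obtain \<eta> where \<eta>: "(\<lambda>N. average L w N \<xi>) \<longlonglongrightarrow> \<eta>" by (rule average_xi[OF w])
  define K where "K = {v. convergent (\<lambda>N. average L w N v)}"
  define C where "C = word_norm w + 1"
  have Cbound: "norm (average L w N v) \<le> C * norm v" for N v
    using average_norm[of L w N v] by (simp add: C_def distrib_right add_increasing2)
  have word: "(\<lambda>N. average L w N (W u \<xi>)) \<longlonglongrightarrow> W u \<eta>" if u: "word_parity \<theta> q u" for u q
  proof -
    obtain m0 where m0: "indices u \<subseteq> {..<m0}" using bound_indices[OF finite_indices] by blast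
    have "W (copy L m w) (W u \<xi>) - W u (W (copy L m w) \<xi>) = 0" if m: "m \<ge> m0" for m
    proof -
      have "indices (copy L m w) \<inter> indices u = {}"
      \<comment> \<open>With \<open>L = 0\<close> all copies coincide, but then \<open>w\<close> has
        no indices at all.\<close>
      proof (cases "L = 0")
        case True
        thus ?thesis using w by (simp add: copy_def)
      next
        case False
        hence "m0 \<le> m * L" using m by (metis le_trans mult_le_mono2 mult.right_neutral less_one not_le)
        thus ?thesis using copy_indices[OF w, of m] m0 by fastforce
      qed
      from commute_words[OF _ u this, of False] show ?thesis
        using word_parity_relabel[OF even] by (simp add: copy_def)
    qed
    from cesaro_null[of m0 "\<lambda>m. W (copy L m w) (W u \<xi>) - W u (W (copy L m w) \<xi>)", OF this]
    have "(\<lambda>N. average L w N (W u \<xi>) - W u (average L w N \<xi>)) \<longlonglongrightarrow> 0"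
      by (simp add: average_def sum_subtractf scaleR_right_diff_distrib clinear_scaleR[OF W_bounded]
          clinear_sum[OF W_bounded])
    from tendsto_add[OF this clinear_tendsto[OF W_bounded \<eta>, of u]] show ?thesis by simp
  qed
  have K: "closed_csubspace K"
    unfolding closed_csubspace_def
  proof (intro conjI ballI allI)
    show "closed K"
      unfolding closed_sequential_limits
    proof (intro allI impI, elim conjE)
      fix k v assume k: "\<forall>n. k n \<in> K" and lim: "k \<longlonglongrightarrow> v"
      have "Cauchy (\<lambda>N. average L w N v)"
      proof (rule CauchyI)
        fix e :: real assume e: "0 < e"
        have C0: "C > 0"
        proof -
          have "0 \<le> word_norm w" unfolding word_norm_def by (induction w) auto
          thus ?thesis by (simp add: C_def)
        qed
        have "e / (3 * C) > 0" using e C0 by simp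
        then obtain n where n: "norm (k n - v) < e / (3 * C)" using lim unfolding LIMSEQ_iff by blast
        hence d: "C * norm (k n - v) < e / 3" using C0 by (simp add: field_simps)
        have "Cauchy (\<lambda>N. average L w N (k n))" using k convergent_Cauchy by (auto simp: K_def)
        then obtain M where M: "\<And>p q. p \<ge> M \<Longrightarrow> q \<ge> M \<Longrightarrow> norm (average L w p (k n) - average L w q (k n)) < e / 3"
          using e CauchyD[of "\<lambda>N. average L w N (k n)" "e / 3"] by auto
        have "norm (average L w p v - average L w q v) < e" if "p \<ge> M" "q \<ge> M" for p q
        proof -
          have "average L w p v - average L w q v = (average L w p (k n) - average L w q (k n))
              - (average L w p (k n - v) - average L w q (k n - v))"
            by (simp add: clinear_diff[OF average_bounded])
          also have "norm \<dots> \<le> norm (average L w p (k n) - average L w q (k n))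
              + (norm (average L w p (k n - v)) + norm (average L w q (k n - v)))"
            by (intro order_trans[OF norm_triangle_ineq4] add_mono norm_triangle_ineq4 order_refl)
          also have "\<dots> < e / 3 + (e / 3 + e / 3)"
            using M[OF that] Cbound[of p "k n - v"] Cbound[of q "k n - v"] d by linarith
          finally show ?thesis by simp
        qed
        thus "\<exists>M. \<forall>p\<ge>M. \<forall>q\<ge>M. norm (average L w p v - average L w q v) < e" by blast
      qed
      thus "v \<in> K" by (simp add: K_def Cauchy_convergent)
    qed
    show "0 \<in> K" by (simp add: K_def clinear_zero[OF average_bounded] convergent_const)
    show "x + y \<in> K" if "x \<in> K" "y \<in> K" for x y
      using that by (simp add: K_def clinear_add[OF average_bounded] convergent_add)
    show "c *\<^sub>C x \<in> K" if x: "x \<in> K" for c x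
    proof -
      obtain l where "(\<lambda>N. average L w N x) \<longlonglongrightarrow> l" using x by (auto simp: K_def convergent_def)
      hence "(\<lambda>N. c *\<^sub>C average L w N x) \<longlonglongrightarrow> c *\<^sub>C l"
        by (rule bounded_linear.tendsto[OF bounded_linear_scaleC])
      thus ?thesis by (auto simp: K_def convergent_def clinear_scaleC[OF average_bounded])
    qed
  qed
  have "v - proj K v = 0"
  proof (rule words_total)
    fix u q assume "word_parity \<theta> q u"
    from word[OF this] have "W u \<xi> \<in> K" by (auto simp: K_def convergent_def)
    thus "cinner (W u \<xi>) (v - proj K v) = 0" using proj_orth[OF K] cinner_swap_zero by blast
  qed
  hence "v \<in> K" using proj_in[OF K, of v] by simp
  thus ?thesis by (simp add: K_def)
qed

text \<open>For an even word the strong limit is the required element: finitely many copies do not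
  affect it, so it lies in \<open>alg {n..}\<close> for every \<open>n\<close>. For an odd word the
  tail element is 0.\<close>

lemma mean_in_tail:
  assumes w: "indices w \<subseteq> {..<L}" and "0 < L" and par: "word_parity \<theta> q w"
  obtains T where "T \<in> tail" "(\<lambda>N. average L w N \<xi>) \<longlonglongrightarrow> T \<xi>"
proof (cases q)
  case True
  \<comment> \<open>The zero operator, written as a difference so that \<open>tail_diff\<close>
    applies.\<close>
  have "(\<lambda>v. id v - id v) \<in> tail" by (rule tail_diff[OF tail_id tail_id])
  moreover have "(\<lambda>N. average L w N \<xi>) \<longlonglongrightarrow> (\<lambda>v. id v - id v) \<xi>"
    using average_odd[OF w] par True by simp
  ultimately show ?thesis by (rule that)
next
  case False
  define T where "T v = lim (\<lambda>N. average L w N v)" for v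
  have lim: "(\<lambda>N. average L w N v) \<longlonglongrightarrow> T v" for v
    unfolding T_def convergent_LIMSEQ_iff[symmetric] by (rule average_converges[OF w]) (use par False in simp)
  have bT: "bounded_clinear T"
  proof (rule bounded_clinearI)
    fix x y c
    have "(\<lambda>N. average L w N (x + y)) \<longlonglongrightarrow> T x + T y"
      unfolding clinear_add[OF average_bounded] by (intro tendsto_add lim)
    thus "T (x + y) = T x + T y" by (rule LIMSEQ_unique[OF lim])
    have "(\<lambda>N. average L w N (c *\<^sub>C x)) \<longlonglongrightarrow> c *\<^sub>C T x"
      unfolding clinear_scaleC[OF average_bounded] by (intro bounded_linear.tendsto[OF bounded_linear_scaleC] lim)
    thus "T (c *\<^sub>C x) = c *\<^sub>C T x" by (rule LIMSEQ_unique[OF lim])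
    show "norm (T x) \<le> word_norm w * norm x"
      by (rule LIMSEQ_le_const2[OF tendsto_norm[OF lim]]) (use average_norm in blast)
  qed
  have "T \<in> alg {n..}" for n
  proof -
    have "T (S v) = S (T v)" if S: "S \<in> commutant (gens {n..})" for S v
    proof -
      have bS: "bounded_clinear S" by (rule commutant_bounded[OF S])
      have "W (copy L m w) (S v) - S (W (copy L m w) v) = 0" if "m \<ge> n" for m
      proof -
        have "n \<le> m * L" using that \<open>0 < L\<close> by (metis le_trans mult_le_mono2 mult.right_neutral Suc_leI One_nat_def)
        hence "indices (copy L m w) \<subseteq> {n..}" using copy_indices[OF w, of m] by fastforce
        hence "W (copy L m w) \<in> alg {n..}" by (rule W_alg)
        thus ?thesis using S by (simp add: commutant_iff[of "W (copy L m w)"])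
      qed
      from cesaro_null[of n "\<lambda>m. W (copy L m w) (S v) - S (W (copy L m w) v)", OF this]
      have "(\<lambda>N. average L w N (S v) - S (average L w N v)) \<longlonglongrightarrow> 0"
        by (simp add: average_def sum_subtractf scaleR_right_diff_distrib clinear_scaleR[OF bS]
            clinear_sum[OF bS])
      moreover have "(\<lambda>N. average L w N (S v) - S (average L w N v)) \<longlonglongrightarrow> T (S v) - S (T v)"
        by (intro tendsto_diff lim clinear_tendsto[OF bS])
      ultimately have "T (S v) - S (T v) = 0" by (metis LIMSEQ_unique)
      thus ?thesis by simp
    qed
    thus ?thesis using bT by (simp add: commutant_iff[of T])
  qed
  hence "T \<in> tail" by (simp add: tail_def)
  thus ?thesis using lim by (rule that)
qed

text \<open>\<open>T \<xi>\<close> lies in the closed span of word vectors with arbitrarily distant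
  indices. Extended by the identity to those indices, the relabelling stays injective, so
  exchangeability moves \<open>u\<close> and leaves the distant words alone.\<close>

lemma tail_functional_relabel:
  assumes f: "inj_on f (indices u)" and T: "T \<in> tail"
  shows "cinner (W u \<xi>) (T \<xi>) = cinner (W (relabel f u) \<xi>) (T \<xi>)"
proof -
  obtain n where n: "indices u \<union> f ` indices u \<subseteq> {..<n}"
    by (rule bound_indices[of "indices u \<union> f ` indices u"]) simp
  have "cinner (T \<xi>) (W u \<xi> - W (relabel f u) \<xi>) = 0"
  proof (rule alg_density)
    show "T \<in> alg {n..}" using T tail_subset_alg by blast
    fix w :: "(nat \<times> 'a) list" assume w: "indices w \<subseteq> {n..}"
    define g where "g j = (if j \<in> indices u then f j else j)" for j
    have "inj_on g (indices w \<union> indices u)"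
      unfolding inj_on_def
    proof (intro ballI impI)
      fix i j assume ij: "i \<in> indices w \<union> indices u" "j \<in> indices w \<union> indices u" and eq: "g i = g j"
      have u: "f k < n" "k < n" if "k \<in> indices u" for k using n that by auto
      have w': "k \<ge> n" if "k \<in> indices w" for k using w that by auto
      show "i = j"
        using ij eq u[of i] u[of j] w'[of i] w'[of j] inj_onD[OF f, of i j]
        by (auto simp: g_def split: if_splits)
    qed
    from exchangeable_inj_inner[OF exch this]
    have "cinner (W w \<xi>) (W u \<xi>) = cinner (W (relabel g w) \<xi>) (W (relabel g u) \<xi>)" .
    moreover have "relabel g w = w"
      by (rule relabel_fixed) (use n w in \<open>fastforce simp: g_def\<close>)
    moreover have "relabel g u = relabel f u" by (rule relabel_cong) (simp add: g_def)
    ultimately show "cinner (W w \<xi>) (W u \<xi> - W (relabel f u) \<xi>) = 0" by (simp add: cinner.diff_right)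
  qed
  hence "cinner (W u \<xi> - W (relabel f u) \<xi>) (T \<xi>) = 0" using cinner_swap_zero by blast
  thus ?thesis by (simp add: cinner.diff_left)
qed

abbreviation join :: "nat set \<Rightarrow> ('h \<Rightarrow> 'h) set" where
  "join I \<equiv> commutant (commutant (gens I \<union> tail))"

lemma join_subset_alg: "join I \<subseteq> alg UNIV"
  by (rule bicommutant_least) (use gens_alg[of UNIV] gens_mono[of I UNIV] tail_subset_alg_UNIV in blast)

lemma adj_closed_join: "adj_closed (join I)"
proof -
  have "adj_closed (gens I \<union> tail)"
    using adj_closed_gens[of I] tail_adj tail_bounded unfolding adj_closed_def by blast
  thus ?thesis by (intro adj_closed_commutant)
qed

text \<open>Tail elements commute with words and can be gathered next to \<open>\<xi>\<close>, so
  the vectors \<open>W w (T \<xi>)\<close> are stable under the generators of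
  \<open>join I\<close>.\<close>

lemma join_density:
  assumes X: "X \<in> join I"
    and u: "\<And>w q T. word_parity \<theta> q w \<Longrightarrow> indices w \<subseteq> I \<Longrightarrow> T \<in> tail \<Longrightarrow> cinner (W w (T \<xi>)) u = 0"
  shows "cinner (X \<xi>) u = 0"
proof (rule bicommutant_density[OF _ _ X])
  let ?V = "{W w (T \<xi>) | w q T. word_parity \<theta> q w \<and> indices w \<subseteq> I \<and> T \<in> tail}"
  show "adj_closed (gens I \<union> tail)"
    using adj_closed_gens[of I] tail_adj tail_bounded unfolding adj_closed_def by blast
  show "s v \<in> ?V" if s: "s \<in> gens I \<union> tail" and v: "v \<in> ?V" for s v
  proof -
    obtain w q T where w: "v = W w (T \<xi>)" "word_parity \<theta> q w" "indices w \<subseteq> I" "T \<in> tail" using v by blast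
    show ?thesis
    proof (cases "s \<in> gens I")
      case True
      then obtain j a p where s: "s = \<iota> j a" "j \<in> I" "parity \<theta> p a" unfolding gens_def by blast
      have "s v = W ((j, a) # w) (T \<xi>)" "indices ((j, a) # w) \<subseteq> I" using s w by simp_all
      thus ?thesis using word_parity.Cons[OF s(3) w(2)] w(4) by blast
    next
      case False
      hence "s \<in> tail" using s by blast
      hence "s v = W w ((s \<circ> T) \<xi>)" "s \<circ> T \<in> tail"
        using tail_commutes_word tail_comp w(4) by (simp_all add: w(1))
      thus ?thesis using w by blast
    qed
  qed
  have "\<xi> = W [] (id \<xi>)" "word_parity \<theta> False []" "indices [] \<subseteq> I" by (simp_all add: word_parity.Nil)
  thus "\<xi> \<in> ?V" using tail_id by blast
  show "cinner v u = 0" if "v \<in> ?V" for v using that u by blast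
qed

end

section \<open>Factorisation of the expectation\<close>

locale graded_exchangeable_expectation = graded_exchangeable \<theta> \<iota> \<xi> + graded_expectation \<theta> \<iota> \<xi> E
  for \<theta> :: "'a::unital_cstar_algebra \<Rightarrow> 'a"
    and \<iota> :: "nat \<Rightarrow> 'a \<Rightarrow> 'h::chilbert_space \<Rightarrow> 'h"
    and \<xi> :: 'h and E :: "('h \<Rightarrow> 'h) \<Rightarrow> 'h \<Rightarrow> 'h"
begin

lemma tail_alg: "T \<in> tail \<Longrightarrow> T \<in> alg UNIV"
  using tail_subset_alg_UNIV by blast

text \<open>The module property puts \<open>adj T\<close> inside the expectation, and preservation
  of the state then removes \<open>E\<close>.\<close>

lemma E_inner:
  assumes X: "X \<in> alg UNIV" and T: "T \<in> tail"
  shows "cinner (E X \<xi>) (T \<xi>) = cinner (X \<xi>) (T \<xi>)"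
proof -
  have bT: "bounded_clinear T" by (rule tail_bounded[OF T])
  have "adj T \<circ> X \<in> alg UNIV" by (intro commutant_comp tail_alg tail_adj T X)
  moreover have "E (adj T \<circ> X) = adj T \<circ> E X" using E_module[OF X tail_adj[OF T] tail_id] by simp
  ultimately show ?thesis using E_state[of "adj T \<circ> X"] by (simp add: cinner_adj'[OF bT])
qed

text \<open>Tail elements lie in the commutant, for which the cyclic vector \<open>\<xi>\<close> is separating.\<close>

lemma E_eqI:
  assumes X: "X \<in> alg UNIV" and T: "T \<in> tail"
    and eq: "\<And>S. S \<in> tail \<Longrightarrow> cinner (X \<xi>) (S \<xi>) = cinner (T \<xi>) (S \<xi>)"
  shows "E X = T"
proof -
  define D where "D v = E X v - T v" for v
  have D: "D \<in> tail" unfolding D_def by (rule tail_diff[OF E_tail[OF X] T])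
  \<comment> \<open>\<open>D\<close> lies in the tail algebra, so it may serve as its own test
    element.\<close>
  have "cinner (D \<xi>) (D \<xi>) = 0"
    using E_inner[OF X D] eq[OF D] by (simp add: D_def cinner.diff_left)
  hence D0: "D \<xi> = 0" by (simp add: cinner_eq_zero)
  have "D = (\<lambda>_. 0)"
  proof (rule eq_on_words[OF tail_bounded[OF D]])
    show "bounded_clinear (\<lambda>_. 0 :: 'h)" by (rule bounded_clinearI[where B=0]) (simp_all add: scaleC_zero_right)
    show "D (W w \<xi>) = 0" for w using tail_commutes_word[OF D] by (simp add: D0 clinear_zero[OF W_bounded])
  qed
  hence "E X v - T v = 0" for v unfolding D_def by metis
  thus ?thesis by (intro ext) simp
qed

lemma identically_distributed_E: "identically_distributed \<iota> E"
  unfolding identically_distributed_def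
proof (intro allI)
  fix j k a
  have alg: "\<iota> i a \<in> alg UNIV" for i by (rule rep_alg) simp
  show "E (\<iota> j a) = E (\<iota> k a)"
  proof (rule E_eqI[OF alg E_tail[OF alg]])
    fix S assume S: "S \<in> tail"
    \<comment> \<open>The constant map to \<open>k\<close> is injective on the single index
      \<open>j\<close>.\<close>
    show "cinner (\<iota> j a \<xi>) (S \<xi>) = cinner (E (\<iota> k a) \<xi>) (S \<xi>)"
      using tail_functional_relabel[OF _ S, of "\<lambda>_. k" "[(j, a)]"] E_inner[OF alg S] by simp
  qed
qed

text \<open>The weak form of \<open>E (X \<circ> Y) = E X \<circ> E Y\<close>, tested on tail
  vectors; \<open>E_eqI\<close> turns it into the operator identity.\<close>

definition factorizes :: "('h \<Rightarrow> 'h) \<Rightarrow> ('h \<Rightarrow> 'h) \<Rightarrow> bool" where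
  "factorizes X Y \<longleftrightarrow> (\<forall>S\<in>tail. cinner (X (Y \<xi>)) (S \<xi>) = cinner (E X (E Y \<xi>)) (S \<xi>))"

lemma factorizes_words:
  assumes y: "word_parity \<theta> q y" and disj: "indices x \<inter> indices y = {}"
  shows "factorizes (W x) (W y)"
proof -
  obtain L where L: "0 < L" "indices x \<union> indices y \<subseteq> {..<L}"
    using bound_indices[of "indices x \<union> indices y"] by auto
  have yL: "indices y \<subseteq> {..<L}" and xL: "indices x \<subseteq> {..<L}" using L by auto
  obtain T where T: "T \<in> tail" and lim: "(\<lambda>N. average L y N \<xi>) \<longlonglongrightarrow> T \<xi>"
    by (rule mean_in_tail[OF yL L(1) y])
  have mean: "cinner (W z (W y \<xi>)) (S \<xi>) = cinner (W z (T \<xi>)) (S \<xi>)"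
    if zL: "indices z \<subseteq> {..<L}" and z: "indices z \<inter> indices y = {}" and S: "S \<in> tail" for z S
  proof -
    have copy: "cinner (W z (W (copy L m y) \<xi>)) (S \<xi>) = cinner (W z (W y \<xi>)) (S \<xi>)" for m
    proof -
      define f where "f j = (if j \<in> indices y then j + m * L else j)" for j
      have "inj_on f (indices (z @ y))"
        unfolding inj_on_def
      proof (intro ballI impI)
        fix i j assume ij: "i \<in> indices (z @ y)" "j \<in> indices (z @ y)" and eq: "f i = f j"
        \<comment> \<open>For \<open>m = 0\<close> disjointness of the words excludes a collision;
          for \<open>m > 0\<close> the shifted index is at least \<open>L\<close>.\<close>
        have no: "a \<noteq> b + m * L" if "a \<in> indices z" "b \<in> indices y" for a b
        proof
          assume ab: "a = b + m * L"
          have "a < L" using zL that(1) by auto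
          hence "m * L < 1 * L" using ab by linarith
          hence "m = 0" by (simp only: mult_less_cancel2) simp
          thus False using ab that z by auto
        qed
        show "i = j" using ij eq no[of i j] no[of j i] z by (auto simp: f_def split: if_splits)
      qed
      from tail_functional_relabel[OF this S]
      have "cinner (W (z @ y) \<xi>) (S \<xi>) = cinner (W (relabel f z @ relabel f y) \<xi>) (S \<xi>)" by simp
      moreover have "relabel f z = z" by (rule relabel_fixed) (use z in \<open>auto simp: f_def\<close>)
      moreover have "relabel f y = copy L m y" unfolding copy_def by (rule relabel_cong) (simp add: f_def)
      ultimately show ?thesis by (simp add: W_append)
    qed
    have "cinner (W z (average L y N \<xi>)) (S \<xi>) = cinner (W z (W y \<xi>)) (S \<xi>)" if "N > 0" for N
      using that
      by (simp add: average_def clinear_scaleR[OF W_bounded] clinear_sum[OF W_bounded] cinner.scaleR_left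
          cinner.sum_left copy scaleR_conv_of_real)
    hence ev: "\<forall>\<^sub>F N in sequentially. cinner (W z (average L y N \<xi>)) (S \<xi>) = cinner (W z (W y \<xi>)) (S \<xi>)"
      by (rule eventually_mono[OF eventually_gt_at_top[of "0::nat"]])
    have "(\<lambda>N. cinner (W z (average L y N \<xi>)) (S \<xi>)) \<longlonglongrightarrow> cinner (W z (T \<xi>)) (S \<xi>)"
      by (intro cinner.tendsto clinear_tendsto[OF W_bounded] lim tendsto_const)
    from Lim_transform_eventually[OF this ev] show ?thesis by (simp add: LIMSEQ_const_iff)
  qed
  have algW: "W w \<in> alg UNIV" for w by (rule W_alg) simp
  \<comment> \<open>The empty word in place of \<open>z\<close> identifies the limit with the
    expectation.\<close>
  have EY: "E (W y) = T"
    by (rule E_eqI[OF algW T]) (use mean[of "[]"] in simp)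
  show ?thesis
    unfolding factorizes_def
  proof
    fix S assume S: "S \<in> tail"
    have bT: "bounded_clinear T" by (rule tail_bounded[OF T])
    have TS: "adj T \<circ> S \<in> tail" by (intro tail_comp tail_adj T S)
    \<comment> \<open>Centrality moves \<open>T\<close> to the left, its adjoint joins the test
      element \<open>S\<close>, and \<open>E_inner\<close> then replaces \<open>W x\<close> by its
      expectation.\<close>
    have "cinner (W x (W y \<xi>)) (S \<xi>) = cinner (T (W x \<xi>)) (S \<xi>)"
      using mean[OF xL disj S] tail_commutes_word[OF T] by simp
    also have "\<dots> = cinner (W x \<xi>) ((adj T \<circ> S) \<xi>)" by (simp add: cinner_adj[OF bT])
    also have "\<dots> = cinner (E (W x) \<xi>) ((adj T \<circ> S) \<xi>)" by (rule E_inner[OF algW TS, symmetric])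
    also have "\<dots> = cinner (T (E (W x) \<xi>)) (S \<xi>)" by (simp add: cinner_adj[OF bT])
    also have "T (E (W x) \<xi>) = E (W x) (T \<xi>)" by (rule tail_commutes[OF T tail_alg[OF E_tail[OF algW]]])
    finally show "cinner (W x (W y \<xi>)) (S \<xi>) = cinner (E (W x) (E (W y) \<xi>)) (S \<xi>)" by (simp add: EY)
  qed
qed

text \<open>Isolates \<open>Y \<xi>\<close> in the first slot, the shape to which
  \<open>join_density\<close> applies for fixed \<open>X\<close>.\<close>

lemma factorizes_right:
  assumes X: "X \<in> alg UNIV" and Y: "Y \<in> alg UNIV"
  shows "factorizes X Y \<longleftrightarrow> (\<forall>S\<in>tail. cinner (Y \<xi>) (adj X (S \<xi>) - adj (E X) (S \<xi>)) = 0)"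
proof -
  have "cinner (E X (E Y \<xi>)) (S \<xi>) = cinner (Y \<xi>) (adj (E X) (S \<xi>))" if S: "S \<in> tail" for S
    using E_inner[OF Y tail_comp[OF tail_adj[OF E_tail[OF X]] S]]
    by (simp add: cinner_adj[OF tail_bounded[OF E_tail[OF X]]])
  thus ?thesis
    unfolding factorizes_def by (simp add: cinner_adj[OF commutant_bounded[OF X]] cinner.diff_right)
qed

text \<open>In the product \<open>X\<close> acts on \<open>Y \<xi>\<close> and not on
  \<open>\<xi>\<close>, so density at \<open>\<xi>\<close> cannot be used for \<open>X\<close>
  directly. Taking the adjoint, and using that tail elements commute with \<open>X\<close>, isolates
  \<open>adj X \<xi>\<close> instead.\<close>

lemma factorizes_left:
  assumes X: "X \<in> alg UNIV" and Y: "Y \<in> alg UNIV"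
  shows "factorizes X Y \<longleftrightarrow> (\<forall>S\<in>tail. cinner (adj X \<xi>) (adj S (Y \<xi>) - adj S (E Y \<xi>)) = 0)"
proof -
  have bX: "bounded_clinear X" by (rule commutant_bounded[OF X])
  have EX: "E X \<in> tail" and EY: "E Y \<in> tail" using E_tail X Y by blast+
  have "cinner (X (Y \<xi>)) (S \<xi>) = cinner (adj S (Y \<xi>)) (adj X \<xi>)
      \<and> cinner (E X (E Y \<xi>)) (S \<xi>) = cinner (adj S (E Y \<xi>)) (adj X \<xi>)" if S: "S \<in> tail" for S
  proof
    have bS: "bounded_clinear S" by (rule tail_bounded[OF S])
    have S': "adj S \<in> tail" by (rule tail_adj[OF S])
    show "cinner (X (Y \<xi>)) (S \<xi>) = cinner (adj S (Y \<xi>)) (adj X \<xi>)"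
      using tail_commutes[OF S' X, of "Y \<xi>"]
      by (simp add: cinner_adj'[OF bS, symmetric] cinner_adj[OF bX, symmetric])
    define R where "R = adj S \<circ> E Y"
    have R: "R \<in> tail" unfolding R_def by (intro tail_comp S' EY)
    have bR: "bounded_clinear R" by (rule tail_bounded[OF R])
    have "cinner (E X (E Y \<xi>)) (S \<xi>) = cinner (adj S (E X (E Y \<xi>))) \<xi>" by (simp add: cinner_adj'[OF bS])
    also have "adj S (E X (E Y \<xi>)) = E X (R \<xi>)"
      using tail_commutes[OF S' tail_alg[OF EX]] by (simp add: R_def)
    also have "E X (R \<xi>) = R (E X \<xi>)" using tail_commutes[OF R tail_alg[OF EX]] by simp
    also have "cinner (R (E X \<xi>)) \<xi> = cinner (E X \<xi>) (adj R \<xi>)" by (rule cinner_adj[OF bR])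
    also have "\<dots> = cinner (X \<xi>) (adj R \<xi>)" by (rule E_inner[OF X tail_adj[OF R]])
    also have "\<dots> = cinner (R (X \<xi>)) \<xi>" by (rule cinner_adj[OF bR, symmetric])
    also have "R (X \<xi>) = X (R \<xi>)" by (rule tail_commutes[OF R X])
    also have "cinner (X (R \<xi>)) \<xi> = cinner (R \<xi>) (adj X \<xi>)" by (rule cinner_adj[OF bX])
    finally show "cinner (E X (E Y \<xi>)) (S \<xi>) = cinner (adj S (E Y \<xi>)) (adj X \<xi>)" by (simp add: R_def)
  qed
  hence "factorizes X Y \<longleftrightarrow> (\<forall>S\<in>tail. cinner (adj S (Y \<xi>) - adj S (E Y \<xi>)) (adj X \<xi>) = 0)"
    unfolding factorizes_def by (simp add: cinner.diff_left)
  thus ?thesis using cinner_swap_zero by blast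
qed

text \<open>Extends \<open>factorizes_words\<close> one factor at a time: to general
  \<open>Y\<close> while \<open>X\<close> is a word, then to general \<open>X\<close>.\<close>

lemma factorizes_join:
  assumes disj: "I \<inter> J = {}" and X: "X \<in> join I" and Y: "Y \<in> join J"
  shows "factorizes X Y"
proof -
  have algW: "W w \<in> alg UNIV" for w by (rule W_alg) simp
  have algX: "X \<in> alg UNIV" and algY: "Y \<in> alg UNIV" using X Y join_subset_alg by blast+
  have word_right: "factorizes (W x) Y" if x: "indices x \<subseteq> I" for x :: "(nat \<times> 'a) list"
    unfolding factorizes_right[OF algW algY]
  proof
    fix S assume S: "S \<in> tail"
    show "cinner (Y \<xi>) (adj (W x) (S \<xi>) - adj (E (W x)) (S \<xi>)) = 0"
    proof (rule join_density[OF Y])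
      fix y q T assume y: "word_parity \<theta> q y" "indices y \<subseteq> J" and T: "T \<in> tail"
      have bT: "bounded_clinear T" by (rule tail_bounded[OF T])
      have T': "adj T \<in> tail" by (rule tail_adj[OF T])
      have "factorizes (W x) (W y)" by (rule factorizes_words[OF y(1)]) (use x y(2) disj in blast)
      \<comment> \<open>The tail factor of the vector \<open>W y (T \<xi>)\<close> is absorbed by
        the test element, which becomes \<open>adj T \<circ> S\<close>.\<close>
      hence "cinner (W y \<xi>) (adj (W x) ((adj T \<circ> S) \<xi>) - adj (E (W x)) ((adj T \<circ> S) \<xi>)) = 0"
        using factorizes_right[OF algW algW] tail_comp[OF T' S] by blast
      also have "adj (W x) ((adj T \<circ> S) \<xi>) = adj T (adj (W x) (S \<xi>))"
        using tail_commutes_word[OF T'] by (simp add: adj_W)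
      also have "adj (E (W x)) ((adj T \<circ> S) \<xi>) = adj T (adj (E (W x)) (S \<xi>))"
        using tail_commutes[OF T' tail_alg[OF tail_adj[OF E_tail[OF algW]]]] by simp
      finally have "cinner (T (W y \<xi>)) (adj (W x) (S \<xi>) - adj (E (W x)) (S \<xi>)) = 0"
        by (simp add: cinner_adj[OF bT] clinear_diff[OF bounded_clinear_adj[OF bT]])
      thus "cinner (W y (T \<xi>)) (adj (W x) (S \<xi>) - adj (E (W x)) (S \<xi>)) = 0"
        by (simp add: tail_commutes_word[OF T])
    qed
  qed
  show ?thesis
    unfolding factorizes_left[OF algX algY]
  proof
    fix S assume S: "S \<in> tail"
    have "adj X \<in> join I" using adj_closed_join X unfolding adj_closed_def by blast
    thus "cinner (adj X \<xi>) (adj S (Y \<xi>) - adj S (E Y \<xi>)) = 0"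
    proof (rule join_density)
      fix x :: "(nat \<times> 'a) list" and T assume x: "indices x \<subseteq> I" and T: "T \<in> tail"
      have bT: "bounded_clinear T" and bS: "bounded_clinear S" using tail_bounded T S by blast+
      \<comment> \<open>The starred word is taken because its adjoint is \<open>W x\<close>; the
        tail factor is again absorbed, now as \<open>S \<circ> T\<close>.\<close>
      have "factorizes (W (word_star x)) Y" by (rule word_right) (use x in simp)
      hence "cinner (adj (W (word_star x)) \<xi>) (adj (S \<circ> T) (Y \<xi>) - adj (S \<circ> T) (E Y \<xi>)) = 0"
        using factorizes_left[OF algW algY] tail_comp[OF S T] by blast
      hence "cinner (W x \<xi>) (adj T (adj S (Y \<xi>) - adj S (E Y \<xi>))) = 0"
        by (simp add: adj_comp[OF bS bT] clinear_diff[OF bounded_clinear_adj[OF bT]]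
            adj_W[symmetric] adj_adj[OF W_bounded])
      thus "cinner (W x (T \<xi>)) (adj S (Y \<xi>) - adj S (E Y \<xi>)) = 0"
        by (simp add: cinner_adj[OF bT, symmetric] tail_commutes_word[OF T])
    qed
  qed
qed

lemma conditionally_independent_E: "conditionally_independent \<iota> tail E"
  unfolding conditionally_independent_def vN_gen_join_tail
proof (intro allI impI ballI)
  fix I J :: "nat set" and X Y
  assume IJ: "I \<inter> J = {}" and X: "X \<in> join I" and Y: "Y \<in> join J"
  have algX: "X \<in> alg UNIV" and algY: "Y \<in> alg UNIV" using X Y join_subset_alg by blast+
  show "E (X \<circ> Y) = E X \<circ> E Y"
  proof (rule E_eqI)
    show "X \<circ> Y \<in> alg UNIV" by (rule commutant_comp[OF algX algY])
    show "E X \<circ> E Y \<in> tail" by (intro tail_comp E_tail algX algY)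
    show "cinner ((X \<circ> Y) \<xi>) (S \<xi>) = cinner ((E X \<circ> E Y) \<xi>) (S \<xi>)" if "S \<in> tail" for S
      using factorizes_join[OF IJ X Y] that by (simp add: factorizes_def)
  qed
qed

end

theorem theorem3p8:
  fixes \<theta> :: "'a::unital_cstar_algebra \<Rightarrow> 'a"
    and \<iota> :: "nat \<Rightarrow> 'a \<Rightarrow> 'h::chilbert_space \<Rightarrow> 'h"
    and \<xi> :: 'h
    and \<omega> :: "'a gt \<Rightarrow> complex"
    and \<pi> :: "'a gt \<Rightarrow> 'h \<Rightarrow> 'h"
    and E :: "('h \<Rightarrow> 'h) \<Rightarrow> 'h \<Rightarrow> 'h"
  defines "M \<equiv> commutant (commutant (\<pi> ` graded_tensor \<theta>))"
    and "Z \<equiv> tail_algebra \<theta> \<pi>"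
  assumes process: "graded_process \<theta> \<iota> \<xi>"
    and state: "gt_state \<theta> \<omega>"
    and gns: "gns_triple \<theta> \<omega> \<pi> \<xi>"
    and corresponds: "\<And>j a. \<iota> j a = \<pi> (gt_emb \<theta> j a)"
    and expectation: "conditional_expectation M Z E"
    and normal: "normal_on M E"
    and preserves: "\<And>X. X \<in> M \<Longrightarrow> cinner (E X \<xi>) \<xi> = cinner (X \<xi>) \<xi>"
  shows "exchangeable \<iota> \<xi> \<longleftrightarrow> conditionally_independent \<iota> Z E \<and> identically_distributed \<iota> E"
proof -
  interpret graded \<theta> \<iota> \<xi> by unfold_locales (rule process)
  have rep: "gt_rep \<theta> \<pi>" using gns unfolding gns_triple_def by blast
  have \<iota>: "(\<lambda>a. \<pi> (gt_emb \<theta> j a)) = \<iota> j" for j using corresponds by auto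
  have Z: "Z = tail"
    unfolding Z_def tail_algebra_eq[OF rep] \<iota> commutant_gens tail_def ..
  have "gens UNIV \<subseteq> \<pi> ` graded_tensor \<theta>"
    unfolding gens_def corresponds gt_emb_def graded_tensor_def using fp_emb_free_product by blast
  \<comment> \<open>This inclusion restricts the properties of \<open>E\<close> from
    \<open>M\<close> to the algebra generated by the process.\<close>
  hence M: "alg UNIV \<subseteq> M" unfolding M_def by (rule bicommutant_mono)
  interpret graded_expectation \<theta> \<iota> \<xi> E
  proof
    note ce = expectation[unfolded conditional_expectation_def Z]
    show "E X \<in> tail" if "X \<in> alg UNIV" for X using ce that M by blast
    show "E T = T" if "T \<in> tail" for T using ce that by blast
    show "E (S \<circ> X \<circ> T) = S \<circ> E X \<circ> T" if "X \<in> alg UNIV" "S \<in> tail" "T \<in> tail" for X S T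
      using ce that M by blast
    show "cinner (E X \<xi>) \<xi> = cinner (X \<xi>) \<xi>" if "X \<in> alg UNIV" for X using preserves that M by blast
  qed
  show ?thesis
  proof
    assume "exchangeable \<iota> \<xi>"
    then interpret graded_exchangeable_expectation \<theta> \<iota> \<xi> E by unfold_locales
    show "conditionally_independent \<iota> Z E \<and> identically_distributed \<iota> E"
      using conditionally_independent_E identically_distributed_E unfolding Z by blast
  next
    assume "conditionally_independent \<iota> Z E \<and> identically_distributed \<iota> E"
    thus "exchangeable \<iota> \<xi>" using exchangeable_if unfolding Z by blast
  qed
qed

end
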